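(* Let $\mu$ be an even, nonzero, finite Borel measure on $\mathbb{R}^n$ that is not supported in any lower-dimensional subspace of $\mathbb{R}^n$ and satisfies $\int_{\mathbb{R}^n}|x|\,d\mu(x)<\infty$. Then there exists $\varphi\in\mathcal{L}$ such that $$d\mu=\frac{|\mu|}{\mu_{\gamma_n}(\varphi,\mathbb{R}^n)}\,d\mu_{\gamma_n}(\varphi,\cdot),$$ where $|\mu|=\int_{\mathbb{R}^n}d\mu$ and $\mu_{\gamma_n}(\varphi,\mathbb{R}^n)=\int_{\mathbb{R}^n}d\mu_{\gamma_n}(\varphi,x)$.
   Context: Let $n\geq1$ and $c_{n+1}=(2\pi)^{-\frac{n+1}{2}}$. $\mathrm{Conv}(\mathbb{R}^n)$ is the set of convex, lower semi-continuous functions $\varphi:\mathbb{R}^n\to\mathbb{R}\cup\{+\infty\}$ with $\varphi\not\equiv+\infty$. $\mathcal{L}$ is the set of $\varphi\in\mathrm{Conv}(\mathbb{R}^n)$ with $\liminf_{|x|\to+\infty}\varphi(x)/|x|>0$, where $|\cdot|$ is the Euclidean norm. For $\varphi\in\mathcal{L}$, the Euclidean Gaussian moment measure $\mu_{\gamma_n}(\varphi,\cdot)$ of $\varphi$ is the Borel measure on $\mathbb{R}^n$ given, for every Borel set $\vartheta\subseteq\mathbb{R}^n$, by $$\mu_{\gamma_n}(\varphi,\vartheta)=c_{n+1}\int_{\{x\in\mathbb{R}^n:\ \nabla\varphi(x)\in\vartheta\}}e^{-\frac{\varphi(x)^2}{2}}e^{-\frac{|x|^2}{2}}\,dx,$$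 i.e. the push-forward of $c_{n+1}e^{-\varphi(x)^2/2}e^{-|x|^2/2}\,dx$ under $\nabla\varphi$ (the gradient exists almost everywhere in the interior of the effective domain $\{\varphi<+\infty\}$, and $e^{-\varphi(x)^2/2}=0$ where $\varphi(x)=+\infty$). A measure $\mu$ is even if $\mu(-\vartheta)=\mu(\vartheta)$ for every Borel set $\vartheta$. *)

theory Defs
  imports "HOL-Analysis.Analysis"
begin

text \<open>Functions with values in \<open>\<real> \<union> {+\<infinity>}\<close> are \<^typ>\<open>ereal\<close>-valued functions
  that never take the value \<open>-\<infinity>\<close>.\<close>

definition convex_ereal :: "('a::real_vector \<Rightarrow> ereal) \<Rightarrow> bool" where
  "convex_ereal \<phi> \<longleftrightarrow>
     (\<forall>x y. \<forall>t\<in>{0..1::real}.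
        \<phi> ((1 - t) *\<^sub>R x + t *\<^sub>R y) \<le> ereal (1 - t) * \<phi> x + ereal t * \<phi> y)"

definition lower_semicontinuous :: "('a::topological_space \<Rightarrow> ereal) \<Rightarrow> bool" where
  "lower_semicontinuous \<phi> \<longleftrightarrow> (\<forall>x. \<phi> x \<le> Liminf (at x) \<phi>)"

definition Conv :: "('a::euclidean_space \<Rightarrow> ereal) set" where
  "Conv = {\<phi>. (\<forall>x. \<phi> x \<noteq> -\<infinity>) \<and> (\<exists>x. \<phi> x \<noteq> \<infinity>) \<and>
              convex_ereal \<phi> \<and> lower_semicontinuous \<phi>}"

definition Lclass :: "('a::euclidean_space \<Rightarrow> ereal) set" where
  "Lclass = {\<phi> \<in> Conv. Liminf at_infinity (\<lambda>x. \<phi> x / ereal (norm x)) > 0}"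

definition effdom :: "('a \<Rightarrow> ereal) \<Rightarrow> 'a set" where
  "effdom \<phi> = {x. \<phi> x < \<infinity>}"

text \<open>The interior condition is needed because \<^const>\<open>real_of_ereal\<close> sends \<open>\<infinity>\<close> to 0.\<close>

definition has_grad :: "('a::euclidean_space \<Rightarrow> ereal) \<Rightarrow> 'a \<Rightarrow> 'a \<Rightarrow> bool" where
  "has_grad \<phi> x g \<longleftrightarrow>
     x \<in> interior (effdom \<phi>) \<and> GDERIV (\<lambda>y. real_of_ereal (\<phi> y)) x :> g"

definition grad_dom :: "('a::euclidean_space \<Rightarrow> ereal) \<Rightarrow> 'a set" where
  "grad_dom \<phi> = {x. \<exists>g. has_grad \<phi> x g}"

definition grad :: "('a::euclidean_space \<Rightarrow> ereal) \<Rightarrow> 'a \<Rightarrow> 'a" where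
  "grad \<phi> x = (if x \<in> grad_dom \<phi> then (THE g. has_grad \<phi> x g) else 0)"

text \<open>\<open>exp_half_sq v\<close> is \<open>e\<^bsup>-v\<^sup>2/2\<^esup>\<close>, with value 0 at \<open>\<plusminus>\<infinity>\<close>.\<close>

definition exp_half_sq :: "ereal \<Rightarrow> real" where
  "exp_half_sq v = (if \<bar>v\<bar> = \<infinity> then 0 else exp (- (real_of_ereal v)\<^sup>2 / 2))"

text \<open>The constant \<open>c\<^sub>n\<^sub>+\<^sub>1\<close>, where \<open>n\<close> is the dimension of \<open>'a\<close>.\<close>

definition gauss_const :: "'a::euclidean_space itself \<Rightarrow> real" where
  "gauss_const _ = (2 * pi) powr (- (real DIM('a) + 1) / 2)"

text \<open>The indicator removes the points where the gradient does not exist, at which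
  \<^const>\<open>grad\<close> has the dummy value 0. The explicit integral formula is
  \<open>emeasure_gaussian_moment_measure\<close> below.\<close>

definition gaussian_moment_measure :: "('a::euclidean_space \<Rightarrow> ereal) \<Rightarrow> 'a measure" where
  "gaussian_moment_measure \<phi> =
     distr (density lborel (\<lambda>x. ennreal (gauss_const TYPE('a) * exp_half_sq (\<phi> x)
                                          * exp (- (norm x)\<^sup>2 / 2))
                                * indicator (grad_dom \<phi>) x))
           borel (grad \<phi>)"

definition even_measure :: "'a::real_normed_vector measure \<Rightarrow> bool" where
  "even_measure \<mu> \<longleftrightarrow> (\<forall>A\<in>sets borel. emeasure \<mu> (uminus ` A) = emeasure \<mu> A)"


text \<open>For \<open>\<phi>\<close> in \<^const>\<open>Conv\<close> the gradient is a Borel function on a Borel set, so that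
  \<^const>\<open>gaussian_moment_measure\<close> is given by the expected integral.\<close>

lemma has_grad_unique:
  assumes "has_grad \<phi> x g" "has_grad \<phi> x h"
  shows "g = h"
proof -
  have "(\<lambda>k. k \<bullet> g) = (\<lambda>k. k \<bullet> h)"
    using assms unfolding has_grad_def gderiv_def by (blast intro: has_derivative_unique)
  then show ?thesis
    by (metis inner_commute vector_eq_ldot)
qed

lemma grad_eq: "has_grad \<phi> x g \<Longrightarrow> grad \<phi> x = g"
  unfolding grad_def grad_dom_def using has_grad_unique by (auto intro!: the_equality)

lemma lower_semicontinuous_measurable:
  fixes \<phi> :: "'a::euclidean_space \<Rightarrow> ereal"
  assumes "lower_semicontinuous \<phi>"
  shows "\<phi> \<in> borel_measurable borel"
proof (rule borel_measurableI_greater)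
  fix a
  have "open {x. a < \<phi> x}"
  proof (subst open_subopen, safe)
    fix x assume "a < \<phi> x"
    then have "a < Liminf (at x) \<phi>"
      using assms unfolding lower_semicontinuous_def by (meson less_le_trans)
    then have "\<forall>\<^sub>F y in at x. a < \<phi> y" by (rule less_LiminfD)
    then obtain S where "open S" "x \<in> S" "\<And>y. y \<in> S \<Longrightarrow> y \<noteq> x \<Longrightarrow> a < \<phi> y"
      unfolding eventually_at_topological by auto
    with \<open>a < \<phi> x\<close> show "\<exists>T. open T \<and> x \<in> T \<and> T \<subseteq> {x. a < \<phi> x}"
      by (intro exI[of _ S]) blast
  qed
  then show "{x \<in> space borel. a < \<phi> x} \<in> sets borel" by simp
qed

lemma Conv_continuous_on:
  fixes \<phi> :: "'a::euclidean_space \<Rightarrow> ereal"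
  assumes "\<phi> \<in> Conv"
  shows "continuous_on (interior (effdom \<phi>)) (\<lambda>x. real_of_ereal (\<phi> x))"
proof -
  have fin: "\<exists>r. \<phi> x = ereal r" if "x \<in> effdom \<phi>" for x
    using that assms by (cases "\<phi> x") (auto simp: Conv_def effdom_def)
  have cv: "\<phi> ((1 - t) *\<^sub>R x + t *\<^sub>R y) \<le> ereal (1 - t) * \<phi> x + ereal t * \<phi> y"
    if "0 \<le> t" "t \<le> 1" for x y and t :: real
    using that assms by (auto simp: Conv_def convex_ereal_def)
  have cdom: "convex (effdom \<phi>)"
    unfolding convex_alt
  proof safe
    fix x y and t :: real assume "x \<in> effdom \<phi>" "y \<in> effdom \<phi>" "0 \<le> t" "t \<le> 1"
    then obtain a b where "\<phi> x = ereal a" "\<phi> y = ereal b" using fin by meson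
    then show "(1 - t) *\<^sub>R x + t *\<^sub>R y \<in> effdom \<phi>"
      using cv[OF \<open>0 \<le> t\<close> \<open>t \<le> 1\<close>, of x y] by (auto simp: effdom_def)
  qed
  have "convex_on (interior (effdom \<phi>)) (\<lambda>x. real_of_ereal (\<phi> x))"
  proof (rule convex_onI)
    fix t :: real and x y
    assume t: "0 < t" "t < 1" and xy: "x \<in> interior (effdom \<phi>)" "y \<in> interior (effdom \<phi>)"
    then have "x \<in> effdom \<phi>" "y \<in> effdom \<phi>" using interior_subset by blast+
    moreover from this have "(1 - t) *\<^sub>R x + t *\<^sub>R y \<in> effdom \<phi>"
      using cdom t unfolding convex_alt by auto
    ultimately obtain a b c where "\<phi> x = ereal a" "\<phi> y = ereal b"
      "\<phi> ((1 - t) *\<^sub>R x + t *\<^sub>R y) = ereal c" using fin by meson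
    then show "real_of_ereal (\<phi> ((1 - t) *\<^sub>R x + t *\<^sub>R y))
        \<le> (1 - t) * real_of_ereal (\<phi> x) + t * real_of_ereal (\<phi> y)"
      using cv[of t x y] t by simp
  next
    show "convex (interior (effdom \<phi>))" using cdom by (rule convex_interior)
  qed
  then show ?thesis by (intro convex_on_continuous) auto
qed

lemma differentiability_set_borel:
  fixes f :: "'a::euclidean_space \<Rightarrow> real"
  assumes U: "open U" and f: "continuous_on U f"
  shows "{x \<in> U. \<exists>g. GDERIV f x :> g} \<in> sets borel"
proof -
  obtain Q :: "'a set" where Q: "countable Q" "\<And>X. open X \<Longrightarrow> X \<noteq> {} \<Longrightarrow> \<exists>d\<in>Q. d \<in> X"
    by (rule countable_dense_setE) blast
  define e where "e k = 1 / real (Suc k)" for k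
  have e: "e k > 0" for k by (simp add: e_def)
  have e_lim: "e \<longlonglongrightarrow> 0" unfolding e_def by (rule LIMSEQ_inverse_real_of_nat[unfolded inverse_eq_divide])
  have e_small: "\<exists>k. e k < r" if "r > 0" for r
    using order_tendstoD(2)[OF e_lim that] by (auto simp: eventually_sequentially)
  define A where "A k q m = {x \<in> U. \<forall>h. norm h < e m \<longrightarrow> x + h \<in> U \<longrightarrow>
      \<bar>f (x + h) - f x - h \<bullet> q\<bar> \<le> e k * norm h}" for k q m
  have A_borel: "A k q m \<in> sets borel" for k q m
  proof -
    define B where "B h = {x \<in> U \<inter> (\<lambda>x. x + h) -` U. e k * norm h < \<bar>f (x + h) - f x - h \<bullet> q\<bar>}" for h
    have "open (B h)" for h
    proof -
      have o: "open (U \<inter> (\<lambda>x. x + h) -` U)"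
        by (intro open_Int U continuous_open_vimage continuous_intros)
      have c: "continuous_on (U \<inter> (\<lambda>x. x + h) -` U) (\<lambda>x. \<bar>f (x + h) - f x - h \<bullet> q\<bar>)"
        by (intro continuous_intros continuous_on_compose2[OF f] continuous_on_subset[OF f]) auto
      have "open (U \<inter> (\<lambda>x. x + h) -` U \<inter> (\<lambda>x. \<bar>f (x + h) - f x - h \<bullet> q\<bar>) -` {e k * norm h<..})"
        by (rule continuous_open_preimage[OF c o]) simp
      also have "\<dots> = B h" by (auto simp: B_def)
      finally show ?thesis .
    qed
    then have "open (\<Union>h\<in>{h. norm h < e m}. B h)" by blast
    moreover have "A k q m = U - (\<Union>h\<in>{h. norm h < e m}. B h)"
      by (auto simp: A_def B_def not_less)
    ultimately show ?thesis using U by simp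
  qed
  have "{x \<in> U. \<exists>g. GDERIV f x :> g} = (\<Inter>k. \<Union>q\<in>Q. \<Union>m. A k q m)"
  proof (intro equalityI subsetI)
    fix x assume "x \<in> {x \<in> U. \<exists>g. GDERIV f x :> g}"
    then obtain g where x: "x \<in> U" and g: "(f has_derivative (\<lambda>h. h \<bullet> g)) (at x)"
      by (auto simp: gderiv_def)
    have "\<exists>q\<in>Q. \<exists>m. x \<in> A k q m" for k
    proof -
      obtain d where d: "d > 0" "\<And>y. norm (y - x) < d \<Longrightarrow>
          norm (f y - f x - (y - x) \<bullet> g) \<le> e k / 2 * norm (y - x)"
        using g e[of k] unfolding has_derivative_at_alt by (meson half_gt_zero)
      obtain m where m: "e m < d" using e_small d by blast
      obtain q where q: "q \<in> Q" "q \<in> ball g (e k / 2)"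
        using Q(2)[of "ball g (e k / 2)"] e[of k] by auto
      have "\<bar>f (x + h) - f x - h \<bullet> q\<bar> \<le> e k * norm h" if "norm h < e m" for h
      proof -
        have 1: "\<bar>f (x + h) - f x - h \<bullet> g\<bar> \<le> e k / 2 * norm h"
          using d(2)[of "x + h"] that m by simp
        have "\<bar>h \<bullet> (g - q)\<bar> \<le> norm h * norm (g - q)" by (rule Cauchy_Schwarz_ineq2)
        also have "\<dots> \<le> norm h * (e k / 2)"
          using q by (intro mult_left_mono) (auto simp: dist_norm)
        finally have "\<bar>h \<bullet> g - h \<bullet> q\<bar> \<le> e k / 2 * norm h"
          by (simp add: inner_diff_right mult.commute)
        with 1 show ?thesis by linarith
      qed
      with x q show ?thesis unfolding A_def by blast
    qed
    then show "x \<in> (\<Inter>k. \<Union>q\<in>Q. \<Union>m. A k q m)" by blast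
  next
    fix x assume "x \<in> (\<Inter>k. \<Union>q\<in>Q. \<Union>m. A k q m)"
    then have "\<forall>k. \<exists>q m. x \<in> A k q m" by blast
    then obtain q m where A: "\<And>k. x \<in> A k (q k) (m k)" by metis
    then have x: "x \<in> U" by (auto simp: A_def)
    obtain r where r: "r > 0" "ball x r \<subseteq> U" using U x by (meson openE)
    have bound: "\<bar>f (x + h) - f x - h \<bullet> q k\<bar> \<le> e k * norm h"
      if "norm h < min r (e (m k))" for h k
    proof -
      have "x + h \<in> U" using that r by (intro subsetD[OF r(2)]) (simp add: dist_norm)
      then show ?thesis using A[of k] that by (simp add: A_def)
    qed
    have close: "norm (q j - q k) \<le> e j + e k" for j k
    proof (cases "q j = q k")
      case True then show ?thesis using e[of j] e[of k] by simp
    next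
      case False
      define s where "s = min r (min (e (m j)) (e (m k))) / 2 / norm (q j - q k)"
      define h where "h = s *\<^sub>R (q j - q k)"
      have mp: "min r (min (e (m j)) (e (m k))) > 0" using r e by simp
      have s: "s > 0" unfolding s_def using mp False by (intro divide_pos_pos) auto
      have "norm h = min r (min (e (m j)) (e (m k))) / 2"
        using mp False by (simp add: h_def s_def abs_of_pos)
      then have nh: "norm h < min r (e (m j))" "norm h < min r (e (m k))" using mp by linarith+
      have "\<bar>h \<bullet> q j - h \<bullet> q k\<bar> \<le> (e j + e k) * norm h"
        using bound[OF nh(1)] bound[OF nh(2)] by (simp add: algebra_simps)
      moreover have "h \<bullet> q j - h \<bullet> q k = norm h * norm (q j - q k)"
      proof -
        have "h \<bullet> q j - h \<bullet> q k = h \<bullet> (q j - q k)" by (simp only: inner_diff_right)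
        also have "\<dots> = s * (norm (q j - q k))\<^sup>2"
          by (simp only: h_def inner_scaleR_left dot_square_norm)
        also have "\<dots> = norm h * norm (q j - q k)" using s by (simp add: h_def power2_eq_square)
        finally show ?thesis .
      qed
      ultimately have "norm h * norm (q j - q k) \<le> norm h * (e j + e k)"
        by (simp add: mult.commute)
      moreover have "norm h > 0" using s False by (simp add: h_def)
      ultimately show ?thesis by simp
    qed
    have "Cauchy q"
    proof (rule metric_CauchyI)
      fix d :: real assume "d > 0"
      then have "\<forall>\<^sub>F k in sequentially. e k < d / 2"
        by (intro order_tendstoD(2)[OF e_lim]) simp
      then obtain N where N: "\<And>k. k \<ge> N \<Longrightarrow> e k < d / 2" by (auto simp: eventually_sequentially)
      show "\<exists>M. \<forall>m\<ge>M. \<forall>n\<ge>M. dist (q m) (q n) < d"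
      proof (intro exI[of _ N] allI impI)
        fix i j assume "i \<ge> N" "j \<ge> N"
        then show "dist (q i) (q j) < d"
          using close[of i j] N[of i] N[of j] by (simp add: dist_norm)
      qed
    qed
    then obtain g where g: "q \<longlonglongrightarrow> g" by (meson Cauchy_convergent convergent_def)
    have qg: "norm (q k - g) \<le> e k" for k
    proof (rule LIMSEQ_le)
      show "(\<lambda>j. norm (q k - q j)) \<longlonglongrightarrow> norm (q k - g)" by (intro tendsto_intros g)
      show "(\<lambda>j. e k + e j) \<longlonglongrightarrow> e k"
        using tendsto_add[OF tendsto_const e_lim, of "e k"] by simp
    qed (use close in blast)
    have "(f has_derivative (\<lambda>h. h \<bullet> g)) (at x)"
      unfolding has_derivative_at_alt
    proof (intro conjI allI impI)
      show "bounded_linear (\<lambda>h. h \<bullet> g)" by (rule bounded_linear_inner_left)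
      fix d :: real assume "d > 0"
      then obtain k where k: "e k < d / 2" using e_small[of "d / 2"] by auto
      show "\<exists>b>0. \<forall>y. norm (y - x) < b \<longrightarrow> norm (f y - f x - (y - x) \<bullet> g) \<le> d * norm (y - x)"
      proof (intro exI[of _ "min r (e (m k))"] conjI allI impI)
        show "min r (e (m k)) > 0" using r e by simp
        fix y assume y: "norm (y - x) < min r (e (m k))"
        define h where "h = y - x"
        have 1: "\<bar>f y - f x - h \<bullet> q k\<bar> \<le> e k * norm h"
          using bound[of h k] y by (simp add: h_def)
        have "\<bar>h \<bullet> (q k - g)\<bar> \<le> norm h * norm (q k - g)" by (rule Cauchy_Schwarz_ineq2)
        also have "\<dots> \<le> norm h * e k" by (intro mult_left_mono qg) simp
        finally have "\<bar>h \<bullet> q k - h \<bullet> g\<bar> \<le> e k * norm h"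
          by (simp add: inner_diff_right mult.commute)
        with 1 have "\<bar>f y - f x - h \<bullet> g\<bar> \<le> (2 * e k) * norm h" by (simp add: algebra_simps)
        also have "\<dots> \<le> d * norm h" using k by (intro mult_right_mono) auto
        finally show "norm (f y - f x - (y - x) \<bullet> g) \<le> d * norm (y - x)" by (simp add: h_def)
      qed
    qed
    with x show "x \<in> {x \<in> U. \<exists>g. GDERIV f x :> g}" by (auto simp: gderiv_def)
  qed
  moreover have "(\<Inter>k. \<Union>q\<in>Q. \<Union>m. A k q m) \<in> sets borel"
    using A_borel Q(1) by (intro sets.countable_INT' sets.countable_UN' sets.countable_UN) auto
  ultimately show ?thesis by simp
qed

lemma grad_dom_borel:
  assumes "\<phi> \<in> Conv"
  shows "grad_dom \<phi> \<in> sets borel"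
proof -
  have "grad_dom \<phi> = {x \<in> interior (effdom \<phi>). \<exists>g. GDERIV (\<lambda>y. real_of_ereal (\<phi> y)) x :> g}"
    by (auto simp: grad_dom_def has_grad_def)
  then show ?thesis
    using differentiability_set_borel[OF open_interior Conv_continuous_on[OF assms]] by simp
qed

lemma grad_borel_measurable:
  assumes "\<phi> \<in> Conv"
  shows "grad \<phi> \<in> borel_measurable borel"
proof -
  note [measurable] = grad_dom_borel[OF assms]
  define f where "f x = real_of_ereal (\<phi> x)" for x
  have "\<phi> \<in> borel_measurable borel"
    using assms by (intro lower_semicontinuous_measurable) (simp add: Conv_def)
  then have [measurable]: "f \<in> borel_measurable borel"
    unfolding f_def by measurable
  have "(\<lambda>x. grad \<phi> x \<bullet> b) \<in> borel_measurable borel" for b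
  proof (rule borel_measurable_LIMSEQ_real)
    show "(\<lambda>x. if x \<in> grad_dom \<phi> then (f (x + (1 / real (Suc k)) *\<^sub>R b) - f x) / (1 / real (Suc k)) else 0)
        \<in> borel_measurable borel" for k by measurable
    fix x
    show "(\<lambda>k. if x \<in> grad_dom \<phi> then (f (x + (1 / real (Suc k)) *\<^sub>R b) - f x) / (1 / real (Suc k)) else 0)
        \<longlonglongrightarrow> grad \<phi> x \<bullet> b"
    proof (cases "x \<in> grad_dom \<phi>")
      case False then show ?thesis by (simp add: grad_def)
    next
      case True
      then obtain g where g: "has_grad \<phi> x g" by (auto simp: grad_dom_def)
      have f': "(f has_derivative (\<lambda>h. h \<bullet> g)) (at x)"
        using g by (simp add: has_grad_def gderiv_def f_def[abs_def])
      have "((\<lambda>t. f (x + t *\<^sub>R b)) has_derivative (\<lambda>t. (t *\<^sub>R b) \<bullet> g)) (at 0)"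
        using f' by (intro has_derivative_compose[of "\<lambda>t. x + t *\<^sub>R b" _ 0 UNIV f])
          (auto intro!: derivative_eq_intros)
      then have "((\<lambda>t. f (x + t *\<^sub>R b)) has_field_derivative (b \<bullet> g)) (at 0)"
        by (simp add: has_field_derivative_def mult_commute_abs)
      then have "((\<lambda>t. (f (x + t *\<^sub>R b) - f x) / t) \<longlongrightarrow> b \<bullet> g) (at 0)"
        by (simp add: has_field_derivative_iff)
      moreover have "filterlim (\<lambda>k. 1 / real (Suc k)) (at 0) sequentially"
        unfolding filterlim_at using LIMSEQ_inverse_real_of_nat
        by (simp add: inverse_eq_divide)
      ultimately have "(\<lambda>k. (f (x + (1 / real (Suc k)) *\<^sub>R b) - f x) / (1 / real (Suc k))) \<longlonglongrightarrow> b \<bullet> g"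
        by (rule filterlim_compose)
      with True grad_eq[OF g] show ?thesis by (simp add: inner_commute)
    qed
  qed
  then show ?thesis by (subst borel_measurable_euclidean_space) blast
qed

lemma exp_half_sq_borel_measurable [measurable]: "exp_half_sq \<in> borel_measurable borel"
  unfolding exp_half_sq_def[abs_def] by measurable

lemma emeasure_gaussian_moment_measure:
  fixes \<phi> :: "'a::euclidean_space \<Rightarrow> ereal"
  assumes "\<phi> \<in> Conv" "\<theta> \<in> sets borel"
  shows "emeasure (gaussian_moment_measure \<phi>) \<theta> =
    ennreal (gauss_const TYPE('a)) *
      (\<integral>\<^sup>+ x \<in> {x. \<exists>g\<in>\<theta>. has_grad \<phi> x g}.
          ennreal (exp_half_sq (\<phi> x) * exp (- (norm x)\<^sup>2 / 2)) \<partial>lborel)"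
proof -
  have [measurable]: "\<phi> \<in> borel_measurable borel" "grad \<phi> \<in> borel_measurable borel"
      "grad_dom \<phi> \<in> sets borel" "\<theta> \<in> sets borel"
    using assms grad_dom_borel grad_borel_measurable
    by (auto intro!: lower_semicontinuous_measurable simp: Conv_def)
  have eq: "{x. \<exists>g\<in>\<theta>. has_grad \<phi> x g} = grad_dom \<phi> \<inter> (grad \<phi> -` \<theta>)"
    using grad_eq by (fastforce simp: grad_dom_def)
  have [measurable]: "grad \<phi> -` \<theta> \<in> sets borel"
    using measurable_sets[of "grad \<phi>" borel borel \<theta>] by simp
  have nn: "gauss_const TYPE('a) \<ge> 0" "exp_half_sq v \<ge> 0" for v
    by (auto simp: gauss_const_def exp_half_sq_def)
  have "emeasure (gaussian_moment_measure \<phi>) \<theta> =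
      (\<integral>\<^sup>+ x. ennreal (gauss_const TYPE('a) * exp_half_sq (\<phi> x) * exp (- (norm x)\<^sup>2 / 2))
               * indicator (grad_dom \<phi>) x * indicator (grad \<phi> -` \<theta>) x \<partial>lborel)"
    unfolding gaussian_moment_measure_def
    by (subst emeasure_distr; simp?)+ (subst emeasure_density; simp)
  also have "\<dots> = (\<integral>\<^sup>+ x. ennreal (gauss_const TYPE('a)) *
      (ennreal (exp_half_sq (\<phi> x) * exp (- (norm x)\<^sup>2 / 2))
        * indicator (grad_dom \<phi> \<inter> (grad \<phi> -` \<theta>)) x) \<partial>lborel)"
    by (intro nn_integral_cong) (simp add: nn ennreal_mult indicator_inter_arith mult.assoc)
  also have "\<dots> = ennreal (gauss_const TYPE('a)) *
      (\<integral>\<^sup>+ x. ennreal (exp_half_sq (\<phi> x) * exp (- (norm x)\<^sup>2 / 2))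
        * indicator (grad_dom \<phi> \<inter> (grad \<phi> -` \<theta>)) x \<partial>lborel)"
    by (rule nn_integral_cmult) measurable
  finally show ?thesis by (simp add: eq)
qed

end

(*
  Direct method. After normalizing mu to a probability measure, maximize the Gaussian mass
  G(phi) = int Psi(phi(x)) exp(-|x|^2/2) dx of the epigraph, where Psi' = -exp(-s^2/2) and Psi vanishes
  at infinity, among the even closed convex functions phi with int phi^* dmu <= 0. If G(phi) is bounded
  below, evenness forces phi to be bounded on a fixed ball, which yields compactness of maximizing
  sequences. For an even bounded continuous g the functions (phi^* + t (g - int g dmu))^* satisfy the
  constraint again, and their t-derivative at t = 0 is int g dmu - g(grad phi) almost everywhere; so
  the maximality of phi says that the moment measure of phi is proportional to mu on even functions.
  Both measures are even. Since phi^* is finite mu-almost everywhere, the finiteness domain of phi^*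
  spans the space, which makes phi coercive.
*)

theory Submission
  imports Defs "HOL-Probability.Distributions" "HOL-Library.Diagonal_Subsequence"
begin

section \<open>Gaussian tails\<close>

text \<open>Adding a constant to \<open>\<phi>\<close> moves \<open>conjugate \<phi>\<close> by the
  opposite constant, while \<open>G\<close> grows as \<open>\<phi>\<close> slides down. The
  constraint stops this sliding and forces \<open>0 \<le> \<phi> 0\<close>. Evenness then makes 0 a
  minimum point and all sublevel sets symmetric, so that mass cannot escape by translation. The
  obstacle is the passage to the limit. A sequence of convex functions can be made to converge on a
  countable dense set only, and pointwise limits may misbehave at the boundary of the effective
  domain. Two inequalities are enough: the limit function lies below the lower limit of the
  sequence, so that \<open>G\<close> is upper semicontinuous along it, and its conjugate lies below
  the lower limit of the conjugates, so that Fatou's lemma preserves the constraint. Subtracting its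
  mean from \<open>g\<close> takes the place of a Lagrange multiplier; the factor of proportionality
  then appears by itself as the total mass of the moment measure. Derivatives are taken for
  \<open>t > 0\<close> only, and equality comes from using both \<open>g\<close> and
  \<open>- g\<close>.\<close>

lemma integrable_gaussian:
  "integrable lborel (\<lambda>x::'a::euclidean_space. exp (- (norm x)\<^sup>2 / 2))"
proof -
  have fin: "(\<integral>\<^sup>+ t. ennreal (exp (- t\<^sup>2 / 2)) \<partial>lborel) < \<infinity>"
  proof -
    have "integrable lborel (\<lambda>t. sqrt (2 * pi) * std_normal_density t)"
      using integrable_std_normal_moment[of 0] by simp
    then have "integrable lborel (\<lambda>t::real. exp (- t\<^sup>2 / 2))"
      by (simp add: std_normal_density_def)
    then show ?thesis by (simp add: integrable_iff_bounded)
  qed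
  have eq: "exp (- (norm x)\<^sup>2 / 2) = (\<Prod>b\<in>Basis. exp (- (x \<bullet> b)\<^sup>2 / 2))" for x :: 'a
  proof -
    have "(norm x)\<^sup>2 = (\<Sum>b\<in>Basis. (x \<bullet> b)\<^sup>2)"
      unfolding power2_norm_eq_inner by (subst euclidean_inner) (simp add: power2_eq_square)
    then show ?thesis
      by (simp add: exp_sum[symmetric] sum_negf sum_divide_distrib)
  qed
  have "(\<integral>\<^sup>+ x. ennreal (exp (- (norm (x::'a))\<^sup>2 / 2)) \<partial>lborel)
      = (\<integral>\<^sup>+ x. (\<Prod>b\<in>Basis. ennreal (exp (- ((x::'a) \<bullet> b)\<^sup>2 / 2))) \<partial>lborel)"
    by (simp only: eq prod_ennreal exp_ge_zero)
  also have "\<dots> = (\<Prod>b\<in>(Basis::'a set). \<integral>\<^sup>+ t. ennreal (exp (- t\<^sup>2 / 2)) \<partial>lborel)"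
    by (rule nn_integral_lborel_prod) auto
  also have "\<dots> < \<infinity>"
    using fin by (simp add: less_top[symmetric] ennreal_prod_eq_top power_eq_top_ennreal)
  finally show ?thesis by (simp add: integrable_iff_bounded)
qed

text \<open>This is the function \<open>Psi\<close> of the overview: the one-dimensional Gaussian
  mass, without normalizing factor, of the vertical half-line above height \<open>s\<close>.\<close>

definition gauss_tail :: "real \<Rightarrow> real" where
  "gauss_tail s = (\<integral>t. indicator {s<..} t * exp (- t\<^sup>2 / 2) \<partial>lborel)"

lemma integrable_gaussian_real: "integrable lborel (\<lambda>t::real. exp (- t\<^sup>2 / 2))"
  using integrable_gaussian[where 'a = real] by simp

lemma gauss_tail_integrable:
  assumes [measurable]: "A \<in> sets borel"
  shows "integrable lborel (\<lambda>t::real. indicator A t * exp (- t\<^sup>2 / 2))"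
  by (rule Bochner_Integration.integrable_bound[OF integrable_gaussian_real]) (auto simp: indicator_def)

lemma gauss_tail_diff:
  assumes "a \<le> b"
  shows "gauss_tail a - gauss_tail b = integral {a..b} (\<lambda>t. exp (- t\<^sup>2 / 2))"
proof -
  have "gauss_tail a - gauss_tail b =
      (\<integral>t. indicator {a<..} t * exp (- t\<^sup>2 / 2) - indicator {b<..} t * exp (- t\<^sup>2 / 2) \<partial>lborel)"
    unfolding gauss_tail_def
    by (rule Bochner_Integration.integral_diff[symmetric]) (rule gauss_tail_integrable; simp)+
  also have "\<dots> = (\<integral>t. indicator {a..b} t * exp (- t\<^sup>2 / 2) \<partial>lborel)"
  proof (rule integral_cong_AE)
    have "AE t in lborel. t \<noteq> a" by (rule AE_lborel_singleton)
    then show "AE t in lborel. indicator {a<..} t * exp (- t\<^sup>2 / 2) - indicator {b<..} t * exp (- t\<^sup>2 / 2)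
        = indicator {a..b} t * exp (- t\<^sup>2 / 2)"
      by eventually_elim (use assms in \<open>auto simp: indicator_def\<close>)
  qed measurable
  also have "\<dots> = integral {a..b} (\<lambda>t. exp (- t\<^sup>2 / 2))"
    using set_borel_integral_eq_integral(2)[of "{a..b}" "\<lambda>t::real. exp (- t\<^sup>2 / 2)"]
      gauss_tail_integrable[of "{a..b}"]
    by (simp add: set_integrable_def set_lebesgue_integral_def)
  finally show ?thesis .
qed

lemma DERIV_gauss_tail: "DERIV gauss_tail s :> - exp (- s\<^sup>2 / 2)"
proof -
  \<comment> \<open>The base point \<open>s - 1\<close> replaces the unbounded half-line by a
    compact interval that has \<open>s\<close> in its interior, where the fundamental theorem of
    calculus applies.\<close>
  have "((\<lambda>u. integral {s-1..u} (\<lambda>t. exp (- t\<^sup>2 / 2))) has_real_derivative exp (- s\<^sup>2 / 2))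
      (at s within {s-1..s+1})"
    by (rule integral_has_real_derivative) (auto intro!: continuous_intros)
  then have d: "((\<lambda>u. integral {s-1..u} (\<lambda>t. exp (- t\<^sup>2 / 2))) has_real_derivative exp (- s\<^sup>2 / 2)) (at s)"
    by (simp add: at_within_Icc_at)
  have "((\<lambda>u. gauss_tail (s-1) - integral {s-1..u} (\<lambda>t. exp (- t\<^sup>2 / 2))) has_real_derivative 0 - exp (- s\<^sup>2 / 2)) (at s)"
    by (intro DERIV_diff d DERIV_const)
  moreover have "\<forall>\<^sub>F u in nhds s. u > s - 1"
    by (rule eventually_nhds_in_open[of "{s - 1<..}", simplified]) simp
  then have "\<forall>\<^sub>F u in nhds s. gauss_tail (s-1) - integral {s-1..u} (\<lambda>t. exp (- t\<^sup>2 / 2)) = gauss_tail u"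
    by eventually_elim (simp only: gauss_tail_diff[symmetric, OF less_imp_le])
  ultimately show ?thesis
    by (subst (asm) DERIV_cong_ev[OF refl _ refl]) auto
qed

lemma gauss_tail_strict_antimono: "a < b \<Longrightarrow> gauss_tail b < gauss_tail a"
  by (rule DERIV_neg_imp_decreasing) (auto intro: DERIV_gauss_tail)

lemma gauss_tail_antimono: "a \<le> b \<Longrightarrow> gauss_tail b \<le> gauss_tail a"
  using gauss_tail_strict_antimono[of a b] by (cases "a = b") auto

lemma gauss_tail_pos: "0 < gauss_tail s"
proof -
  have "0 \<le> gauss_tail (s + 1)" unfolding gauss_tail_def by (intro integral_nonneg_AE) auto
  with gauss_tail_strict_antimono[of s "s + 1"] show ?thesis by simp
qed

lemma gauss_tail_tendsto: "(gauss_tail \<longlongrightarrow> 0) at_top"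
proof -
  have "((\<lambda>s. \<integral>t. indicator {s<..} t * exp (- t\<^sup>2 / 2 :: real) \<partial>lborel) \<longlongrightarrow> integral\<^sup>L lborel (\<lambda>t::real. 0 :: real)) at_top"
  proof (rule integral_dominated_convergence_at_top[where w = "\<lambda>t. exp (- t\<^sup>2 / 2)"])
    show "integrable lborel (\<lambda>t::real. exp (- t\<^sup>2 / 2))" by (rule integrable_gaussian_real)
    show "AE t in lborel. ((\<lambda>s. indicator {s<..} t * exp (- t\<^sup>2 / 2 :: real)) \<longlongrightarrow> 0) at_top"
    proof (rule AE_I2)
      fix t :: real
      have "\<forall>\<^sub>F s in at_top. indicator {s<..} t * exp (- t\<^sup>2 / 2 :: real) = 0"
        using eventually_ge_at_top[of t] by eventually_elim auto
      then show "((\<lambda>s. indicator {s<..} t * exp (- t\<^sup>2 / 2 :: real)) \<longlongrightarrow> 0) at_top"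
        by (rule tendsto_eventually)
    qed
  qed (auto simp: indicator_def)
  then show ?thesis by (simp add: gauss_tail_def[abs_def])
qed

lemma gauss_tail_lipschitz: "\<bar>gauss_tail a - gauss_tail b\<bar> \<le> \<bar>a - b\<bar>"
proof -
  have "norm (gauss_tail a - gauss_tail b) \<le> 1 * norm (a - b)"
  proof (rule field_differentiable_bound[where S = UNIV and f' = "\<lambda>s. - exp (- s\<^sup>2 / 2)"])
    show "DERIV gauss_tail z :> - exp (- z\<^sup>2 / 2)" for z by (rule DERIV_gauss_tail)
  qed auto
  then show ?thesis by simp
qed

text \<open>The value at \<open>\<infinity>\<close> is the limit of \<open>gauss_tail\<close>. The
  value 0 at \<open>-\<infinity>\<close> is a dummy that breaks monotonicity, which is why later
  statements exclude \<open>-\<infinity>\<close>.\<close>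

definition gauss_tail_ereal :: "ereal \<Rightarrow> real" where
  "gauss_tail_ereal v = (if \<bar>v\<bar> = \<infinity> then 0 else gauss_tail (real_of_ereal v))"

lemma gauss_tail_ereal_simps [simp]:
  "gauss_tail_ereal (ereal r) = gauss_tail r" "gauss_tail_ereal \<infinity> = 0"
  by (auto simp: gauss_tail_ereal_def)

lemma gauss_tail_ereal_nonneg: "0 \<le> gauss_tail_ereal v"
  using gauss_tail_pos by (simp add: gauss_tail_ereal_def less_imp_le)

lemma gauss_tail_ereal_antimono: "v \<noteq> -\<infinity> \<Longrightarrow> v \<le> w \<Longrightarrow> gauss_tail_ereal w \<le> gauss_tail_ereal v"
  using gauss_tail_pos
  by (cases v; cases w) (auto simp: gauss_tail_antimono less_imp_le)

lemma gauss_tail_ereal_le: "0 \<le> v \<Longrightarrow> gauss_tail_ereal v \<le> gauss_tail 0"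
  using gauss_tail_ereal_antimono[of 0 v] by (auto simp: zero_ereal_def)

lemma gauss_tail_ereal_bounded: "gauss_tail_ereal v \<le> (\<integral>t. exp (- t\<^sup>2 / 2 :: real) \<partial>lborel)"
proof -
  have "gauss_tail s \<le> (\<integral>t. exp (- t\<^sup>2 / 2) \<partial>lborel)" for s
    unfolding gauss_tail_def
    by (intro integral_mono gauss_tail_integrable integrable_gaussian_real) (auto simp: indicator_def)
  moreover have "0 \<le> (\<integral>t. exp (- t\<^sup>2 / 2 :: real) \<partial>lborel)" by (intro integral_nonneg_AE) auto
  ultimately show ?thesis by (simp add: gauss_tail_ereal_def)
qed

lemma gauss_tail_measurable [measurable]: "gauss_tail \<in> borel_measurable borel"
  by (intro borel_measurable_continuous_onI continuous_at_imp_continuous_on ballI)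
     (use DERIV_gauss_tail DERIV_isCont in blast)

lemma gauss_tail_ereal_measurable [measurable]: "gauss_tail_ereal \<in> borel_measurable borel"
  unfolding gauss_tail_ereal_def[abs_def] by measurable

text \<open>A real \<open>c\<close> strictly below \<open>v\<close> is what a bound on a lower limit
  can be compared with; the finite and the infinite value are treated uniformly in this way. For
  finite \<open>v\<close> the shift by \<open>\<epsilon>\<close> works because
  \<open>gauss_tail\<close> is 1-Lipschitz, for \<open>v = \<infinity>\<close> because it tends to
  0.\<close>

lemma gauss_tail_ereal_approx:
  assumes "v \<noteq> -\<infinity>" "0 < \<epsilon>"
  shows "\<exists>c. ereal c < v \<and> gauss_tail c \<le> gauss_tail_ereal v + \<epsilon>"
proof (cases v)
  case (real r)
  then show ?thesis
    using gauss_tail_lipschitz[of "r - \<epsilon>" r] assms by (intro exI[of _ "r - \<epsilon>"]) auto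
next
  case PInf
  have "\<forall>\<^sub>F s in at_top. gauss_tail s < \<epsilon>"
    using gauss_tail_tendsto assms(2) by (rule order_tendstoD)
  then obtain c where "gauss_tail c < \<epsilon>" by (auto simp: eventually_at_top_linorder)
  with PInf show ?thesis by (intro exI[of _ c]) auto
qed (use assms in simp)

section \<open>Legendre conjugates\<close>

text \<open>The Legendre transform for arbitrary \<open>f\<close>. The first operand of the
  difference is always finite, so the ambiguous \<open>\<infinity> - \<infinity>\<close> never
  occurs.\<close>

definition conjugate :: "('a::real_inner \<Rightarrow> ereal) \<Rightarrow> 'a \<Rightarrow> ereal" where
  "conjugate f x = (SUP y. ereal (x \<bullet> y) - f y)"

lemma conjugate_upper: "ereal (x \<bullet> y) - f y \<le> conjugate f x"
  unfolding conjugate_def by (rule SUP_upper) simp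

lemma conjugate_le: "(\<And>y. ereal (x \<bullet> y) - f y \<le> c) \<Longrightarrow> conjugate f x \<le> c"
  unfolding conjugate_def by (rule SUP_least)

lemma conjugate_conjugate_le: "conjugate (conjugate f) x \<le> f x"
proof (rule conjugate_le)
  fix y
  have "ereal (x \<bullet> y) - f x \<le> conjugate f y"
    using conjugate_upper[of y x f] by (simp add: inner_commute)
  then show "ereal (x \<bullet> y) - conjugate f y \<le> f x"
    by (cases "f x"; cases "conjugate f y") auto
qed

lemma conjugate_antimono: "(\<And>x. f x \<le> g x) \<Longrightarrow> conjugate g x \<le> conjugate f x"
  unfolding conjugate_def by (intro SUP_mono') (simp add: ereal_minus_mono)

text \<open>One inequality is the biconjugate bound for \<open>conjugate f\<close>, the other is
  that bound for \<open>f\<close> reversed by conjugation. Since closed convexity is encoded below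
  as \<open>conjugate (conjugate \<phi>) = \<phi>\<close>, every function built as a conjugate
  satisfies it without a separation theorem.\<close>

lemma conjugate_triple: "conjugate (conjugate (conjugate f)) = conjugate f"
  by (intro ext antisym conjugate_conjugate_le conjugate_antimono)

lemma conjugate_even:
  assumes "\<And>x. f (- x) = f x"
  shows "conjugate f (- x) = conjugate f x"
proof -
  have "conjugate f (- x) \<le> conjugate f x" for x
  proof (rule conjugate_le)
    show "ereal (- x \<bullet> y) - f y \<le> conjugate f x" for y
      using conjugate_upper[of x "- y" f] assms by simp
  qed
  from this[of x] this[of "- x"] show ?thesis by simp
qed

lemma convex_ereal_conjugate: "convex_ereal (conjugate f)"
  unfolding convex_ereal_def
proof (intro allI ballI conjugate_le)
  fix x y z and t :: real assume t: "t \<in> {0..1}"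
  show "ereal (((1 - t) *\<^sub>R x + t *\<^sub>R y) \<bullet> z) - f z
      \<le> ereal (1 - t) * conjugate f x + ereal t * conjugate f y"
  proof (cases "f z")
    case (real r)
    have "ereal (((1 - t) *\<^sub>R x + t *\<^sub>R y) \<bullet> z) - f z = ereal (1 - t) * (ereal (x \<bullet> z) - f z) + ereal t * (ereal (y \<bullet> z) - f z)"
      by (simp add: real inner_add_left algebra_simps)
    also have "\<dots> \<le> ereal (1 - t) * conjugate f x + ereal t * conjugate f y"
      using t by (intro add_mono ereal_mult_left_mono conjugate_upper) auto
    finally show ?thesis .
  next
    \<comment> \<open>Here the conjugate is \<open>\<infinity>\<close> everywhere. The endpoints are
      separate because \<open>0 * \<infinity> = 0\<close> in \<open>ereal\<close>, so that only one
      summand is infinite there.\<close>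
    case MInf
    then have "conjugate f w = \<infinity>" for w using conjugate_upper[of w z f] by simp
    then show ?thesis using t by (cases "t = 0"; cases "t = 1") auto
  qed simp
qed

lemma lower_semicontinuous_conjugate: "lower_semicontinuous (conjugate f)"
  unfolding lower_semicontinuous_def
proof (intro allI, subst le_Liminf_iff, intro allI impI)
  fix x c assume "c < conjugate f x"
  then obtain y where y: "c < ereal (x \<bullet> y) - f y"
    unfolding conjugate_def less_SUP_iff by auto
  have "((\<lambda>z. ereal (z \<bullet> y) - f y) \<longlongrightarrow> ereal (x \<bullet> y) - f y) (at x)"
  proof (cases "f y")
    case (real r)
    then show ?thesis by (auto intro!: tendsto_intros)
  qed auto
  then have "\<forall>\<^sub>F z in at x. c < ereal (z \<bullet> y) - f y"
    using y by (rule order_tendstoD)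
  then show "\<forall>\<^sub>F z in at x. c < conjugate f z"
    by eventually_elim (use conjugate_upper less_le_trans in blast)
qed

lemma conjugate_measurable [measurable]:
  fixes f :: "'a::euclidean_space \<Rightarrow> ereal"
  shows "conjugate f \<in> borel_measurable borel"
  by (rule lower_semicontinuous_measurable[OF lower_semicontinuous_conjugate])

lemma convex_erealD:
  "convex_ereal \<phi> \<Longrightarrow> 0 \<le> t \<Longrightarrow> t \<le> 1 \<Longrightarrow>
    \<phi> ((1 - t) *\<^sub>R x + t *\<^sub>R y) \<le> ereal (1 - t) * \<phi> x + ereal t * \<phi> y"
  unfolding convex_ereal_def by auto

section \<open>Almost everywhere differentiability of convex functions\<close>

lemma nn_integral_indicator_translate:
  fixes N :: "'a::euclidean_space set"
  assumes [measurable]: "N \<in> sets borel"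
  shows "(\<integral>\<^sup>+ x. indicator N (x + c) \<partial>lborel) = emeasure lborel N"
proof -
  have "emeasure lborel N = (\<integral>\<^sup>+ x. indicator N x \<partial>distr lborel borel ((+) c))"
    by (simp add: lborel_distr_plus)
  also have "\<dots> = (\<integral>\<^sup>+ x. indicator N (c + x) \<partial>lborel)"
    by (rule nn_integral_distr) auto
  finally show ?thesis by (simp add: add.commute)
qed

text \<open>Averaging the translates of \<open>N\<close> along \<open>b\<close> and exchanging the integrals.\<close>

lemma null_set_if_lines_meet_once:
  fixes N :: "'a::euclidean_space set"
  assumes N [measurable]: "N \<in> sets borel"
    and once: "\<And>x s t. x + s *\<^sub>R b \<in> N \<Longrightarrow> x + t *\<^sub>R b \<in> N \<Longrightarrow> s = t"
  shows "N \<in> null_sets lborel"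
proof -
  have "emeasure lborel N = (\<integral>\<^sup>+ t. emeasure lborel N * indicator {0..1::real} t \<partial>lborel)"
    by (simp add: nn_integral_cmult_indicator)
  also have "\<dots> = (\<integral>\<^sup>+ t. (\<integral>\<^sup>+ x. indicator N (x + t *\<^sub>R b) * indicator {0..1::real} t \<partial>lborel) \<partial>lborel)"
    by (intro nn_integral_cong, subst nn_integral_multc) (auto simp: nn_integral_indicator_translate)
  also have "\<dots> = (\<integral>\<^sup>+ x. (\<integral>\<^sup>+ t. indicator N (x + t *\<^sub>R b) * indicator {0..1::real} t \<partial>lborel) \<partial>lborel)"
    by (rule lborel_pair.Fubini') measurable
  also have "\<dots> = (\<integral>\<^sup>+ x. 0 \<partial>(lborel :: 'a measure))"
  proof (rule nn_integral_cong)
    fix x :: 'a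
    obtain s where s: "\<And>t. x + t *\<^sub>R b \<in> N \<Longrightarrow> t = s" using once by metis
    have "AE t in lborel. t \<noteq> s" by (rule AE_lborel_singleton)
    then have "AE t in lborel. indicator N (x + t *\<^sub>R b) * indicator {0..1::real} t = (0::ennreal)"
      by eventually_elim (use s in \<open>auto simp: indicator_def\<close>)
    then show "(\<integral>\<^sup>+ t. indicator N (x + t *\<^sub>R b) * indicator {0..1::real} t \<partial>lborel) = 0"
      by (subst nn_integral_0_iff_AE) auto
  qed
  finally show ?thesis using N by (simp add: null_sets_def)
qed

text \<open>Existence of the partial derivatives suffices, and only the upper halves of the first-order
  expansions are needed: a convex \<open>w\<close> with \<open>w 0 = 0\<close> satisfies \<open>- w (- h) \<le> w h\<close>.\<close>

lemma convex_on_GDERIV_from_partials: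
  fixes u :: "'a::euclidean_space \<Rightarrow> real"
  assumes U: "open U" "x \<in> U" and u: "convex_on U u"
    and part: "\<And>b \<epsilon>. b \<in> Basis \<Longrightarrow> 0 < \<epsilon> \<Longrightarrow>
      \<exists>\<delta>>0. \<forall>t. \<bar>t\<bar> < \<delta> \<longrightarrow> u (x + t *\<^sub>R b) - u x - t * p b \<le> \<epsilon> * \<bar>t\<bar>"
  shows "GDERIV u x :> (\<Sum>b\<in>Basis. p b *\<^sub>R b)"
proof -
  define G where "G = (\<Sum>b\<in>Basis. p b *\<^sub>R b)"
  define w where "w h = u (x + h) - u x - h \<bullet> G" for h
  define n where "n = real DIM('a)"
  have n: "n \<ge> 1" using DIM_positive[where 'a = 'a] unfolding n_def by linarith
  have Gb: "b \<bullet> G = p b" if "b \<in> Basis" for b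
    using that by (simp add: G_def inner_sum_right inner_Basis if_distrib cong: if_cong)
  obtain \<rho> where \<rho>: "\<rho> > 0" "ball x \<rho> \<subseteq> U" using U by (meson openE)
  have small: "\<exists>\<eta>>0. \<forall>h. norm h < \<eta> \<longrightarrow> \<bar>w h\<bar> \<le> \<epsilon> * norm h" if \<epsilon>: "\<epsilon> > 0" for \<epsilon>
  proof -
    have "\<exists>\<delta>>0. \<forall>t. \<bar>t\<bar> < \<delta> \<longrightarrow> w (t *\<^sub>R b) \<le> \<epsilon> / n * \<bar>t\<bar>" if "b \<in> Basis" for b
      using part[OF that, of "\<epsilon> / n"] Gb[OF that] \<epsilon> n by (simp add: w_def algebra_simps)
    then obtain \<delta> where \<delta>: "\<And>b. b \<in> Basis \<Longrightarrow> \<delta> b > 0"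
      "\<And>b t. b \<in> Basis \<Longrightarrow> \<bar>t\<bar> < \<delta> b \<Longrightarrow> w (t *\<^sub>R b) \<le> \<epsilon> / n * \<bar>t\<bar>" by metis
    define \<eta> where "\<eta> = Min (insert \<rho> (\<delta> ` Basis)) / n"
    have Mpos: "Min (insert \<rho> (\<delta> ` Basis)) > 0" using \<rho> \<delta>(1) by (subst Min_gr_iff) auto
    have \<eta>: "\<eta> > 0" unfolding \<eta>_def using Mpos n by (intro divide_pos_pos) auto
    have up: "w h \<le> \<epsilon> * norm h" if h: "norm h < \<eta>" for h
    proof -
      have nb: "norm ((n * (h \<bullet> b)) *\<^sub>R b) < Min (insert \<rho> (\<delta> ` Basis))" "\<bar>n * (h \<bullet> b)\<bar> < Min (insert \<rho> (\<delta> ` Basis))"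
        if "b \<in> Basis" for b
      proof -
        have "\<bar>h \<bullet> b\<bar> < \<eta>" using h Basis_le_norm[OF that, of h] by simp
        then show "\<bar>n * (h \<bullet> b)\<bar> < Min (insert \<rho> (\<delta> ` Basis))"
          using n by (simp add: \<eta>_def abs_mult field_simps)
        then show "norm ((n * (h \<bullet> b)) *\<^sub>R b) < Min (insert \<rho> (\<delta> ` Basis))" using that by simp
      qed
      have inU: "x + (n * (h \<bullet> b)) *\<^sub>R b \<in> U" if "b \<in> Basis" for b
        using nb(1)[OF that] \<rho>(2) by (intro subsetD[OF \<rho>(2)]) (simp add: dist_norm)
      have sumn: "(\<Sum>b\<in>(Basis::'a set). 1 / n) = 1" using n by (simp add: n_def)
      \<comment> \<open>The point \<open>x + h\<close> is the average of \<open>n\<close> points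
        displaced along the axes, so Jensen's inequality bounds \<open>w h\<close> by axis values.
        Each displacement is magnified by \<open>n\<close>, which explains the division by
        \<open>n\<close> in \<open>\<eta>\<close> and the axis accuracy
        \<open>\<epsilon> / n\<close>.\<close>
      have rep: "(\<Sum>b\<in>Basis. (1 / n) *\<^sub>R (x + (n * (h \<bullet> b)) *\<^sub>R b)) = x + h"
      proof -
        have "(\<Sum>b\<in>Basis. (1 / n) *\<^sub>R (x + (n * (h \<bullet> b)) *\<^sub>R b)) = (\<Sum>b\<in>Basis. (1 / n) *\<^sub>R x + (h \<bullet> b) *\<^sub>R b)"
          using n by (intro sum.cong) (auto simp: scaleR_add_right)
        also have "\<dots> = (\<Sum>b\<in>(Basis::'a set). 1 / n) *\<^sub>R x + h"
          by (simp add: sum.distrib scaleR_sum_left euclidean_representation del: sum_constant)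
        finally show ?thesis by (simp only: sumn scaleR_one)
      qed
      have "u (\<Sum>b\<in>Basis. (1 / n) *\<^sub>R (x + (n * (h \<bullet> b)) *\<^sub>R b)) \<le> (\<Sum>b\<in>Basis. (1 / n) * u (x + (n * (h \<bullet> b)) *\<^sub>R b))"
        using n u sumn inU by (intro convex_on_sum[where C = U]) (auto simp: convex_on_imp_convex)
      also have "\<dots> = (\<Sum>b\<in>Basis. (1 / n) * w ((n * (h \<bullet> b)) *\<^sub>R b) + (1 / n) * u x + (h \<bullet> b) * (b \<bullet> G))"
        using n by (intro sum.cong) (auto simp: w_def field_simps)
      also have "\<dots> = (\<Sum>b\<in>Basis. (1 / n) * w ((n * (h \<bullet> b)) *\<^sub>R b)) + (\<Sum>b\<in>(Basis::'a set). 1 / n) * u x + h \<bullet> G"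
        by (simp only: sum.distrib sum_distrib_right euclidean_inner[of h G] inner_commute[of G])
      finally have "w h \<le> (\<Sum>b\<in>Basis. (1 / n) * w ((n * (h \<bullet> b)) *\<^sub>R b))"
        using rep sumn by (simp add: w_def)
      also have "\<dots> \<le> (\<Sum>b\<in>(Basis::'a set). (1 / n) * (\<epsilon> * norm h))"
      proof (intro sum_mono mult_left_mono)
        fix b :: 'a assume b: "b \<in> Basis"
        have "w ((n * (h \<bullet> b)) *\<^sub>R b) \<le> \<epsilon> / n * \<bar>n * (h \<bullet> b)\<bar>"
          using nb(2)[OF b] b by (intro \<delta>(2)) auto
        also have "\<dots> = \<epsilon> * \<bar>h \<bullet> b\<bar>" using n by (simp add: abs_mult)
        also have "\<dots> \<le> \<epsilon> * norm h" using \<epsilon> Basis_le_norm[OF b] by simp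
        finally show "w ((n * (h \<bullet> b)) *\<^sub>R b) \<le> \<epsilon> * norm h" .
      qed (use n in auto)
      also have "\<dots> = \<epsilon> * norm h" by (simp only: sum_distrib_right[symmetric] sumn mult_1)
      finally show ?thesis .
    qed
    have low: "- w (- h) \<le> w h" if h: "norm h < \<eta>" for h
    proof -
      have "\<eta> \<le> \<rho>"
      proof -
        have "\<eta> \<le> Min (insert \<rho> (\<delta> ` Basis)) / 1"
          unfolding \<eta>_def using Mpos n by (intro divide_left_mono) auto
        also have "\<dots> \<le> \<rho>" by simp
        finally show ?thesis .
      qed
      then have "x + h \<in> U" "x + (- h) \<in> U" using h \<rho>(2) by (auto simp: subset_iff dist_norm)
      from convex_onD[OF u _ _ this, of "1 / 2"]
      have "u ((1 / 2) *\<^sub>R (x + h) + (1 / 2) *\<^sub>R (x - h)) \<le> (u (x + h) + u (x - h)) / 2" by simp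
      moreover have "(1 / 2) *\<^sub>R (x + h) + (1 / 2) *\<^sub>R (x - h) = x"
        by (simp add: algebra_simps flip: scaleR_left_distrib)
      ultimately show ?thesis by (simp add: w_def)
    qed
    have "\<bar>w h\<bar> \<le> \<epsilon> * norm h" if "norm h < \<eta>" for h
      using up[of h] up[of "- h"] low[of h] that by simp
    with \<eta> show ?thesis by blast
  qed
  show ?thesis
    unfolding gderiv_def has_derivative_at_alt G_def[symmetric]
  proof (intro conjI allI impI)
    show "bounded_linear (\<lambda>h. h \<bullet> G)" by (rule bounded_linear_inner_left)
    fix \<epsilon> :: real assume "0 < \<epsilon>"
    from small[OF this] obtain \<eta> where "\<eta> > 0" "\<And>h. norm h < \<eta> \<Longrightarrow> \<bar>w h\<bar> \<le> \<epsilon> * norm h" by blast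
    note \<eta> = this
    have "norm (u y - u x - (y - x) \<bullet> G) \<le> \<epsilon> * norm (y - x)" if "norm (y - x) < \<eta>" for y
      using \<eta>(2)[OF that] by (simp add: w_def)
    with \<eta>(1) show "\<exists>d>0. \<forall>y. norm (y - x) < d \<longrightarrow> norm (u y - u x - (y - x) \<bullet> G) \<le> \<epsilon> * norm (y - x)"
      by blast
  qed
qed

text \<open>By convexity the one-sided derivatives along \<open>b\<close> exist. Hypothesis
  \<open>nd\<close> says that no line of rational slope \<open>r\<close> stays below
  \<open>u\<close> with a margin proportional to the distance; a gap between the left and the right
  derivative would contain such an \<open>r\<close>, so the two coincide.\<close>

lemma convex_on_partial_derivative:
  fixes u :: "'a::euclidean_space \<Rightarrow> real"
  assumes U: "open U" "x \<in> U" and u: "convex_on U u"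
    and nd: "\<And>r m. r \<in> \<rat> \<Longrightarrow> \<exists>t. x + t *\<^sub>R b \<in> U \<and> u (x + t *\<^sub>R b) < u x + r * t + \<bar>t\<bar> / real (Suc m)"
  shows "\<exists>p. \<forall>\<epsilon>>0. \<exists>\<delta>>0. \<forall>t. \<bar>t\<bar> < \<delta> \<longrightarrow> u (x + t *\<^sub>R b) - u x - t * p \<le> \<epsilon> * \<bar>t\<bar>"
proof -
  define v where "v t = u (x + t *\<^sub>R b) - u x" for t
  define I where "I = {t. x + t *\<^sub>R b \<in> U}"
  have "open ((\<lambda>t. x + t *\<^sub>R b) -` U)" using U(1) by (intro continuous_open_vimage continuous_intros)
  then obtain \<rho> where \<rho>: "\<rho> > 0" "\<And>t. \<bar>t\<bar> < \<rho> \<Longrightarrow> t \<in> I"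
    using U(2) unfolding open_dist I_def dist_real_def vimage_def by (force dest: spec[of _ 0])
  have scale: "v (c * t) \<le> c * v t" if "t \<in> I" "0 \<le> c" "c \<le> 1" for c t
  proof -
    have "u ((1 - c) *\<^sub>R x + c *\<^sub>R (x + t *\<^sub>R b)) \<le> (1 - c) * u x + c * u (x + t *\<^sub>R b)"
      using that U by (intro convex_onD[OF u]) (auto simp: I_def)
    moreover have "(1 - c) *\<^sub>R x + c *\<^sub>R (x + t *\<^sub>R b) = x + (c * t) *\<^sub>R b" by (simp add: algebra_simps)
    ultimately show ?thesis by (simp add: v_def algebra_simps)
  qed
  have slopes: "v s / s \<le> v t / t" if "s \<in> I" "t \<in> I" "s < 0" "0 < t" for s t
  proof -
    define c where "c = t / (t - s)"
    have c: "0 \<le> c" "c \<le> 1" using that by (auto simp: c_def)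
    have "u ((1 - c) *\<^sub>R (x + t *\<^sub>R b) + c *\<^sub>R (x + s *\<^sub>R b)) \<le> (1 - c) * u (x + t *\<^sub>R b) + c * u (x + s *\<^sub>R b)"
      using that c by (intro convex_onD[OF u]) (auto simp: I_def)
    moreover have "(1 - c) * t + c * s = 0" using that by (simp add: c_def field_simps)
    then have "(1 - c) *\<^sub>R (x + t *\<^sub>R b) + c *\<^sub>R (x + s *\<^sub>R b) = x"
      by (simp add: algebra_simps flip: scaleR_left_distrib)
    ultimately have "0 \<le> (1 - c) * v t + c * v s" by (simp add: v_def algebra_simps)
    then have "0 \<le> (t - s) * ((1 - c) * v t + c * v s)" using that by (intro mult_nonneg_nonneg) auto
    also have "\<dots> = ((t - s) * (1 - c)) * v t + ((t - s) * c) * v s" by (simp only: distrib_left mult.assoc)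
    also have "\<dots> = (- s) * v t + t * v s" using that by (simp add: c_def right_diff_distrib)
    finally have "0 \<le> (- s) * v t + t * v s" .
    then show ?thesis using that by (simp add: field_simps)
  qed
  \<comment> \<open>This is the right derivative: by \<open>slopes\<close>, any quotient on the left
    bounds the quotients on the right from below, so the infimum is finite.\<close>
  define p where "p = (INF t\<in>{0<..} \<inter> I. v t / t)"
  have ne: "\<rho> / 2 \<in> {0<..} \<inter> I" "- \<rho> / 2 \<in> I" using \<rho> by auto
  have bdd: "bdd_below ((\<lambda>t. v t / t) ` ({0<..} \<inter> I))"
    using slopes[of "- \<rho> / 2"] ne \<rho> by (intro bdd_belowI2[of _ "v (- \<rho> / 2) / (- \<rho> / 2)"]) auto
  have p_le: "t * p \<le> v t" if "t \<in> I" "0 < t" for t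
    using cINF_lower[OF bdd, of t] that by (simp add: p_def field_simps)
  have right: "\<exists>t>0. t \<in> I \<and> v t \<le> t * (p + \<epsilon>)" if "\<epsilon> > 0" for \<epsilon>
  proof -
    have "{0<..} \<inter> I \<noteq> {}" using ne(1) by blast
    from cINF_less_iff[OF this bdd, of "p + \<epsilon>"] that
    obtain t where "t \<in> {0<..} \<inter> I" "v t / t < p + \<epsilon>" by (auto simp: p_def[symmetric])
    then show ?thesis by (intro exI[of _ t]) (auto simp: field_simps)
  qed
  have left: "\<exists>t<0. t \<in> I \<and> v t \<le> t * (p - \<epsilon>)" if \<epsilon>: "\<epsilon> > 0" for \<epsilon>
  proof (rule ccontr)
    assume "\<not> ?thesis"
    then have neg: "t * (p - \<epsilon>) < v t" if "t \<in> I" "t < 0" for t using that by force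
    \<comment> \<open>If the left quotients stay below \<open>p - \<epsilon>\<close>, a rational
      \<open>r\<close> in the gap and a margin smaller than its distance to both ends contradict
      \<open>nd\<close> on either side of 0.\<close>
    obtain r where r: "r \<in> \<rat>" "p - \<epsilon> < r" "r < p" using Rats_dense_in_real[of "p - \<epsilon>" p] \<epsilon> by auto
    obtain m where m: "1 / real (Suc m) < min (p - r) (r - (p - \<epsilon>))"
      using reals_Archimedean[of "min (p - r) (r - (p - \<epsilon>))"] r by (auto simp: inverse_eq_divide)
    obtain t where t: "t \<in> I" "v t < r * t + \<bar>t\<bar> / real (Suc m)"
      using nd[OF r(1), of m] by (auto simp: v_def I_def)
    consider "t = 0" | "t > 0" | "t < 0" by linarith
    then show False
    proof cases
      case 1 then show False using t by (simp add: v_def)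
    next
      case 2
      have "t * (1 / real (Suc m)) \<le> t * (p - r)" using 2 m by (intro mult_left_mono) auto
      then show False using p_le[OF t(1) 2] t(2) 2 by (simp add: algebra_simps)
    next
      case 3
      have "(- t) * (1 / real (Suc m)) \<le> (- t) * (r - (p - \<epsilon>))" using 3 m by (intro mult_left_mono) auto
      then show False using neg[OF t(1) 3] t(2) 3 by (simp add: algebra_simps)
    qed
  qed
  show ?thesis
  proof (rule exI[of _ p], intro allI impI)
    fix \<epsilon> :: real assume \<epsilon>: "\<epsilon> > 0"
    obtain t1 where t1: "t1 > 0" "t1 \<in> I" "v t1 \<le> t1 * (p + \<epsilon>)" using right[OF \<epsilon>] by blast
    obtain t2 where t2: "t2 < 0" "t2 \<in> I" "v t2 \<le> t2 * (p - \<epsilon>)" using left[OF \<epsilon>] by blast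
    have "v t - t * p \<le> \<epsilon> * \<bar>t\<bar>" if t: "\<bar>t\<bar> < min t1 (- t2)" for t
    proof (cases "0 \<le> t")
      case True
      have "v (t / t1 * t1) \<le> t / t1 * v t1" using t t1 True by (intro scale) auto
      also have "\<dots> \<le> t / t1 * (t1 * (p + \<epsilon>))" using t1 True by (intro mult_left_mono) auto
      finally show ?thesis using t1 True by (simp add: algebra_simps)
    next
      case False
      have "v (t / t2 * t2) \<le> t / t2 * v t2" using t t2 False by (intro scale) (auto simp: divide_le_eq_1 field_simps)
      also have "\<dots> \<le> t / t2 * (t2 * (p - \<epsilon>))" using t2 False by (intro mult_left_mono) (auto simp: divide_nonpos_neg)
      finally show ?thesis using t2 False by (simp add: algebra_simps)
    qed
    then show "\<exists>\<delta>>0. \<forall>t. \<bar>t\<bar> < \<delta> \<longrightarrow> u (x + t *\<^sub>R b) - u x - t * p \<le> \<epsilon> * \<bar>t\<bar>"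
      using t1 t2 by (intro exI[of _ "min t1 (- t2)"]) (auto simp: v_def)
  qed
qed

text \<open>Where \<open>u\<close> has distinct one-sided derivatives along \<open>b\<close>, some rational \<open>r\<close> lies strictly
  between them; then \<open>u - r t\<close> has a strict minimum there, so the set of these points for a fixed \<open>r\<close>
  meets every line parallel to \<open>b\<close> at most once.\<close>

theorem convex_on_differentiable_AE:
  fixes u :: "'a::euclidean_space \<Rightarrow> real"
  assumes U: "open U" and u: "convex_on U u"
  shows "\<exists>N\<in>null_sets lborel. \<forall>x\<in>U - N. \<exists>g. GDERIV u x :> g"
proof -
  \<comment> \<open>The margin with factor \<open>1 / Suc m\<close> makes the strictness of the
    minimum quantitative: the inequalities at two points of one line add up to
    \<open>\<bar>t - s\<bar> / real (Suc m) \<le> 0\<close>.\<close>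
  define N where "N b r m = {x \<in> U. \<forall>t. x + t *\<^sub>R b \<in> U \<longrightarrow> u x + r * t + \<bar>t\<bar> / real (Suc m) \<le> u (x + t *\<^sub>R b)}"
    for b and r :: real and m :: nat
  have cont: "continuous_on U u" using convex_on_continuous[OF U u] .
  have "N b r m \<in> null_sets lborel" for b and r :: real and m
  proof (rule null_set_if_lines_meet_once)
    define B where "B t = {x \<in> U \<inter> (\<lambda>x. x + t *\<^sub>R b) -` U. u (x + t *\<^sub>R b) - u x < r * t + \<bar>t\<bar> / real (Suc m)}" for t
    have "open (B t)" for t
    proof -
      have o: "open (U \<inter> (\<lambda>x. x + t *\<^sub>R b) -` U)"
        by (intro open_Int U continuous_open_vimage continuous_intros)
      have c: "continuous_on (U \<inter> (\<lambda>x. x + t *\<^sub>R b) -` U) (\<lambda>x. u (x + t *\<^sub>R b) - u x)"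
        by (intro continuous_intros continuous_on_compose2[OF cont] continuous_on_subset[OF cont]) auto
      have "open (U \<inter> (\<lambda>x. x + t *\<^sub>R b) -` U \<inter> (\<lambda>x. u (x + t *\<^sub>R b) - u x) -` {..< r * t + \<bar>t\<bar> / real (Suc m)})"
        by (rule continuous_open_preimage[OF c o]) simp
      also have "\<dots> = B t" by (auto simp: B_def)
      finally show ?thesis .
    qed
    then have "open (\<Union>t. B t)" by blast
    \<comment> \<open>The union runs over uncountably many \<open>t\<close>, but its members are
      open, so \<open>N b r m\<close> is still Borel.\<close>
    moreover have "N b r m = U - (\<Union>t. B t)" by (auto simp: N_def B_def not_less algebra_simps)
    ultimately show "N b r m \<in> sets borel" using U by simp
    fix x s t assume *: "x + s *\<^sub>R b \<in> N b r m" "x + t *\<^sub>R b \<in> N b r m"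
    have eq: "x + s *\<^sub>R b + (t - s) *\<^sub>R b = x + t *\<^sub>R b" "x + t *\<^sub>R b + (s - t) *\<^sub>R b = x + s *\<^sub>R b"
      by (simp_all add: algebra_simps)
    have "u (x + s *\<^sub>R b) + r * (t - s) + \<bar>t - s\<bar> / real (Suc m) \<le> u (x + t *\<^sub>R b)"
      using * spec[of "\<lambda>\<tau>. x + s *\<^sub>R b + \<tau> *\<^sub>R b \<in> U \<longrightarrow> u (x + s *\<^sub>R b) + r * \<tau> + \<bar>\<tau>\<bar> / real (Suc m) \<le> u (x + s *\<^sub>R b + \<tau> *\<^sub>R b)" "t - s"]
      unfolding N_def mem_Collect_eq eq by blast
    moreover have "u (x + t *\<^sub>R b) + r * (s - t) + \<bar>s - t\<bar> / real (Suc m) \<le> u (x + s *\<^sub>R b)"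
      using * spec[of "\<lambda>\<tau>. x + t *\<^sub>R b + \<tau> *\<^sub>R b \<in> U \<longrightarrow> u (x + t *\<^sub>R b) + r * \<tau> + \<bar>\<tau>\<bar> / real (Suc m) \<le> u (x + t *\<^sub>R b + \<tau> *\<^sub>R b)" "s - t"]
      unfolding N_def mem_Collect_eq eq by blast
    ultimately have "\<bar>t - s\<bar> / real (Suc m) \<le> 0"
      by (simp add: abs_minus_commute[of s t] algebra_simps)
    then show "s = t" by (simp add: divide_le_0_iff)
  qed
  then have "(\<Union>b\<in>Basis. \<Union>r\<in>(\<rat>::real set). \<Union>m. N b r m) \<in> null_sets lborel"
    by (intro null_sets_UN' countable_rat) (auto intro: countable_finite)
  moreover have "\<exists>g. GDERIV u x :> g" if x: "x \<in> U - (\<Union>b\<in>Basis. \<Union>r\<in>(\<rat>::real set). \<Union>m. N b r m)" for x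
  proof -
    have "\<exists>p. \<forall>\<epsilon>>0. \<exists>\<delta>>0. \<forall>t. \<bar>t\<bar> < \<delta> \<longrightarrow> u (x + t *\<^sub>R b) - u x - t * p \<le> \<epsilon> * \<bar>t\<bar>" if "b \<in> Basis" for b
    proof (rule convex_on_partial_derivative[OF U _ u])
      fix r :: real and m assume "r \<in> \<rat>"
      then have "x \<notin> N b r m" using x that by blast
      then show "\<exists>t. x + t *\<^sub>R b \<in> U \<and> u (x + t *\<^sub>R b) < u x + r * t + \<bar>t\<bar> / real (Suc m)"
        using x by (auto simp: N_def not_le)
    qed (use x in auto)
    then obtain p where "\<And>b \<epsilon>. b \<in> Basis \<Longrightarrow> \<epsilon> > 0 \<Longrightarrow>
        \<exists>\<delta>>0. \<forall>t. \<bar>t\<bar> < \<delta> \<longrightarrow> u (x + t *\<^sub>R b) - u x - t * p b \<le> \<epsilon> * \<bar>t\<bar>" by metis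
    then have "GDERIV u x :> (\<Sum>b\<in>Basis. p b *\<^sub>R b)"
      using x by (intro convex_on_GDERIV_from_partials[OF U _ u]) auto
    then show ?thesis ..
  qed
  ultimately show ?thesis by blast
qed

section \<open>The first variation of the Gaussian functional\<close>

lemma Conv_finite: "\<phi> \<in> Conv \<Longrightarrow> x \<in> effdom \<phi> \<Longrightarrow> \<exists>r. \<phi> x = ereal r"
  by (cases "\<phi> x") (auto simp: Conv_def effdom_def)

lemma Conv_convex_effdom:
  assumes "\<phi> \<in> Conv"
  shows "convex (effdom \<phi>)"
  unfolding convex_alt
proof safe
  fix x y and t :: real assume *: "x \<in> effdom \<phi>" "y \<in> effdom \<phi>" "0 \<le> t" "t \<le> 1"
  then obtain a b where "\<phi> x = ereal a" "\<phi> y = ereal b" using Conv_finite[OF assms] by meson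
  then show "(1 - t) *\<^sub>R x + t *\<^sub>R y \<in> effdom \<phi>"
    using convex_erealD[of \<phi> t x y] assms * by (auto simp: effdom_def Conv_def)
qed

lemma Conv_convex_on:
  assumes "\<phi> \<in> Conv"
  shows "convex_on (interior (effdom \<phi>)) (\<lambda>x. real_of_ereal (\<phi> x))"
proof (rule convex_onI)
  fix t :: real and x y
  assume t: "0 < t" "t < 1" and xy: "x \<in> interior (effdom \<phi>)" "y \<in> interior (effdom \<phi>)"
  then have "x \<in> effdom \<phi>" "y \<in> effdom \<phi>" using interior_subset by blast+
  moreover from this have "(1 - t) *\<^sub>R x + t *\<^sub>R y \<in> effdom \<phi>"
    using Conv_convex_effdom[OF assms] t unfolding convex_alt by auto
  ultimately obtain a b c where "\<phi> x = ereal a" "\<phi> y = ereal b"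
    "\<phi> ((1 - t) *\<^sub>R x + t *\<^sub>R y) = ereal c" using Conv_finite[OF assms] by meson
  then show "real_of_ereal (\<phi> ((1 - t) *\<^sub>R x + t *\<^sub>R y))
      \<le> (1 - t) * real_of_ereal (\<phi> x) + t * real_of_ereal (\<phi> y)"
    using convex_erealD[of \<phi> t x y] assms t by (simp add: Conv_def)
qed (rule convex_interior[OF Conv_convex_effdom[OF assms]])

lemma Conv_measurable: "\<phi> \<in> Conv \<Longrightarrow> \<phi> \<in> borel_measurable borel"
  by (rule lower_semicontinuous_measurable) (simp add: Conv_def)

text \<open>The effective domain is convex, so its boundary is a null set, and in the interior
  almost everywhere differentiability applies.\<close>

lemma Conv_AE_grad_dom:
  fixes \<phi> :: "'a::euclidean_space \<Rightarrow> ereal"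
  assumes \<phi>: "\<phi> \<in> Conv"
  shows "AE x in lborel. x \<in> effdom \<phi> \<longrightarrow> x \<in> grad_dom \<phi>"
proof -
  have [measurable]: "\<phi> \<in> borel_measurable borel" by (rule Conv_measurable[OF \<phi>])
  have "effdom \<phi> \<in> sets borel" unfolding effdom_def by measurable
  then have "effdom \<phi> - interior (effdom \<phi>) \<in> sets lborel" by simp
  moreover have "negligible (effdom \<phi> - interior (effdom \<phi>))"
    using negligible_convex_frontier[OF Conv_convex_effdom[OF \<phi>]]
    by (rule negligible_subset) (use closure_subset in \<open>auto simp: frontier_def\<close>)
  ultimately have "effdom \<phi> - interior (effdom \<phi>) \<in> null_sets lborel"
    by (simp add: negligible_iff_null_sets null_sets_completion_iff)
  then have 1: "AE x in lborel. x \<notin> effdom \<phi> - interior (effdom \<phi>)" by (rule AE_not_in)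
  obtain N where N: "N \<in> null_sets lborel"
    "\<And>x. x \<in> interior (effdom \<phi>) - N \<Longrightarrow> \<exists>g. GDERIV (\<lambda>x. real_of_ereal (\<phi> x)) x :> g"
    using convex_on_differentiable_AE[OF open_interior Conv_convex_on[OF \<phi>]] by blast
  from AE_not_in[OF N(1)] 1 show ?thesis
    by eventually_elim (use N(2) in \<open>auto simp: grad_dom_def has_grad_def\<close>)
qed

text \<open>Each \<open>y k\<close> is an approximate subgradient at \<open>x\<close> with error
  \<open>\<epsilon> k\<close>. Testing it at the fixed distance \<open>s\<close> in the direction of
  \<open>y k - g\<close> and comparing with the first-order expansion gives
  \<open>norm (y k - g) \<le> \<epsilon> k / s + \<eta> / 2\<close>; the radius \<open>s\<close>
  depends on \<open>\<eta>\<close> but not on \<open>k\<close>.\<close>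

lemma near_maximizers_tendsto_grad:
  fixes \<phi> :: "'a::euclidean_space \<Rightarrow> ereal"
  assumes \<phi>: "\<phi> \<in> Conv" and g: "has_grad \<phi> x g"
    and y: "\<And>k. \<phi> x - ereal (\<epsilon> k) \<le> ereal (x \<bullet> y k) - conjugate \<phi> (y k)"
    and \<epsilon>: "\<epsilon> \<longlonglongrightarrow> 0"
  shows "y \<longlonglongrightarrow> g"
proof -
  define u where "u z = real_of_ereal (\<phi> z)" for z
  have fin: "\<phi> z = ereal (u z)" if "z \<in> effdom \<phi>" for z
    using Conv_finite[OF \<phi> that] by (auto simp: u_def)
  have x: "x \<in> interior (effdom \<phi>)" and d: "(u has_derivative (\<lambda>h. h \<bullet> g)) (at x)"
    using g by (auto simp: has_grad_def gderiv_def u_def[abs_def])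
  have xe: "x \<in> effdom \<phi>" using x interior_subset by blast
  have sub: "h \<bullet> y k \<le> u (x + h) - u x + \<epsilon> k" if "x + h \<in> effdom \<phi>" for h k
  proof -
    have "ereal (y k \<bullet> (x + h)) - \<phi> (x + h) \<le> conjugate \<phi> (y k)" by (rule conjugate_upper)
    with y[of k] show ?thesis
      using fin[OF that] fin[OF xe]
      by (cases "conjugate \<phi> (y k)") (auto simp: inner_add_right inner_commute)
  qed
  show ?thesis
  proof (rule metric_LIMSEQ_I)
    fix \<eta> :: real assume \<eta>: "\<eta> > 0"
    obtain r where r: "r > 0" "ball x r \<subseteq> effdom \<phi>"
      using x by (meson mem_interior)
    obtain \<delta> where \<delta>: "\<delta> > 0" "\<And>z. norm (z - x) < \<delta> \<Longrightarrow>
        norm (u z - u x - (z - x) \<bullet> g) \<le> \<eta> / 2 * norm (z - x)"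
      using d \<eta> unfolding has_derivative_at_alt by (meson half_gt_zero)
    define s where "s = min r \<delta> / 2"
    have s: "s > 0" "s < r" "s < \<delta>" using r \<delta> by (auto simp: s_def)
    have bound: "norm (y k - g) \<le> \<epsilon> k / s + \<eta> / 2" for k
    proof (cases "y k = g")
      case True
      have "0 \<le> \<epsilon> k" using sub[of 0 k] xe by simp
      with True s \<eta> show ?thesis by simp
    next
      case False
      define h where "h = s *\<^sub>R sgn (y k - g)"
      have nh: "norm h = s" using False s by (simp add: h_def norm_sgn)
      have "h \<bullet> (y k - g) = s * norm (y k - g)"
        using False by (simp add: h_def sgn_div_norm dot_square_norm power2_eq_square)
      moreover have "x + h \<in> effdom \<phi>" using nh s r by (intro subsetD[OF r(2)]) (simp add: dist_norm)
      then have "h \<bullet> y k \<le> u (x + h) - u x + \<epsilon> k" by (rule sub)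
      moreover have "u (x + h) - u x - h \<bullet> g \<le> \<eta> / 2 * s"
        using \<delta>(2)[of "x + h"] nh s abs_ge_self[of "u (x + h) - u x - h \<bullet> g"] by simp
      ultimately have "s * norm (y k - g) \<le> \<epsilon> k + \<eta> / 2 * s" by (simp add: inner_diff_right)
      then show ?thesis using s by (simp add: field_simps)
    qed
    have "\<forall>\<^sub>F k in sequentially. \<epsilon> k < s * (\<eta> / 2)"
      using \<epsilon> s \<eta> by (intro order_tendstoD) auto
    then have "\<forall>\<^sub>F k in sequentially. dist (y k) g < \<eta>"
    proof eventually_elim
      case (elim k)
      then have "\<epsilon> k / s < \<eta> / 2" using s by (simp add: field_simps)
      with bound[of k] show ?case unfolding dist_norm by linarith
    qed
    then show "\<exists>N. \<forall>k\<ge>N. dist (y k) g < \<eta>" by (simp add: eventually_sequentially)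
  qed
qed

text \<open>Conjugation does not expand uniform distances. Two inequalities with an added constant
  are stated instead of a bound on a difference, so that infinite values are covered.\<close>

lemma conjugate_perturb_le:
  assumes "\<And>y. \<bar>k y\<bar> \<le> c"
  shows "conjugate (\<lambda>y. f y + ereal (k y)) x \<le> conjugate f x + ereal c"
    and "conjugate f x \<le> conjugate (\<lambda>y. f y + ereal (k y)) x + ereal c"
proof -
  show "conjugate (\<lambda>y. f y + ereal (k y)) x \<le> conjugate f x + ereal c"
  proof (rule conjugate_le)
    show "ereal (x \<bullet> y) - (f y + ereal (k y)) \<le> conjugate f x + ereal c" for y
      using conjugate_upper[of x y f] assms[of y]
      by (cases "f y"; cases "conjugate f x") auto
  qed
  show "conjugate f x \<le> conjugate (\<lambda>y. f y + ereal (k y)) x + ereal c"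
  proof (rule conjugate_le)
    show "ereal (x \<bullet> y) - f y \<le> conjugate (\<lambda>y. f y + ereal (k y)) x + ereal c" for y
      using conjugate_upper[of x y "\<lambda>y. f y + ereal (k y)"] assms[of y]
      by (cases "f y"; cases "conjugate (\<lambda>y. f y + ereal (k y)) x") auto
  qed
qed

lemma conjugate_near_maximizer:
  assumes "conjugate f x = ereal a" "0 < \<epsilon>"
  shows "\<exists>y r. f y = ereal r \<and> a - \<epsilon> \<le> x \<bullet> y - r"
proof -
  have "ereal (a - \<epsilon>) < conjugate f x" using assms by simp
  then obtain y where "ereal (a - \<epsilon>) < ereal (x \<bullet> y) - f y"
    unfolding conjugate_def less_SUP_iff by auto
  moreover have "ereal (x \<bullet> y) - f y \<le> ereal a" using conjugate_upper[of x y f] assms by simp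
  ultimately show ?thesis by (cases "f y") (auto intro!: exI[of _ y])
qed

text \<open>The near-maximizers of both suprema converge to the gradient, and squeeze the difference quotient.\<close>

lemma conjugate_perturb_derivative:
  fixes \<phi> :: "'a::euclidean_space \<Rightarrow> ereal" and h :: "'a \<Rightarrow> real"
  assumes \<phi>: "\<phi> \<in> Conv" "conjugate (conjugate \<phi>) = \<phi>" and g: "has_grad \<phi> x g"
    and h: "continuous_on UNIV h" "\<And>y. \<bar>h y\<bar> \<le> C"
    and t: "\<And>k. 0 < t k" "t \<longlonglongrightarrow> 0"
  shows "\<exists>d. (\<forall>k. conjugate (\<lambda>y. conjugate \<phi> y + ereal (t k * h y)) x
      = ereal (real_of_ereal (\<phi> x) + t k * d k)) \<and> d \<longlonglongrightarrow> - h g"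
proof -
  define f where "f = conjugate \<phi>"
  define \<psi> where "\<psi> k = conjugate (\<lambda>y. f y + ereal (t k * h y)) x" for k
  have x: "x \<in> effdom \<phi>" using g interior_subset by (auto simp: has_grad_def)
  then obtain a where a: "\<phi> x = ereal a" using Conv_finite[OF \<phi>(1)] by blast
  have fa: "conjugate f x = ereal a" using a \<phi>(2) by (simp add: f_def)
  have th: "\<bar>t k * h y\<bar> \<le> t k * C" for k y using t(1)[of k] h(2)[of y] by (simp add: abs_mult)
  have "\<exists>b. \<psi> k = ereal b" for k
    using conjugate_perturb_le[of "\<lambda>y. t k * h y", OF th, where f = f and x = x]
    by (cases "\<psi> k") (auto simp: \<psi>_def[symmetric] fa)
  then obtain b where b: "\<And>k. \<psi> k = ereal (b k)" by metis
  define d where "d k = (b k - a) / t k" for k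
  have d: "b k = a + t k * d k" for k using t(1)[of k] by (simp add: d_def)
  \<comment> \<open>The suprema need not be attained. The tolerance is the square of
    \<open>t k\<close>, so that it still vanishes after division by \<open>t k\<close>.\<close>
  have t2: "0 < (t k)\<^sup>2" for k using t(1)[of k] by simp
  have "\<exists>y r. f y + ereal (t k * h y) = ereal r \<and> b k - (t k)\<^sup>2 \<le> x \<bullet> y - r" for k
    using b t2 by (intro conjugate_near_maximizer) (auto simp: \<psi>_def)
  then have "\<exists>y r. f y = ereal r \<and> b k - (t k)\<^sup>2 \<le> x \<bullet> y - r - t k * h y" for k
  proof -
    from \<open>\<exists>y r. f y + ereal (t k * h y) = ereal r \<and> b k - (t k)\<^sup>2 \<le> x \<bullet> y - r\<close>
    obtain y r where "f y + ereal (t k * h y) = ereal r" "b k - (t k)\<^sup>2 \<le> x \<bullet> y - r" by blast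
    then show ?thesis by (cases "f y") (auto intro!: exI[of _ y])
  qed
  then obtain y r where y: "\<And>k. f (y k) = ereal (r k)" "\<And>k. b k - (t k)\<^sup>2 \<le> x \<bullet> y k - r k - t k * h (y k)"
    by metis
  have "\<exists>y r. f y = ereal r \<and> a - (t k)\<^sup>2 \<le> x \<bullet> y - r" for k
    using fa t2 by (intro conjugate_near_maximizer)
  then obtain z q where z: "\<And>k. f (z k) = ereal (q k)" "\<And>k. a - (t k)\<^sup>2 \<le> x \<bullet> z k - q k"
    by metis
  have max_a: "x \<bullet> w - s \<le> a" if "f w = ereal s" for w s
    using conjugate_upper[of x w f] that fa by simp
  have ab: "a \<le> b k + t k * C" for k
    using conjugate_perturb_le(2)[of "\<lambda>y. t k * h y", OF th, where f = f and x = x] b[of k]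
    by (simp add: \<psi>_def fa)
  have "y \<longlonglongrightarrow> g"
  proof (rule near_maximizers_tendsto_grad[OF \<phi>(1) g])
    \<comment> \<open>A near-maximizer of the perturbed supremum loses \<open>t k * C\<close> when
      the perturbation is dropped and another \<open>t k * C\<close> when the perturbed value is
      replaced by \<open>a\<close>.\<close>
    show "(\<lambda>k. 2 * t k * C + (t k)\<^sup>2) \<longlonglongrightarrow> 0"
      by (auto intro!: tendsto_eq_intros t(2))
    show "\<phi> x - ereal (2 * t k * C + (t k)\<^sup>2) \<le> ereal (x \<bullet> y k) - conjugate \<phi> (y k)" for k
      using y[of k] ab[of k] th[of k "y k"] by (simp add: a f_def[symmetric])
  qed
  then have hy: "(\<lambda>k. h (y k)) \<longlonglongrightarrow> h g"
    using h(1) by (auto intro: continuous_on_tendsto_compose)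
  have "z \<longlonglongrightarrow> g"
  proof (rule near_maximizers_tendsto_grad[OF \<phi>(1) g])
    show "(\<lambda>k. (t k)\<^sup>2) \<longlonglongrightarrow> 0"
      by (auto intro!: tendsto_eq_intros t(2))
    show "\<phi> x - ereal ((t k)\<^sup>2) \<le> ereal (x \<bullet> z k) - conjugate \<phi> (z k)" for k
      using z[of k] by (simp add: a f_def[symmetric])
  qed
  then have hz: "(\<lambda>k. h (z k)) \<longlonglongrightarrow> h g"
    using h(1) by (auto intro: continuous_on_tendsto_compose)
  have "d \<longlonglongrightarrow> - h g"
  proof (rule tendsto_sandwich)
    show "(\<lambda>k. - t k - h (z k)) \<longlonglongrightarrow> - h g" "(\<lambda>k. t k - h (y k)) \<longlonglongrightarrow> - h g"
      by (auto intro!: tendsto_eq_intros t(2) hy hz)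
    show "\<forall>\<^sub>F k in sequentially. - t k - h (z k) \<le> d k"
    proof (rule always_eventually, rule allI)
      fix k
      have "x \<bullet> z k - q k - t k * h (z k) \<le> b k"
        using conjugate_upper[of x "z k" "\<lambda>y. f y + ereal (t k * h y)"] z(1)[of k] b[of k] by (simp add: \<psi>_def)
      with z(2)[of k] have "t k * (- t k - h (z k)) \<le> t k * d k"
        by (simp add: d[of k] algebra_simps power2_eq_square)
      then show "- t k - h (z k) \<le> d k" using t(1)[of k] by simp
    qed
    show "\<forall>\<^sub>F k in sequentially. d k \<le> t k - h (y k)"
    proof (rule always_eventually, rule allI)
      fix k
      have "t k * d k \<le> t k * (t k - h (y k))"
        using y(2)[of k] max_a[OF y(1)[of k]] by (simp add: d[of k] algebra_simps power2_eq_square)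
      then show "d k \<le> t k - h (y k)" using t(1)[of k] by simp
    qed
  qed
  then show ?thesis using b d a by (auto simp: \<psi>_def f_def)
qed

text \<open>Caratheodory's form \<open>F z - F a = q z * (z - a)\<close> allows the increment
  \<open>d k\<close> to vary with \<open>k\<close>, and even to vanish, without dividing by
  it.\<close>

lemma DERIV_tendsto_compose:
  fixes F :: "real \<Rightarrow> real"
  assumes F: "DERIV F a :> F'" and d: "d \<longlonglongrightarrow> d0" and t: "\<And>k. t k \<noteq> 0" "t \<longlonglongrightarrow> 0"
  shows "(\<lambda>k. (F (a + t k * d k) - F a) / t k) \<longlonglongrightarrow> F' * d0"
proof -
  obtain q where q: "\<And>z. F z - F a = q z * (z - a)" "isCont q a" "q a = F'"
    using F CARAT_DERIV[of F F' a] by auto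
  have "(\<lambda>k. a + t k * d k) \<longlonglongrightarrow> a" by (auto intro!: tendsto_eq_intros t(2) d)
  then have "(\<lambda>k. q (a + t k * d k)) \<longlonglongrightarrow> q a" using q(2) by (rule isCont_tendsto_compose[rotated])
  then have "(\<lambda>k. q (a + t k * d k) * d k) \<longlonglongrightarrow> F' * d0" using d q(3) by (auto intro: tendsto_mult)
  moreover have "(F (a + t k * d k) - F a) / t k = q (a + t k * d k) * d k" for k
    using t(1)[of k] by (simp add: q(1))
  ultimately show ?thesis by simp
qed

definition gauss_functional :: "('a::euclidean_space \<Rightarrow> ereal) \<Rightarrow> real" where
  "gauss_functional \<phi> = (\<integral>x. gauss_tail_ereal (\<phi> x) * exp (- (norm x)\<^sup>2 / 2) \<partial>lborel)"

lemma gauss_functional_integrable: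
  assumes [measurable]: "\<phi> \<in> borel_measurable borel"
  shows "integrable lborel (\<lambda>x::'a::euclidean_space. gauss_tail_ereal (\<phi> x) * exp (- (norm x)\<^sup>2 / 2))"
proof (rule Bochner_Integration.integrable_bound)
  define K where "K = (\<integral>t. exp (- t\<^sup>2 / 2 :: real) \<partial>lborel)"
  show "integrable lborel (\<lambda>x::'a. K * exp (- (norm x)\<^sup>2 / 2))"
    by (intro integrable_mult_right integrable_gaussian)
  show "AE x in lborel. norm (gauss_tail_ereal (\<phi> x) * exp (- (norm x)\<^sup>2 / 2)) \<le> norm (K * exp (- (norm x)\<^sup>2 / 2))"
    using gauss_tail_ereal_bounded gauss_tail_ereal_nonneg
    by (auto simp: abs_mult K_def intro!: AE_I2 mult_right_mono order_trans[OF _ abs_ge_self])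
qed measurable

text \<open>The pointwise quotient is bounded by \<open>C\<close>, because \<open>gauss_tail\<close>
  is 1-Lipschitz and conjugation does not expand uniform distances; hence dominated convergence
  applies. The minus signs of \<open>DERIV_gauss_tail\<close> and of the limit \<open>- h g\<close>
  cancel. Almost everywhere outside \<open>grad_dom \<phi>\<close>, both \<open>\<phi>\<close> and
  its perturbations are \<open>\<infinity>\<close> and contribute nothing.\<close>

lemma gauss_functional_derivative:
  fixes \<phi> :: "'a::euclidean_space \<Rightarrow> ereal" and h :: "'a \<Rightarrow> real"
  assumes \<phi>: "\<phi> \<in> Conv" "conjugate (conjugate \<phi>) = \<phi>"
    and h: "continuous_on UNIV h" "\<And>y. \<bar>h y\<bar> \<le> C"
    and t: "\<And>k. 0 < t k" "t \<longlonglongrightarrow> 0"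
  shows "(\<lambda>k. (gauss_functional (conjugate (\<lambda>y. conjugate \<phi> y + ereal (t k * h y))) - gauss_functional \<phi>) / t k)
    \<longlonglongrightarrow> (\<integral>x. exp_half_sq (\<phi> x) * exp (- (norm x)\<^sup>2 / 2) * indicator (grad_dom \<phi>) x * h (grad \<phi> x) \<partial>lborel)"
proof -
  define \<psi> where "\<psi> k = conjugate (\<lambda>y. conjugate \<phi> y + ereal (t k * h y))" for k
  define \<gamma> where "\<gamma> x = exp (- (norm x)\<^sup>2 / 2)" for x :: 'a
  have [measurable]: "\<phi> \<in> borel_measurable borel" "grad \<phi> \<in> borel_measurable borel"
      "grad_dom \<phi> \<in> sets borel" "h \<in> borel_measurable borel" "\<psi> k \<in> borel_measurable borel" for k
    unfolding \<psi>_def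
    by (rule Conv_measurable[OF \<phi>(1)] grad_borel_measurable[OF \<phi>(1)] grad_dom_borel[OF \<phi>(1)]
        borel_measurable_continuous_onI[OF h(1)] conjugate_measurable)+
  have [measurable]: "\<gamma> \<in> borel_measurable borel" unfolding \<gamma>_def by measurable
  have th: "\<bar>t k * h y\<bar> \<le> t k * C" for k y using t(1)[of k] h(2)[of y] by (simp add: abs_mult)
  have tn: "t k \<noteq> 0" for k using t(1)[of k] by simp
  have lip: "\<bar>(gauss_tail_ereal (\<psi> k x) - gauss_tail_ereal (\<phi> x)) / t k\<bar> \<le> C" for k x
  proof -
    have "\<psi> k x \<le> \<phi> x + ereal (t k * C)" "\<phi> x \<le> \<psi> k x + ereal (t k * C)"
      using conjugate_perturb_le[of "\<lambda>y. t k * h y", OF th, where f = "conjugate \<phi>" and x = x]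
      by (simp_all add: \<psi>_def \<phi>(2))
    moreover have "0 \<le> C" using h(2)[of 0] by simp
    ultimately have "\<bar>gauss_tail_ereal (\<psi> k x) - gauss_tail_ereal (\<phi> x)\<bar> \<le> t k * C"
      using t(1)[of k]
      by (cases "\<psi> k x"; cases "\<phi> x")
         (auto intro!: order_trans[OF gauss_tail_lipschitz] simp: gauss_tail_ereal_def)
    then show ?thesis using t(1)[of k] by (simp add: field_simps)
  qed
  have "(\<lambda>k. \<integral>x. (gauss_tail_ereal (\<psi> k x) - gauss_tail_ereal (\<phi> x)) / t k * \<gamma> x \<partial>lborel) \<longlonglongrightarrow>
      (\<integral>x. exp_half_sq (\<phi> x) * \<gamma> x * indicator (grad_dom \<phi>) x * h (grad \<phi> x) \<partial>lborel)"
  proof (rule integral_dominated_convergence)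
    show "integrable lborel (\<lambda>x. C * \<gamma> x)" unfolding \<gamma>_def
      by (intro integrable_mult_right integrable_gaussian)
    show "AE x in lborel. norm ((gauss_tail_ereal (\<psi> k x) - gauss_tail_ereal (\<phi> x)) / t k * \<gamma> x) \<le> C * \<gamma> x" for k
      unfolding real_norm_def abs_mult \<gamma>_def abs_exp_cancel by (intro AE_I2 mult_right_mono lip) simp
    show "AE x in lborel. (\<lambda>k. (gauss_tail_ereal (\<psi> k x) - gauss_tail_ereal (\<phi> x)) / t k * \<gamma> x)
        \<longlonglongrightarrow> exp_half_sq (\<phi> x) * \<gamma> x * indicator (grad_dom \<phi>) x * h (grad \<phi> x)"
      using Conv_AE_grad_dom[OF \<phi>(1)]
    proof eventually_elim
      case (elim x)
      show ?case
      proof (cases "x \<in> grad_dom \<phi>")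
        case True
        then obtain g where g: "has_grad \<phi> x g" by (auto simp: grad_dom_def)
        then have "x \<in> effdom \<phi>" using interior_subset by (auto simp: has_grad_def)
        then obtain a where a: "\<phi> x = ereal a" using Conv_finite[OF \<phi>(1)] by blast
        obtain d where d: "\<And>k. \<psi> k x = ereal (a + t k * d k)" "d \<longlonglongrightarrow> - h g"
          using conjugate_perturb_derivative[OF \<phi> g h t] a by (auto simp: \<psi>_def)
        have "(\<lambda>k. (gauss_tail (a + t k * d k) - gauss_tail a) / t k) \<longlonglongrightarrow> (- exp (- a\<^sup>2 / 2)) * (- h g)"
          by (rule DERIV_tendsto_compose[OF DERIV_gauss_tail d(2) tn t(2)])
        then have "(\<lambda>k. (gauss_tail (a + t k * d k) - gauss_tail a) / t k * \<gamma> x) \<longlonglongrightarrow> (exp (- a\<^sup>2 / 2) * h g) * \<gamma> x"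
          by (intro tendsto_mult tendsto_const) simp
        then show ?thesis using True grad_eq[OF g] a d(1) by (simp add: exp_half_sq_def mult_ac)
      next
        case False
        with elim have "\<phi> x = \<infinity>" by (simp add: effdom_def)
        moreover have "\<psi> k x = \<infinity>" for k
          using conjugate_perturb_le(2)[of "\<lambda>y. t k * h y", OF th, where f = "conjugate \<phi>" and x = x] \<open>\<phi> x = \<infinity>\<close>
          by (cases "\<psi> k x") (auto simp: \<psi>_def \<phi>(2))
        ultimately show ?thesis using False by simp
      qed
    qed
  qed measurable
  moreover have "(\<integral>x. (gauss_tail_ereal (\<psi> k x) - gauss_tail_ereal (\<phi> x)) / t k * \<gamma> x \<partial>lborel)
      = (gauss_functional (\<psi> k) - gauss_functional \<phi>) / t k" for k
  proof -
    have "gauss_functional (\<psi> k) - gauss_functional \<phi>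
        = (\<integral>x. gauss_tail_ereal (\<psi> k x) * \<gamma> x - gauss_tail_ereal (\<phi> x) * \<gamma> x \<partial>lborel)"
      unfolding gauss_functional_def \<gamma>_def
      by (rule Bochner_Integration.integral_diff[symmetric]) (rule gauss_functional_integrable, measurable)+
    then show ?thesis
      by (simp add: left_diff_distrib)
  qed
  ultimately show ?thesis by (simp only: \<psi>_def \<gamma>_def)
qed

section \<open>Existence of a maximizer\<close>

text \<open>Uniformity in the direction comes from compactness of the sphere: slabs violating the
  bound, with widths tending to 0, would have normals converging to some \<open>v\<close>, and their
  indicators converge to 0 off the null hyperplane orthogonal to \<open>v\<close>.\<close>

lemma gaussian_slab_small:
  assumes "0 < \<epsilon>"
  shows "\<exists>r>0. \<forall>u::'a::euclidean_space. norm u = 1 \<longrightarrow>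
    (\<integral>x. indicator {x. \<bar>x \<bullet> u\<bar> < r} x * exp (- (norm x)\<^sup>2 / 2) \<partial>lborel) < \<epsilon>"
  (is "\<exists>r>0. ?P r")
proof (rule ccontr)
  assume "\<not> (\<exists>r>0. ?P r)"
  then have "\<not> ?P (1 / real (Suc k))" for k by simp
  then have "\<exists>u::'a. norm u = 1 \<and>
      \<epsilon> \<le> (\<integral>x. indicator {x. \<bar>x \<bullet> u\<bar> < 1 / real (Suc k)} x * exp (- (norm x)\<^sup>2 / 2) \<partial>lborel)" for k
    unfolding not_all not_imp not_less by blast
  then have "\<forall>k. \<exists>u::'a. norm u = 1 \<and>
      \<epsilon> \<le> (\<integral>x. indicator {x. \<bar>x \<bullet> u\<bar> < 1 / real (Suc k)} x * exp (- (norm x)\<^sup>2 / 2) \<partial>lborel)" ..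
  from choice[OF this] obtain u :: "nat \<Rightarrow> 'a" where u: "\<And>k. norm (u k) = 1"
    "\<And>k. \<epsilon> \<le> (\<integral>x. indicator {x. \<bar>x \<bullet> u k\<bar> < 1 / real (Suc k)} x * exp (- (norm x)\<^sup>2 / 2) \<partial>lborel)"
    by blast
  have "seq_compact (sphere (0::'a) 1)" by (simp add: compact_imp_seq_compact)
  moreover have "\<forall>k. u k \<in> sphere 0 1" using u(1) by simp
  ultimately obtain v s where v: "v \<in> sphere 0 1" and s: "strict_mono s" "(u \<circ> s) \<longlonglongrightarrow> v"
    by (rule seq_compactE)
  let ?f = "\<lambda>k x. indicator {x. \<bar>x \<bullet> u (s k)\<bar> < 1 / real (Suc (s k))} x * exp (- (norm x)\<^sup>2 / 2) :: real"
  have "(\<lambda>k. \<integral>x. ?f k x \<partial>lborel) \<longlonglongrightarrow> integral\<^sup>L lborel (\<lambda>x::'a. 0 :: real)"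
  proof (rule integral_dominated_convergence)
    show "integrable lborel (\<lambda>x::'a. exp (- (norm x)\<^sup>2 / 2))" by (rule integrable_gaussian)
    have "v \<noteq> 0" using v by auto
    then have "negligible {x. v \<bullet> x = 0}" by (intro negligible_hyperplane) simp
    moreover have "{x. v \<bullet> x = 0} \<in> sets lborel" by (simp add: borel_closed closed_hyperplane)
    ultimately have "{x. v \<bullet> x = 0} \<in> null_sets lborel"
      by (simp add: negligible_iff_null_sets null_sets_completion_iff)
    then have "AE x in lborel. x \<notin> {x. v \<bullet> x = 0}" by (rule AE_not_in)
    then show "AE x in lborel. (\<lambda>k. ?f k x) \<longlonglongrightarrow> 0"
    proof eventually_elim
      case (elim x)
      have "(\<lambda>k. \<bar>x \<bullet> u (s k)\<bar>) \<longlonglongrightarrow> \<bar>x \<bullet> v\<bar>"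
        using s(2) by (intro tendsto_intros) (simp add: o_def)
      moreover have "(\<lambda>k. 1 / real (Suc (s k))) \<longlonglongrightarrow> 0"
        using LIMSEQ_subseq_LIMSEQ[OF LIMSEQ_inverse_real_of_nat s(1)] by (simp add: o_def inverse_eq_divide)
      ultimately have "(\<lambda>k. \<bar>x \<bullet> u (s k)\<bar> - 1 / real (Suc (s k))) \<longlonglongrightarrow> \<bar>x \<bullet> v\<bar> - 0"
        by (rule tendsto_diff)
      moreover have "0 < \<bar>x \<bullet> v\<bar> - 0" using elim by (simp add: inner_commute)
      ultimately have "\<forall>\<^sub>F k in sequentially. 0 < \<bar>x \<bullet> u (s k)\<bar> - 1 / real (Suc (s k))"
        by (rule order_tendstoD)
      then have "\<forall>\<^sub>F k in sequentially. ?f k x = 0" by eventually_elim auto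
      then show ?case by (rule tendsto_eventually)
    qed
  qed (auto simp: indicator_def)
  then have "\<epsilon> \<le> 0"
    using u(2) by (intro LIMSEQ_le_const[where X = "\<lambda>k. \<integral>x. ?f k x \<partial>lborel"]) auto
  with assms show False by simp
qed

text \<open>Once \<open>-\<infinity>\<close> is excluded, \<open>gauss_tail_ereal\<close> vanishes
  at \<open>\<infinity>\<close> only. This is how positivity of the maximum later yields a nonzero
  moment measure.\<close>

lemma gauss_functional_pos_iff:
  assumes [measurable]: "\<phi> \<in> borel_measurable borel" and "\<And>x. \<phi> x \<noteq> -\<infinity>"
  shows "0 < gauss_functional \<phi> \<longleftrightarrow> \<not> (AE x in lborel. \<phi> x = \<infinity>)"
proof -
  have "gauss_functional \<phi> = 0 \<longleftrightarrow> (AE x in lborel. gauss_tail_ereal (\<phi> x) * exp (- (norm x)\<^sup>2 / 2) = 0)"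
    unfolding gauss_functional_def
    by (rule integral_nonneg_eq_0_iff_AE[OF gauss_functional_integrable]) (auto simp: gauss_tail_ereal_nonneg)
  also have "\<dots> \<longleftrightarrow> (AE x in lborel. \<phi> x = \<infinity>)"
  proof -
    have "gauss_tail_ereal (\<phi> x) = 0 \<longleftrightarrow> \<phi> x = \<infinity>" for x
      using assms(2)[of x] less_imp_neq[OF gauss_tail_pos] by (cases "\<phi> x") auto
    then show ?thesis by simp
  qed
  moreover have "0 \<le> gauss_functional \<phi>"
    unfolding gauss_functional_def by (intro integral_nonneg_AE) (auto simp: gauss_tail_ereal_nonneg)
  ultimately show ?thesis by linarith
qed

text \<open>\<open>admissible \<mu>\<close> encodes the constraint \<open>\<integral> conjugate \<phi> d\<mu> \<le> 0\<close>; the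
  shift by \<open>m\<close> makes the integrand nonnegative, since \<open>conjugate \<phi> \<ge> - \<phi> 0\<close>.\<close>

definition admissible :: "'a::euclidean_space measure \<Rightarrow> ('a \<Rightarrow> ereal) \<Rightarrow> bool" where
  "admissible \<mu> \<phi> \<longleftrightarrow> conjugate (conjugate \<phi>) = \<phi> \<and> (\<forall>x. \<phi> (- x) = \<phi> x) \<and>
     (\<exists>m\<ge>0. \<phi> 0 \<le> ereal m \<and> (\<integral>\<^sup>+ y. e2ennreal (conjugate \<phi> y + ereal m) \<partial>\<mu>) \<le> ennreal m)"

section \<open>Uniform bounds on the constraint class\<close>

locale spanning_even_measure = prob_space \<mu> for \<mu> :: "'a::euclidean_space measure" +
  assumes sets_eq [measurable_cong, simp]: "sets \<mu> = sets borel"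
    and even: "even_measure \<mu>"
    and spanning: "\<And>S. subspace S \<Longrightarrow> dim S < DIM('a) \<Longrightarrow> emeasure \<mu> (- S) \<noteq> 0"
    and moment: "(\<integral>\<^sup>+ x. ennreal (norm x) \<partial>\<mu>) < \<infinity>"
begin

lemma space_eq [simp]: "space \<mu> = UNIV"
  using sets_eq_imp_space_eq[OF sets_eq] by simp

lemma emeasure_UNIV [simp]: "emeasure \<mu> UNIV = 1"
  using emeasure_space_1 by simp

lemma admissible_even: "admissible \<mu> \<phi> \<Longrightarrow> \<phi> (- x) = \<phi> x"
  by (simp add: admissible_def)

lemma admissible_biconjugate: "admissible \<mu> \<phi> \<Longrightarrow> conjugate (conjugate \<phi>) = \<phi>"
  by (simp add: admissible_def)

lemma admissible_not_MInf:
  assumes "admissible \<mu> \<phi>"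
  shows "\<phi> x \<noteq> -\<infinity>"
proof
  assume x: "\<phi> x = -\<infinity>"
  obtain m where m: "m \<ge> 0" "(\<integral>\<^sup>+ y. e2ennreal (conjugate \<phi> y + ereal m) \<partial>\<mu>) \<le> ennreal m"
    using assms by (auto simp: admissible_def)
  have "conjugate \<phi> y = \<infinity>" for y using conjugate_upper[of y x \<phi>] x by simp
  then show False using m by (simp add: top_unique)
qed

lemma admissible_Conv:
  assumes "admissible \<mu> \<phi>"
  shows "\<phi> \<in> Conv"
proof -
  have "\<phi> 0 \<noteq> \<infinity>" using assms by (auto simp: admissible_def)
  then show ?thesis
    using admissible_not_MInf[OF assms] convex_ereal_conjugate[of "conjugate \<phi>"]
      lower_semicontinuous_conjugate[of "conjugate \<phi>"] admissible_biconjugate[OF assms]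
    by (auto simp: Conv_def)
qed

text \<open>The conjugate is bounded below by \<open>- \<phi> 0\<close>, while its mean is at most 0
  and \<open>\<mu>\<close> has mass 1; hence \<open>0 \<le> \<phi> 0\<close>.\<close>

lemma admissible_at_0:
  assumes "admissible \<mu> \<phi>"
  obtains c where "\<phi> 0 = ereal c" "0 \<le> c" "\<And>y. ereal (- c) \<le> conjugate \<phi> y"
proof -
  obtain m where m: "m \<ge> 0" "\<phi> 0 \<le> ereal m" "(\<integral>\<^sup>+ y. e2ennreal (conjugate \<phi> y + ereal m) \<partial>\<mu>) \<le> ennreal m"
    using assms by (auto simp: admissible_def)
  obtain c where c: "\<phi> 0 = ereal c"
    using m(2) admissible_not_MInf[OF assms, of 0] by (cases "\<phi> 0") auto
  have low: "ereal (- c) \<le> conjugate \<phi> y" for y using conjugate_upper[of y 0 \<phi>] c by simp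
  have "ennreal (m - c) = (\<integral>\<^sup>+ y. ennreal (m - c) \<partial>\<mu>)" by simp
  also have "\<dots> \<le> (\<integral>\<^sup>+ y. e2ennreal (conjugate \<phi> y + ereal m) \<partial>\<mu>)"
  proof (rule nn_integral_mono)
    fix y
    have "ereal (m - c) \<le> conjugate \<phi> y + ereal m" using low[of y] by (cases "conjugate \<phi> y") auto
    then have "e2ennreal (ereal (m - c)) \<le> e2ennreal (conjugate \<phi> y + ereal m)" by (rule e2ennreal_mono)
    then show "ennreal (m - c) \<le> e2ennreal (conjugate \<phi> y + ereal m)" by simp
  qed
  also note m(3)
  finally have "m - c \<le> m" using m(1) by (simp add: ennreal_le_iff)
  with c low show ?thesis by (intro that) auto
qed

text \<open>The origin is the midpoint of \<open>x\<close> and \<open>- x\<close>, so convexity and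
  evenness make \<open>\<phi> 0\<close> the minimum.\<close>

lemma admissible_ge_0:
  assumes "admissible \<mu> \<phi>"
  shows "0 \<le> \<phi> x"
proof -
  obtain c where c: "\<phi> 0 = ereal c" "0 \<le> c" using admissible_at_0[OF assms] by blast
  have "\<phi> ((1 - 1/2) *\<^sub>R x + (1/2) *\<^sub>R (- x)) \<le> ereal (1 - 1/2) * \<phi> x + ereal (1/2) * \<phi> (- x)"
    using admissible_Conv[OF assms] by (intro convex_erealD) (auto simp: Conv_def)
  then show ?thesis
    using c admissible_even[OF assms, of x] by (cases "\<phi> x") auto
qed

lemma admissible_measurable: "admissible \<mu> \<phi> \<Longrightarrow> \<phi> \<in> borel_measurable borel"
  by (rule Conv_measurable[OF admissible_Conv])

lemma nn_integral_conjugate_shift: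
  assumes low: "\<And>y. ereal (- a) \<le> conjugate \<phi> y" and "a \<le> b"
  shows "(\<integral>\<^sup>+ y. e2ennreal (conjugate \<phi> y + ereal b) \<partial>\<mu>)
    = (\<integral>\<^sup>+ y. e2ennreal (conjugate \<phi> y + ereal a) \<partial>\<mu>) + ennreal (b - a)"
proof -
  have "e2ennreal (conjugate \<phi> y + ereal b) = e2ennreal (conjugate \<phi> y + ereal a) + ennreal (b - a)" for y
    using low[of y] assms(2) by (cases "conjugate \<phi> y") (auto simp flip: ennreal_plus)
  then have "(\<integral>\<^sup>+ y. e2ennreal (conjugate \<phi> y + ereal b) \<partial>\<mu>)
      = (\<integral>\<^sup>+ y. e2ennreal (conjugate \<phi> y + ereal a) + ennreal (b - a) \<partial>\<mu>)" by simp
  also have "\<dots> = (\<integral>\<^sup>+ y. e2ennreal (conjugate \<phi> y + ereal a) \<partial>\<mu>) + ennreal (b - a)"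
    by (subst nn_integral_add) auto
  finally show ?thesis .
qed

text \<open>The shift in \<open>admissible\<close> is existential. Any shift that dominates
  \<open>\<phi> 0\<close> serves equally well, so a whole sequence can share one shift.\<close>

lemma admissible_integral_le:
  assumes \<phi>: "admissible \<mu> \<phi>" and m': "\<phi> 0 \<le> ereal m'"
  shows "(\<integral>\<^sup>+ y. e2ennreal (conjugate \<phi> y + ereal m') \<partial>\<mu>) \<le> ennreal m'"
proof -
  obtain m where m: "m \<ge> 0" "\<phi> 0 \<le> ereal m" "(\<integral>\<^sup>+ y. e2ennreal (conjugate \<phi> y + ereal m) \<partial>\<mu>) \<le> ennreal m"
    using \<phi> by (auto simp: admissible_def)
  obtain c where c: "\<phi> 0 = ereal c" "0 \<le> c" "\<And>y. ereal (- c) \<le> conjugate \<phi> y"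
    using admissible_at_0[OF \<phi>] by blast
  have low: "ereal (- a) \<le> conjugate \<phi> y" if "c \<le> a" for a y
    using c(3)[of y] that by (intro order_trans[OF _ c(3)[of y]]) simp
  show ?thesis
  proof (cases "m \<le> m'")
    case True
    then have "(\<integral>\<^sup>+ y. e2ennreal (conjugate \<phi> y + ereal m') \<partial>\<mu>) \<le> ennreal m + ennreal (m' - m)"
      using m c by (subst nn_integral_conjugate_shift[OF low, of m]) (auto intro!: add_mono)
    also have "\<dots> = ennreal m'" using True m(1) by (simp flip: ennreal_plus)
    finally show ?thesis .
  next
    case False
    have "(\<integral>\<^sup>+ y. e2ennreal (conjugate \<phi> y + ereal m') \<partial>\<mu>) + ennreal (m - m') \<le> ennreal m' + ennreal (m - m')"
      using nn_integral_conjugate_shift[OF low, of m' m] m m' c False by (simp flip: ennreal_plus)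
    then show ?thesis by simp
  qed
qed

text \<open>The function \<open>f\<close> is the norm minus its mean \<open>a\<close>, which is
  finite by the moment assumption, so \<open>f\<close> has mean 0. Its conjugate is at most
  \<open>a\<close> on the unit ball, which has positive volume.\<close>

lemma admissible_exists:
  obtains \<phi> where "admissible \<mu> \<phi>" "0 < gauss_functional \<phi>"
proof -
  define a where "a = enn2real (\<integral>\<^sup>+ y. ennreal (norm y) \<partial>\<mu>)"
  have a: "(\<integral>\<^sup>+ y. ennreal (norm y) \<partial>\<mu>) = ennreal a" "0 \<le> a"
    using moment by (simp_all add: a_def less_top)
  define f where "f y = ereal (norm y - a)" for y :: 'a
  define \<phi> where "\<phi> = conjugate f"
  have \<phi>_le: "\<phi> x \<le> ereal a" if "norm x \<le> 1" for x
    unfolding \<phi>_def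
  proof (rule conjugate_le)
    fix y
    have "x \<bullet> y \<le> norm x * norm y" by (rule norm_cauchy_schwarz)
    also have "\<dots> \<le> 1 * norm y" using that by (intro mult_right_mono) auto
    finally show "ereal (x \<bullet> y) - f y \<le> ereal a" by (simp add: f_def)
  qed
  have "(\<integral>\<^sup>+ y. e2ennreal (conjugate \<phi> y + ereal a) \<partial>\<mu>) \<le> (\<integral>\<^sup>+ y. ennreal (norm y) \<partial>\<mu>)"
  proof (rule nn_integral_mono)
    fix y
    have "conjugate \<phi> y + ereal a \<le> ereal (norm y)"
      using conjugate_conjugate_le[of f y] by (cases "conjugate \<phi> y") (auto simp: f_def \<phi>_def)
    then have "e2ennreal (conjugate \<phi> y + ereal a) \<le> e2ennreal (ereal (norm y))" by (rule e2ennreal_mono)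
    then show "e2ennreal (conjugate \<phi> y + ereal a) \<le> ennreal (norm y)" by simp
  qed
  moreover have "\<phi> (- x) = \<phi> x" for x unfolding \<phi>_def by (rule conjugate_even) (simp add: f_def)
  ultimately have adm: "admissible \<mu> \<phi>"
    unfolding admissible_def using a \<phi>_le[of 0] conjugate_triple[of f] by (auto simp: \<phi>_def)
  moreover have "\<not> (AE x in lborel. \<phi> x = \<infinity>)"
  proof
    assume "AE x in lborel. \<phi> x = \<infinity>"
    then have "AE x in lborel. x \<notin> ball (0::'a) 1"
    proof eventually_elim
      case (elim x)
      then show ?case using \<phi>_le[of x] by auto
    qed
    then have "ball (0::'a) 1 \<in> null_sets lborel" by (subst AE_iff_null_sets) auto
    then have "negligible (ball (0::'a) 1)" by (simp add: negligible_iff_null_sets null_sets_completion_iff)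
    then show False using open_not_negligible[of "ball (0::'a) 1"] by simp
  qed
  ultimately show ?thesis
    using that gauss_functional_pos_iff[OF admissible_measurable[OF adm] admissible_not_MInf[OF adm]] by blast
qed

text \<open>The sublevel set \<open>{\<phi> \<le> M}\<close> carries a fixed amount of Gaussian mass, and being convex and
  symmetric it lies in a slab through any point outside of it; thin slabs are excluded.\<close>

lemma admissible_uniform_bound:
  assumes "0 < \<delta>"
  obtains M r where "0 \<le> M" "0 < r"
    "\<And>\<phi> x. admissible \<mu> \<phi> \<Longrightarrow> \<delta> \<le> gauss_functional \<phi> \<Longrightarrow> norm x < r \<Longrightarrow> \<phi> x \<le> ereal M"
proof -
  define Z where "Z = (\<integral>x. exp (- (norm x)\<^sup>2 / 2) \<partial>(lborel :: 'a measure))"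
  have Z: "0 \<le> Z" unfolding Z_def by (intro integral_nonneg_AE) auto
  define T where "T = gauss_tail 0"
  have T: "0 < T" by (simp add: T_def gauss_tail_pos)
  \<comment> \<open>The mass \<open>\<delta>\<close> is split in halves: \<open>M\<close> makes the
    region where \<open>\<phi>\<close> exceeds \<open>M\<close> contribute less than
    \<open>\<delta> / 2\<close>, and the width \<open>r\<close> does the same for a slab on which
    the integrand is at most \<open>T\<close> times the Gaussian density.\<close>
  have "((\<lambda>s. gauss_tail s * Z) \<longlongrightarrow> 0 * Z) at_top" by (intro tendsto_intros gauss_tail_tendsto)
  then have "\<forall>\<^sub>F s in at_top. gauss_tail s * Z < \<delta> / 2"
    using assms by (intro order_tendstoD) auto
  with eventually_ge_at_top[of 0] have "\<forall>\<^sub>F s in at_top. 0 \<le> s \<and> gauss_tail s * Z < \<delta> / 2"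
    by eventually_elim simp
  then obtain M where M: "0 \<le> M" "gauss_tail M * Z < \<delta> / 2"
    by (auto simp: eventually_at_top_linorder)
  obtain r where r: "0 < r" "\<And>u::'a. norm u = 1 \<Longrightarrow>
      (\<integral>x. indicator {x. \<bar>x \<bullet> u\<bar> < r} x * exp (- (norm x)\<^sup>2 / 2) \<partial>lborel) < \<delta> / (2 * T)"
    using gaussian_slab_small[of "\<delta> / (2 * T)"] assms T by auto
  have "\<phi> x0 \<le> ereal M" if \<phi>: "admissible \<mu> \<phi>" and big: "\<delta> \<le> gauss_functional \<phi>" and x0: "norm x0 < r" for \<phi> x0
  proof (rule ccontr)
    assume "\<not> \<phi> x0 \<le> ereal M"
    then have "ereal M < conjugate (conjugate \<phi>) x0" using admissible_biconjugate[OF \<phi>] by simp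
    \<comment> \<open>The biconjugate supplies the separating functional: an affine minorant of
      \<open>\<phi>\<close> exceeds \<open>M\<close> at \<open>x0\<close>, so \<open>y\<close> is
      larger at \<open>x0\<close> than anywhere on the sublevel set.\<close>
    then obtain y where y: "ereal M < ereal (x0 \<bullet> y) - conjugate \<phi> y"
      unfolding conjugate_def[of "conjugate \<phi>"] less_SUP_iff by auto
    obtain c where "ereal (- c) \<le> conjugate \<phi> y" using admissible_at_0[OF \<phi>] by metis
    with y obtain s where s: "conjugate \<phi> y = ereal s" by (cases "conjugate \<phi> y") auto
    have less: "x \<bullet> y < x0 \<bullet> y" if "\<phi> x \<le> ereal M" for x
    proof -
      have "ereal (x \<bullet> y) - conjugate \<phi> y \<le> \<phi> x"
        using conjugate_upper[of x y "conjugate \<phi>"] admissible_biconjugate[OF \<phi>] by simp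
      with that y s show ?thesis by (cases "\<phi> x") auto
    qed
    obtain u :: 'a where u: "norm u = 1" "\<And>x. \<phi> x \<le> ereal M \<Longrightarrow> \<bar>x \<bullet> u\<bar> < r"
    proof (cases "y = 0")
      \<comment> \<open>For \<open>y = 0\<close> the strict separation reads \<open>0 < 0\<close>,
        so the sublevel set is empty and any unit vector will do.\<close>
      case True
      then have "\<not> \<phi> x \<le> ereal M" for x using less[of x] by auto
      moreover obtain b :: 'a where "b \<in> Basis" using nonempty_Basis by blast
      ultimately show ?thesis by (intro that[of b]) auto
    next
      case False
      have "\<bar>x \<bullet> y\<bar> < r * norm y" if "\<phi> x \<le> ereal M" for x
      proof -
        have "x0 \<bullet> y \<le> norm x0 * norm y" by (rule norm_cauchy_schwarz)
        also have "\<dots> < r * norm y" using x0 False by simp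
        finally show ?thesis using less[OF that] less[of "- x"] that admissible_even[OF \<phi>, of x] by simp
      qed
      with False show ?thesis
        by (intro that[of "sgn y"]) (auto simp: norm_sgn sgn_div_norm abs_mult field_simps)
    qed
    let ?\<gamma> = "\<lambda>x::'a. exp (- (norm x)\<^sup>2 / 2) :: real"
    let ?S = "indicator {x::'a. \<bar>x \<bullet> u\<bar> < r} :: 'a \<Rightarrow> real"
    have intS: "integrable lborel (\<lambda>x. ?S x * ?\<gamma> x)"
      by (rule Bochner_Integration.integrable_bound[OF integrable_gaussian]) (auto simp: indicator_def)
    have "gauss_functional \<phi> \<le> (\<integral>x. gauss_tail M * ?\<gamma> x + T * (?S x * ?\<gamma> x) \<partial>lborel)"
      unfolding gauss_functional_def
    proof (rule integral_mono)
      show "integrable lborel (\<lambda>x. gauss_tail_ereal (\<phi> x) * ?\<gamma> x)"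
        by (rule gauss_functional_integrable[OF admissible_measurable[OF \<phi>]])
      show "integrable lborel (\<lambda>x. gauss_tail M * ?\<gamma> x + T * (?S x * ?\<gamma> x))"
        by (intro Bochner_Integration.integrable_add integrable_mult_right integrable_gaussian intS)
      fix x
      have "gauss_tail_ereal (\<phi> x) \<le> gauss_tail M + T * ?S x"
      proof (cases "\<phi> x \<le> ereal M")
        case True
        have "gauss_tail_ereal (\<phi> x) \<le> T"
          unfolding T_def by (rule gauss_tail_ereal_le[OF admissible_ge_0[OF \<phi>]])
        then show ?thesis using u(2)[OF True] gauss_tail_pos[of M] by simp
      next
        case False
        then have "gauss_tail_ereal (\<phi> x) \<le> gauss_tail_ereal (ereal M)"
          by (intro gauss_tail_ereal_antimono) auto
        then show ?thesis using T by (simp add: indicator_def)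
      qed
      then have "gauss_tail_ereal (\<phi> x) * ?\<gamma> x \<le> (gauss_tail M + T * ?S x) * ?\<gamma> x"
        by (rule mult_right_mono) simp
      then show "gauss_tail_ereal (\<phi> x) * ?\<gamma> x \<le> gauss_tail M * ?\<gamma> x + T * (?S x * ?\<gamma> x)"
        by (simp add: algebra_simps)
    qed
    also have "\<dots> = gauss_tail M * Z + T * (\<integral>x. ?S x * ?\<gamma> x \<partial>lborel)"
      unfolding Z_def using intS integrable_gaussian[where 'a = 'a]
      by (subst Bochner_Integration.integral_add[OF integrable_mult_right integrable_mult_right]) simp_all
    also have "\<dots> < \<delta> / 2 + T * (\<delta> / (2 * T))"
      using T by (intro add_strict_mono M mult_strict_left_mono r u)
    also have "\<dots> = \<delta>" using T by simp
    finally show False using big by simp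
  qed
  with M r show ?thesis by (intro that)
qed

end

section \<open>Compactness of sequences of convex functions\<close>

lemma diagonal_subsequence_ereal:
  fixes F :: "nat \<Rightarrow> 'a \<Rightarrow> ereal"
  assumes "countable Q"
  obtains d where "strict_mono (d :: nat \<Rightarrow> nat)" "\<And>q. q \<in> Q \<Longrightarrow> convergent (\<lambda>k. F (d k) q)"
proof (cases "Q = {}")
  case True
  then show ?thesis using that[of id] by (auto simp: strict_mono_def)
next
  case False
  define e where "e = from_nat_into Q"
  have e: "q \<in> Q \<Longrightarrow> \<exists>n. e n = q" for q
    unfolding e_def using from_nat_into_surj[OF assms] by blast
  interpret subseqs "\<lambda>n s. convergent (\<lambda>k. F (s k) (e n))"
  proof
    fix n and s :: "nat \<Rightarrow> nat" assume "strict_mono s"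
    \<comment> \<open>Sequential compactness of \<open>ereal\<close> provides the subsequence
      without any bound on the values.\<close>
    obtain l r where "strict_mono r" "((\<lambda>k. F (s k) (e n)) \<circ> r) \<longlonglongrightarrow> l"
      using compact_complete_linorder[of "\<lambda>k. F (s k) (e n)"] by blast
    then show "\<exists>r'. strict_mono r' \<and> convergent (\<lambda>k. F ((s \<circ> r') k) (e n))"
      by (auto simp: convergent_def o_def)
  qed
  have "convergent (\<lambda>k. F ((diagseq \<circ> (+) (Suc n)) k) (e n))" for n
  proof (rule diagseq_holds)
    fix r s :: "nat \<Rightarrow> nat" and n
    assume "strict_mono r" "convergent (\<lambda>k. F (s k) (e n))"
    from convergent_subseq_convergent[OF this(2,1)]
    show "convergent (\<lambda>k. F ((s \<circ> r) k) (e n))" by (simp add: o_def)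
  qed
  \<comment> \<open>The diagonal sequence refines the \<open>n\<close>-th extracted sequence only
    from index \<open>Suc n\<close> on; the initial segment does not affect convergence.\<close>
  then have "convergent (\<lambda>k. F (diagseq (k + Suc n)) (e n))" for n by (simp only: o_def add.commute[of _ "Suc n"])
  then have "convergent (\<lambda>k. F (diagseq k) (e n))" for n
    using convergent_ignore_initial_segment[of "\<lambda>k. F (diagseq k) (e n)" "Suc n"] by simp
  then show ?thesis using subseq_diagseq e by (intro that[of diagseq]) auto
qed

text \<open>The point \<open>w\<close> is a convex combination of \<open>v\<close> and a point
  \<open>z\<close> of the ball where \<open>\<phi> \<le> M\<close>. Allowing \<open>w\<close> to lie
  off the ray through \<open>v\<close> leaves an open set of choices, in which a point of a dense
  set can be found.\<close>

lemma convex_ereal_shrink: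
  fixes \<phi> :: "'a::real_normed_vector \<Rightarrow> ereal"
  assumes cv: "convex_ereal \<phi>" and nn: "\<And>x. 0 \<le> \<phi> x"
    and M: "\<And>x. norm x < r \<Longrightarrow> \<phi> x \<le> ereal M"
    and s: "0 \<le> s" "s < 1" and w: "norm (w - s *\<^sub>R v) < (1 - s) * r"
  shows "\<phi> w \<le> \<phi> v + ereal ((1 - s) * M)"
proof -
  define z where "z = (1 / (1 - s)) *\<^sub>R (w - s *\<^sub>R v)"
  have "norm z = norm (w - s *\<^sub>R v) / (1 - s)" using s by (simp add: z_def)
  also have "\<dots> < r" using s w by (simp add: pos_divide_less_eq mult.commute)
  finally have "norm z < r" .
  then have z: "\<phi> z \<le> ereal M" by (rule M)
  have "w = (1 - s) *\<^sub>R z + s *\<^sub>R v" using s by (simp add: z_def)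
  then have "\<phi> w \<le> ereal (1 - s) * \<phi> z + ereal s * \<phi> v"
    using convex_erealD[OF cv, of s z v] s by simp
  also have "\<dots> \<le> ereal (1 - s) * ereal M + ereal 1 * \<phi> v"
    using s z nn by (intro add_mono ereal_mult_left_mono ereal_mult_right_mono) auto
  finally show ?thesis by (simp add: add.commute)
qed

text \<open>A point \<open>q\<close> of the dense set near \<open>s *\<^sub>R x\<close> is inserted
  between \<open>x\<close> and \<open>(s * s) *\<^sub>R x\<close>. At \<open>q\<close> the upper and
  lower limits agree, and each of the two shrinkings costs \<open>(1 - s) * M\<close>.\<close>

lemma limsup_shrink_le_liminf:
  fixes F :: "nat \<Rightarrow> 'a::real_normed_vector \<Rightarrow> ereal"
  assumes cv: "\<And>k. convex_ereal (F k)" and nn: "\<And>k x. 0 \<le> F k x"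
    and M: "0 < r" "\<And>k x. norm x < r \<Longrightarrow> F k x \<le> ereal M"
    and Q: "\<And>X. open X \<Longrightarrow> X \<noteq> {} \<Longrightarrow> \<exists>q\<in>Q. q \<in> X" "\<And>q. q \<in> Q \<Longrightarrow> convergent (\<lambda>k. F k q)"
    and s: "0 \<le> s" "s < 1"
  shows "limsup (\<lambda>k. F k ((s * s) *\<^sub>R x)) \<le> liminf (\<lambda>k. F k x) + ereal (2 * ((1 - s) * M))"
proof -
  obtain q where q: "q \<in> Q" "q \<in> ball (s *\<^sub>R x) ((1 - s) * r)"
    using Q(1)[of "ball (s *\<^sub>R x) ((1 - s) * r)"] mult_pos_pos[of "1 - s" r] M(1) s
    unfolding ball_eq_empty not_le by auto
  obtain l where l: "(\<lambda>k. F k q) \<longlonglongrightarrow> l" using Q(2)[OF q(1)] by (auto simp: convergent_def)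
  have 1: "F k q \<le> F k x + ereal ((1 - s) * M)" for k
    using q(2) by (intro convex_ereal_shrink[OF cv nn M(2) s]) (auto simp: dist_norm norm_minus_commute)
  have 2: "F k ((s * s) *\<^sub>R x) \<le> F k q + ereal ((1 - s) * M)" for k
  proof (rule convex_ereal_shrink[OF cv nn M(2) s])
    have "(s * s) *\<^sub>R x - s *\<^sub>R q = s *\<^sub>R (s *\<^sub>R x - q)" by (simp add: scaleR_diff_right)
    then have "norm ((s * s) *\<^sub>R x - s *\<^sub>R q) = s * norm (s *\<^sub>R x - q)" using s by simp
    also have "\<dots> \<le> 1 * norm (s *\<^sub>R x - q)" using s by (intro mult_right_mono) auto
    also have "\<dots> < (1 - s) * r" using q(2) by (simp add: dist_norm)
    finally show "norm ((s * s) *\<^sub>R x - s *\<^sub>R q) < (1 - s) * r" .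
  qed
  have "limsup (\<lambda>k. F k ((s * s) *\<^sub>R x)) \<le> limsup (\<lambda>k. F k q + ereal ((1 - s) * M))"
    by (intro Limsup_mono always_eventually allI 2)
  also have "\<dots> = l + ereal ((1 - s) * M)"
    using lim_imp_Limsup[OF _ l] by (simp add: Limsup_add_ereal_right)
  also have "l \<le> liminf (\<lambda>k. F k x) + ereal ((1 - s) * M)"
  proof -
    have "l = liminf (\<lambda>k. F k q)" using lim_imp_Liminf[OF _ l] by simp
    also have "\<dots> \<le> liminf (\<lambda>k. F k x + ereal ((1 - s) * M))"
      by (intro Liminf_mono always_eventually allI 1)
    finally show ?thesis by (simp add: Liminf_add_ereal_right)
  qed
  finally have "limsup (\<lambda>k. F k ((s * s) *\<^sub>R x))
      \<le> liminf (\<lambda>k. F k x) + ereal ((1 - s) * M) + ereal ((1 - s) * M)"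
    by (simp add: add_right_mono)
  then show ?thesis by (simp add: add.assoc mult.commute)
qed

text \<open>The sequence \<open>F k x\<close> itself may diverge, so dominated convergence is
  applied only to the positive part \<open>D k\<close> of the excess of its tail over that of
  \<open>\<phi>\<close>, which does tend to 0.\<close>

lemma gauss_functional_le_of_liminf:
  fixes F :: "nat \<Rightarrow> 'a::euclidean_space \<Rightarrow> ereal"
  assumes [measurable]: "\<And>k. F k \<in> borel_measurable borel" "\<phi> \<in> borel_measurable borel"
    and \<phi>: "\<And>x. \<phi> x \<noteq> -\<infinity>" "\<And>x. \<phi> x \<le> liminf (\<lambda>k. F k x)"
    and s: "(\<lambda>k. gauss_functional (F k)) \<longlonglongrightarrow> s"
  shows "s \<le> gauss_functional \<phi>"
proof -
  let ?\<gamma> = "\<lambda>x::'a. exp (- (norm x)\<^sup>2 / 2) :: real"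
  define D where "D k x = max 0 (gauss_tail_ereal (F k x) - gauss_tail_ereal (\<phi> x))" for k x
  have [measurable]: "D k \<in> borel_measurable borel" for k unfolding D_def by measurable
  define K where "K = (\<integral>t. exp (- t\<^sup>2 / 2 :: real) \<partial>lborel)"
  have D_le: "\<bar>D k x\<bar> \<le> K" for k x
    using gauss_tail_ereal_nonneg[of "\<phi> x"] gauss_tail_ereal_bounded[of "F k x"] gauss_tail_ereal_nonneg[of "F k x"]
    unfolding D_def K_def by (auto simp: max_def)
  have intK: "integrable lborel (\<lambda>x::'a. K * ?\<gamma> x)" by (intro integrable_mult_right integrable_gaussian)
  have "(\<lambda>k. \<integral>x. D k x * ?\<gamma> x \<partial>lborel) \<longlonglongrightarrow> integral\<^sup>L lborel (\<lambda>x::'a. 0 :: real)"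
  proof (rule integral_dominated_convergence[OF _ _ intK])
    show "AE x in lborel. norm (D k x * ?\<gamma> x) \<le> K * ?\<gamma> x" for k
      unfolding real_norm_def abs_mult abs_exp_cancel by (intro AE_I2 mult_right_mono D_le) simp
    show "AE x in lborel. (\<lambda>k. D k x * ?\<gamma> x) \<longlonglongrightarrow> 0"
    proof (rule AE_I2)
      fix x
      have "(\<lambda>k. D k x) \<longlonglongrightarrow> 0"
      proof (rule LIMSEQ_I)
        fix \<epsilon> :: real assume \<epsilon>: "0 < \<epsilon>"
        obtain c where c: "ereal c < \<phi> x" "gauss_tail c \<le> gauss_tail_ereal (\<phi> x) + \<epsilon> / 2"
          using gauss_tail_ereal_approx[OF \<phi>(1), of "\<epsilon> / 2" x] \<epsilon> by auto
        have "ereal c < liminf (\<lambda>k. F k x)" using c(1) \<phi>(2)[of x] by simp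
        then have "\<forall>\<^sub>F k in sequentially. ereal c < F k x" by (rule less_LiminfD)
        then have "\<forall>\<^sub>F k in sequentially. norm (D k x - 0) < \<epsilon>"
        proof eventually_elim
          case (elim k)
          then have "gauss_tail_ereal (F k x) \<le> gauss_tail c"
            using gauss_tail_ereal_antimono[of "ereal c" "F k x"] by simp
          with c(2) \<epsilon> show ?case by (simp add: D_def)
        qed
        then show "\<exists>N. \<forall>k\<ge>N. norm (D k x - 0) < \<epsilon>" by (simp add: eventually_sequentially)
      qed
      then show "(\<lambda>k. D k x * ?\<gamma> x) \<longlonglongrightarrow> 0" by (rule tendsto_mult_left_zero)
    qed
  qed measurable
  then have "(\<lambda>k. gauss_functional \<phi> + (\<integral>x. D k x * ?\<gamma> x \<partial>lborel)) \<longlonglongrightarrow> gauss_functional \<phi> + 0"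
    by (intro tendsto_add tendsto_const) simp
  moreover have "gauss_functional (F k) \<le> gauss_functional \<phi> + (\<integral>x. D k x * ?\<gamma> x \<partial>lborel)" for k
  proof -
    have iD: "integrable lborel (\<lambda>x. D k x * ?\<gamma> x)"
      by (rule Bochner_Integration.integrable_bound[OF intK])
         (auto simp: abs_mult intro!: AE_I2 mult_right_mono order_trans[OF D_le abs_ge_self])
    have "gauss_functional (F k) \<le> (\<integral>x. gauss_tail_ereal (\<phi> x) * ?\<gamma> x + D k x * ?\<gamma> x \<partial>lborel)"
      unfolding gauss_functional_def
    proof (rule integral_mono)
      show "integrable lborel (\<lambda>x. gauss_tail_ereal (F k x) * ?\<gamma> x)"
        by (rule gauss_functional_integrable) simp
      show "integrable lborel (\<lambda>x. gauss_tail_ereal (\<phi> x) * ?\<gamma> x + D k x * ?\<gamma> x)"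
        by (intro Bochner_Integration.integrable_add iD gauss_functional_integrable) simp
      show "gauss_tail_ereal (F k x) * ?\<gamma> x \<le> gauss_tail_ereal (\<phi> x) * ?\<gamma> x + D k x * ?\<gamma> x" for x
        unfolding distrib_right[symmetric] by (intro mult_right_mono) (auto simp: D_def)
    qed
    also have "\<dots> = gauss_functional \<phi> + (\<integral>x. D k x * ?\<gamma> x \<partial>lborel)"
      unfolding gauss_functional_def
      by (rule Bochner_Integration.integral_add[OF gauss_functional_integrable iD]) simp
    finally show ?thesis .
  qed
  ultimately show ?thesis using s by (intro LIMSEQ_le[OF s]) auto
qed

context spanning_even_measure
begin

text \<open>The limit is the closed convex hull of the upper limit \<open>S\<close>, whose conjugate is controlled by Fatou's
  lemma. Shrinking towards the origin compares \<open>S\<close> with the lower limit, and lower semicontinuity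
  of the hull removes the shrinking factor again.\<close>

lemma admissible_limit:
  fixes F :: "nat \<Rightarrow> 'a \<Rightarrow> ereal"
  assumes adm: "\<And>k. admissible \<mu> (F k)"
    and M: "0 \<le> M" "0 < r" "\<And>k x. norm x < r \<Longrightarrow> F k x \<le> ereal M"
    and Q: "\<And>X. open X \<Longrightarrow> X \<noteq> {} \<Longrightarrow> \<exists>q\<in>Q. q \<in> X" "\<And>q. q \<in> Q \<Longrightarrow> convergent (\<lambda>k. F k q)"
  obtains \<phi> where "admissible \<mu> \<phi>" "\<And>x. \<phi> x \<le> liminf (\<lambda>k. F k x)"
proof
  define S where "S x = limsup (\<lambda>k. F k x)" for x
  define \<phi> where "\<phi> = conjugate (conjugate S)"
  have nn: "0 \<le> F k x" for k x by (rule admissible_ge_0[OF adm])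
  have cv: "convex_ereal (F k)" for k using admissible_Conv[OF adm] by (simp add: Conv_def)
  have \<phi>S: "\<phi> x \<le> S x" for x unfolding \<phi>_def by (rule conjugate_conjugate_le)
  have "S 0 \<le> ereal M" unfolding S_def using M by (intro Limsup_bounded always_eventually) auto
  then have \<phi>0: "\<phi> 0 \<le> ereal M" using \<phi>S[of 0] by simp
  have low: "ereal (- M) \<le> conjugate S y" for y
    using conjugate_upper[of y 0 S] \<open>S 0 \<le> ereal M\<close> by (cases "S 0"; cases "conjugate S y") auto
  have "(\<integral>\<^sup>+ y. e2ennreal (conjugate S y + ereal M) \<partial>\<mu>)
      \<le> (\<integral>\<^sup>+ y. liminf (\<lambda>k. e2ennreal (conjugate (F k) y + ereal M)) \<partial>\<mu>)"
  proof (rule nn_integral_mono, subst le_Liminf_iff, intro allI impI)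
    \<comment> \<open>A point \<open>x\<close> that nearly attains \<open>conjugate S y\<close> has
      \<open>F k x\<close> below the same threshold for all large \<open>k\<close>, so it competes
      in \<open>conjugate (F k) y\<close> as well.\<close>
    fix y c assume c: "c < e2ennreal (conjugate S y + ereal M)"
    obtain c' where c': "c = ennreal c'" "0 \<le> c'" using c by (cases c) auto
    have "ereal c' < conjugate S y + ereal M"
      using c c' e2ennreal_mono[of "conjugate S y + ereal M" "ereal c'"] by (auto simp: not_le[symmetric])
    then have "ereal (c' - M) < conjugate S y" by (cases "conjugate S y") auto
    then obtain x where "ereal (c' - M) < ereal (y \<bullet> x) - S x"
      unfolding conjugate_def less_SUP_iff by auto
    then have "S x < ereal (y \<bullet> x - (c' - M))" by (cases "S x") auto
    then have "\<forall>\<^sub>F k in sequentially. F k x < ereal (y \<bullet> x - (c' - M))"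
      unfolding S_def by (rule Limsup_lessD)
    then show "\<forall>\<^sub>F k in sequentially. c < e2ennreal (conjugate (F k) y + ereal M)"
    proof eventually_elim
      case (elim k)
      obtain f where f: "F k x = ereal f" using elim nn[of k x] by (cases "F k x") auto
      have "ereal (c' - M) < conjugate (F k) y"
        using conjugate_upper[of y x "F k"] elim f by (cases "conjugate (F k) y") auto
      then show ?case using c'
        by (cases "conjugate (F k) y") (auto simp: ennreal_less_iff)
    qed
  qed
  also have "\<dots> \<le> liminf (\<lambda>k. \<integral>\<^sup>+ y. e2ennreal (conjugate (F k) y + ereal M) \<partial>\<mu>)"
    by (rule nn_integral_liminf) measurable
  also have "\<dots> \<le> liminf (\<lambda>k. ennreal M)"
    using M by (intro Liminf_mono always_eventually allI admissible_integral_le[OF adm]) auto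
  finally have int: "(\<integral>\<^sup>+ y. e2ennreal (conjugate S y + ereal M) \<partial>\<mu>) \<le> ennreal M"
    by (simp add: Liminf_const)
  have "S (- x) = S x" for x unfolding S_def using admissible_even[OF adm] by simp
  then have "\<phi> (- x) = \<phi> x" for x unfolding \<phi>_def by (intro conjugate_even)
  then show "admissible \<mu> \<phi>"
    unfolding admissible_def using M(1) \<phi>0 int by (auto simp: \<phi>_def conjugate_triple)
  fix x
  show "\<phi> x \<le> liminf (\<lambda>k. F k x)"
    unfolding \<phi>_def
  proof (rule conjugate_le)
    fix y
    show "ereal (x \<bullet> y) - conjugate S y \<le> liminf (\<lambda>k. F k x)"
    proof (cases "liminf (\<lambda>k. F k x)")
      case (real l)
      show ?thesis
      proof (cases "conjugate S y")
        case (real b)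
        \<comment> \<open>A single affine minorant of the hull is tested at the shrunken point; both
          sides are continuous in \<open>s\<close>, so \<open>s\<close> can tend to 1 from the
          left.\<close>
        have "s * s * (x \<bullet> y) - b \<le> l + 2 * ((1 - s) * M)" if s: "0 < s" "s < 1" for s
        proof -
          have "ereal (((s * s) *\<^sub>R x) \<bullet> y) - conjugate S y \<le> S ((s * s) *\<^sub>R x)"
            using conjugate_upper[of "(s * s) *\<^sub>R x" y "conjugate S"] \<phi>S[of "(s * s) *\<^sub>R x"]
            unfolding \<phi>_def by (rule order_trans)
          also have "\<dots> \<le> liminf (\<lambda>k. F k x) + ereal (2 * ((1 - s) * M))"
            unfolding S_def using s by (intro limsup_shrink_le_liminf[OF cv nn M(2,3) Q]) auto
          finally show ?thesis using \<open>liminf (\<lambda>k. F k x) = ereal l\<close> real by simp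
        qed
        then have "\<forall>\<^sub>F s in at_left 1. s * s * (x \<bullet> y) - b \<le> l + 2 * ((1 - s) * M)"
          using eventually_at_left_real[of 0 "1::real"] by (auto elim!: eventually_mono)
        moreover have "((\<lambda>s. s * s * (x \<bullet> y) - b) \<longlongrightarrow> 1 * 1 * (x \<bullet> y) - b) (at_left 1)"
          "((\<lambda>s. l + 2 * ((1 - s) * M)) \<longlongrightarrow> l + 2 * ((1 - 1) * M)) (at_left (1::real))"
          by (intro tendsto_intros)+
        ultimately have "1 * 1 * (x \<bullet> y) - b \<le> l + 2 * ((1 - 1) * M)"
          by (intro tendsto_le[of "at_left (1::real)"]) auto
        then show ?thesis using \<open>liminf (\<lambda>k. F k x) = ereal l\<close> real by simp
      qed (use low[of y] in auto)
    next
      case MInf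
      have "0 \<le> liminf (\<lambda>k. F k x)" by (intro Liminf_bounded always_eventually allI nn)
      with MInf show ?thesis by simp
    qed simp
  qed
qed

theorem gauss_functional_maximizer:
  obtains \<phi> where "admissible \<mu> \<phi>" "0 < gauss_functional \<phi>"
    "\<And>\<psi>. admissible \<mu> \<psi> \<Longrightarrow> gauss_functional \<psi> \<le> gauss_functional \<phi>"
proof -
  define s where "s = (SUP \<phi>\<in>Collect (admissible \<mu>). gauss_functional \<phi>)"
  obtain \<phi>0 where \<phi>0: "admissible \<mu> \<phi>0" "0 < gauss_functional \<phi>0" using admissible_exists by blast
  define K where "K = (\<integral>t. exp (- t\<^sup>2 / 2 :: real) \<partial>lborel)"
  have "gauss_functional \<phi> \<le> (\<integral>x. K * exp (- (norm x)\<^sup>2 / 2) \<partial>(lborel :: 'a measure))" if "admissible \<mu> \<phi>" for \<phi>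
    unfolding gauss_functional_def K_def
    by (intro integral_mono gauss_functional_integrable admissible_measurable[OF that] integrable_mult_right
        integrable_gaussian mult_right_mono gauss_tail_ereal_bounded) simp
  then have bdd: "bdd_above (gauss_functional ` Collect (admissible \<mu>))" by (auto intro!: bdd_aboveI2)
  have le_s: "gauss_functional \<phi> \<le> s" if "admissible \<mu> \<phi>" for \<phi>
    unfolding s_def using that by (intro cSUP_upper bdd) auto
  have s: "0 < s" using le_s[OF \<phi>0(1)] \<phi>0(2) by simp
  \<comment> \<open>The denominator starts at 2, so every member of the sequence has value at least
    \<open>s / 2\<close> and one uniform bound serves them all.\<close>
  have "\<exists>\<phi>. admissible \<mu> \<phi> \<and> s - s / real (Suc (Suc k)) < gauss_functional \<phi>" for k
    using less_cSUP_iff[OF _ bdd, of "s - s / real (Suc (Suc k))"] \<phi>0(1) s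
    by (auto simp: s_def[symmetric] simp del: of_nat_Suc)
  then obtain G where G: "\<And>k. admissible \<mu> (G k)" "\<And>k. s - s / real (Suc (Suc k)) < gauss_functional (G k)"
    by metis
  have half: "s / 2 \<le> gauss_functional (G k)" for k
  proof -
    have "s / real (Suc (Suc k)) \<le> s / 2" using s by (intro divide_left_mono) auto
    with G(2)[of k] show ?thesis by simp
  qed
  obtain M r where M: "0 \<le> M" "0 < r"
    "\<And>\<phi> x. admissible \<mu> \<phi> \<Longrightarrow> s / 2 \<le> gauss_functional \<phi> \<Longrightarrow> norm x < r \<Longrightarrow> \<phi> x \<le> ereal M"
    using admissible_uniform_bound[of "s / 2"] s by auto
  obtain Q :: "'a set" where Q: "countable Q" "\<And>X. open X \<Longrightarrow> X \<noteq> {} \<Longrightarrow> \<exists>q\<in>Q. q \<in> X"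
    by (rule countable_dense_setE) blast
  obtain d where d: "strict_mono d" "\<And>q. q \<in> Q \<Longrightarrow> convergent (\<lambda>k. G (d k) q)"
    using diagonal_subsequence_ereal[OF Q(1)] by blast
  obtain \<phi> where \<phi>: "admissible \<mu> \<phi>" "\<And>x. \<phi> x \<le> liminf (\<lambda>k. G (d k) x)"
    using admissible_limit[of "\<lambda>k. G (d k)", OF G(1) M(1,2) M(3)[OF G(1) half] Q(2) d(2)] by blast
  have "(\<lambda>k. s - s / real (Suc (Suc k))) \<longlonglongrightarrow> s - 0"
    by (rule tendsto_diff[OF tendsto_const LIMSEQ_Suc[OF LIMSEQ_Suc[OF lim_const_over_n]]])
  then have *: "(\<lambda>k. s - s / real (Suc (Suc k))) \<longlonglongrightarrow> s" by simp
  have "(\<lambda>k. gauss_functional (G k)) \<longlonglongrightarrow> s"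
    by (rule tendsto_sandwich[OF always_eventually always_eventually * tendsto_const[of s]])
       (use less_imp_le[OF G(2)] le_s[OF G(1)] in blast)+
  then have "(\<lambda>k. gauss_functional (G (d k))) \<longlonglongrightarrow> s"
    using LIMSEQ_subseq_LIMSEQ[OF _ d(1)] by (auto simp: o_def)
  then have "s \<le> gauss_functional \<phi>"
    using admissible_not_MInf[OF \<phi>(1)] \<phi>(2) admissible_measurable[OF G(1)] admissible_measurable[OF \<phi>(1)]
    by (intro gauss_functional_le_of_liminf[of "\<lambda>k. G (d k)"])
  with \<phi>(1) s le_s show ?thesis by (intro that[of \<phi>]) (auto intro: order_trans)
qed

end

section \<open>Coercivity, symmetry and admissible perturbations\<close>

text \<open>The sum defines a norm, since a vector orthogonal to a spanning set is 0. The constant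
  is its minimum on the unit sphere, attained by compactness.\<close>

lemma spanning_set_inner_sum_bound:
  fixes B :: "'a::euclidean_space set"
  assumes B: "finite B" "span B = UNIV"
  obtains c where "0 < c" "\<And>x. c * norm x \<le> (\<Sum>b\<in>B. \<bar>x \<bullet> b\<bar>)"
proof -
  define N where "N x = (\<Sum>b\<in>B. \<bar>x \<bullet> b\<bar>)" for x :: 'a
  have "continuous_on (sphere 0 1) N" unfolding N_def by (intro continuous_intros)
  moreover have "sphere (0::'a) 1 \<noteq> {}" by simp
  ultimately obtain v where v: "v \<in> sphere 0 1" "\<And>x. x \<in> sphere 0 1 \<Longrightarrow> N v \<le> N x"
    using continuous_attains_inf[of "sphere 0 1" N] by (auto simp: compact_sphere)
  have "N v \<noteq> 0"
  proof
    assume "N v = 0"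
    then have "\<forall>b\<in>B. orthogonal v b"
      using B(1) by (simp add: N_def sum_nonneg_eq_0_iff orthogonal_def)
    then have "orthogonal v v" using B(2) by (intro orthogonal_to_span[of v B]) auto
    then show False using v(1) by (auto simp: orthogonal_def)
  qed
  moreover have "0 \<le> N v" by (simp add: N_def sum_nonneg)
  ultimately have "0 < N v" by simp
  moreover have "N v * norm x \<le> N x" for x
  proof (cases "x = 0")
    case False
    have "N (sgn x) = N x / norm x"
      by (simp add: N_def sgn_div_norm abs_mult divide_inverse mult.commute flip: sum_distrib_left)
    moreover have "N v \<le> N (sgn x)" using False by (intro v(2)) (simp add: norm_sgn)
    ultimately have "N v \<le> N x / norm x" by simp
    then show ?thesis using False by (simp add: pos_le_divide_eq)
  qed (simp add: N_def)
  ultimately show ?thesis by (intro that[of "N v"]) (auto simp: N_def)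
qed

lemma lborel_distr_uminus_euclidean: "distr lborel borel uminus = (lborel :: 'a::euclidean_space measure)"
  by (subst lborel_affine[of "-1" 0]) (auto simp: density_1 distr_distr o_def one_ennreal_def[symmetric])

lemma has_grad_reflect:
  assumes even: "\<And>x. \<phi> (- x) = \<phi> x" and g: "has_grad \<phi> x g"
  shows "has_grad \<phi> (- x) (- g)"
proof -
  have "(\<lambda>x. - x) ` effdom \<phi> = effdom \<phi>"
    using even by (force simp: effdom_def image_iff intro: exI[of _ "- _"])
  then have "- x \<in> interior (effdom \<phi>)"
    using g interior_negations[of "effdom \<phi>"] by (auto simp: has_grad_def)
  moreover have "((\<lambda>y. real_of_ereal (\<phi> (- y))) has_derivative (\<lambda>h. (- h) \<bullet> g)) (at (- x))"
    using g by (intro has_derivative_compose[of uminus uminus "- x" UNIV "\<lambda>y. real_of_ereal (\<phi> y)" "\<lambda>h. h \<bullet> g"])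
      (auto simp: has_grad_def gderiv_def intro!: derivative_eq_intros)
  ultimately show ?thesis using even by (simp add: has_grad_def gderiv_def)
qed

lemma grad_reflect:
  assumes "\<And>x. \<phi> (- x) = \<phi> x"
  shows "- x \<in> grad_dom \<phi> \<longleftrightarrow> x \<in> grad_dom \<phi>" and "grad \<phi> (- x) = - grad \<phi> x"
proof -
  show *: "- x \<in> grad_dom \<phi> \<longleftrightarrow> x \<in> grad_dom \<phi>" for x
    using has_grad_reflect[of \<phi>, OF assms] by (fastforce simp: grad_dom_def)
  show "grad \<phi> (- x) = - grad \<phi> x"
  proof (cases "x \<in> grad_dom \<phi>")
    case True
    then obtain g where "has_grad \<phi> x g" by (auto simp: grad_dom_def)
    then show ?thesis using has_grad_reflect[of \<phi>, OF assms] by (simp add: grad_eq)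
  next
    \<comment> \<open>The dummy gradient 0 is its own negative, so oddness survives where no
      gradient exists.\<close>
    case False
    with * show ?thesis by (simp add: grad_def)
  qed
qed

text \<open>Closed sets generate the Borel sets, and their indicators are limits of continuous functions.\<close>

lemma borel_measure_eqI_bounded_continuous:
  fixes M N :: "'a::euclidean_space measure"
  assumes M: "finite_measure M" "sets M = sets borel" and N: "finite_measure N" "sets N = sets borel"
    and eq: "\<And>g :: 'a \<Rightarrow> real. continuous_on UNIV g \<Longrightarrow> (\<And>x. 0 \<le> g x) \<Longrightarrow> (\<And>x. g x \<le> 1) \<Longrightarrow>
      integral\<^sup>L M g = integral\<^sup>L N g"
  shows "M = N"
proof (rule measure_eqI_generator_eq)
  interpret M: finite_measure M by fact
  interpret N: finite_measure N by fact
  show "Int_stable {A :: 'a set. closed A}" by (auto simp: Int_stable_def)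
  show "emeasure M A = emeasure N A" if "A \<in> {A. closed A}" for A
  proof (cases "A = {}")
    \<comment> \<open>The empty set is split off because \<open>infdist x {} = 0\<close> would make
      every \<open>g k\<close> equal to 1.\<close>
    case False
    have A: "closed A" using that by simp
    define g where "g k x = max 0 (1 - real k * infdist x A)" for k x
    have lim: "(\<lambda>k. integral\<^sup>L L (g k)) \<longlonglongrightarrow> measure L A"
      if L: "finite_measure L" "sets L = sets borel" for L
    proof -
      interpret L: finite_measure L by fact
      note [measurable_cong] = L(2)
      have "(\<lambda>k. integral\<^sup>L L (g k)) \<longlonglongrightarrow> (\<integral>x. indicator A x \<partial>L)"
      proof (rule integral_dominated_convergence)
        show "indicator A \<in> borel_measurable L" using A L(2) by (intro borel_measurable_indicator) auto
        show "g k \<in> borel_measurable L" for k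
          unfolding g_def using L(2)
          by (subst measurable_cong_sets[OF L(2) refl]) (intro borel_measurable_continuous_onI continuous_intros)
        show "integrable L (\<lambda>x. 1 :: real)" by simp
        show "AE x in L. norm (g k x) \<le> 1" for k by (auto simp: g_def max_def infdist_nonneg)
        show "AE x in L. (\<lambda>k. g k x) \<longlonglongrightarrow> indicator A x"
        proof (rule AE_I2)
          fix x
          show "(\<lambda>k. g k x) \<longlonglongrightarrow> indicator A x"
          proof (cases "x \<in> A")
            case True
            then show ?thesis using A False by (simp add: g_def in_closed_iff_infdist_zero)
          next
            case x: False
            then have "infdist x A > 0" using A False infdist_nonneg[of x A] by (auto simp: in_closed_iff_infdist_zero less_le)
            then obtain K where K: "1 < real K * infdist x A" using reals_Archimedean3 by blast
            have "\<forall>\<^sub>F k in sequentially. g k x = 0"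
              using eventually_ge_at_top[of K]
            proof eventually_elim
              case (elim k)
              then have "real K * infdist x A \<le> real k * infdist x A" by (intro mult_right_mono infdist_nonneg) auto
              with K show ?case by (simp add: g_def)
            qed
            then show ?thesis using x by (simp add: tendsto_eventually)
          qed
        qed
      qed
      moreover have "(\<integral>x. indicator A x \<partial>L) = measure L A"
        using A L(2) sets_eq_imp_space_eq[OF L(2)] by simp
      ultimately show ?thesis by simp
    qed
    have "integral\<^sup>L M (g k) = integral\<^sup>L N (g k)" for k
      unfolding g_def by (rule eq) (auto intro!: continuous_intros simp: infdist_nonneg)
    then have "measure M A = measure N A"
      using LIMSEQ_unique[OF lim[OF M] ] lim[OF N] by simp
    then show ?thesis by (simp add: M.emeasure_eq_measure N.emeasure_eq_measure)
  qed simp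
  show "sets M = sigma_sets UNIV {A. closed A}" "sets N = sigma_sets UNIV {A. closed A}"
    unfolding M(2) N(2) borel_eq_closed by (simp_all add: sets_measure_of)
  show "range (\<lambda>_::nat. UNIV :: 'a set) \<subseteq> {A. closed A}" "(\<Union>i::nat. UNIV) = (UNIV :: 'a set)" by auto
  show "emeasure M UNIV \<noteq> \<infinity>" for i :: nat by simp
qed auto

context spanning_even_measure
begin

text \<open>Every \<open>b\<close> with finite \<open>conjugate \<phi> b\<close> yields an affine
  minorant of \<open>\<phi>\<close>, and evenness improves it to
  \<open>\<bar>x \<bullet> b\<bar> - s b\<close>. Such points form a set of full measure, which
  therefore spans; summing the minorants over a basis drawn from it gives linear growth.\<close>

lemma admissible_Lclass:
  assumes \<phi>: "admissible \<mu> \<phi>"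
  shows "\<phi> \<in> Lclass"
proof -
  obtain m where m: "m \<ge> 0" "(\<integral>\<^sup>+ y. e2ennreal (conjugate \<phi> y + ereal m) \<partial>\<mu>) \<le> ennreal m"
    using \<phi> by (auto simp: admissible_def)
  define D where "D = {y. conjugate \<phi> y \<noteq> \<infinity>}"
  have "AE y in \<mu>. e2ennreal (conjugate \<phi> y + ereal m) \<noteq> \<infinity>"
    using m by (intro nn_integral_PInf_AE) (auto simp: top_unique)
  then have D: "AE y in \<mu>. y \<in> D" by eventually_elim (auto simp: D_def)
  have "emeasure \<mu> (- span D) = 0"
  proof -
    have "- span D \<in> sets \<mu>" using closed_subspace[OF subspace_span, of D] by simp
    moreover have "AE y in \<mu>. y \<notin> - span D" using D by eventually_elim (simp add: span_base)
    ultimately have "- span D \<in> null_sets \<mu>" by (rule iffD2[OF AE_iff_null_sets])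
    then show ?thesis by (rule null_setsD1)
  qed
  then have "dim (span D) = DIM('a)"
    using spanning[OF subspace_span, of D] dim_subset_UNIV[of "span D"] by linarith
  then have spanD: "span D = UNIV" by (simp add: dim_eq_full)
  obtain B where B: "B \<subseteq> D" "independent B" "D \<subseteq> span B" by (rule maximal_independent_subset)
  have finB: "finite B" using B(2) by (rule independent_imp_finite)
  have spanB: "span B = UNIV" using spanD span_minimal[OF B(3) subspace_span] by (simp add: top.extremum_unique)
  obtain c where c: "0 < c" "\<And>x. c * norm x \<le> (\<Sum>b\<in>B. \<bar>x \<bullet> b\<bar>)"
    using spanning_set_inner_sum_bound[OF finB spanB] by blast
  obtain c0 where "\<And>y. ereal (- c0) \<le> conjugate \<phi> y" using admissible_at_0[OF \<phi>] by metis
  then have "\<exists>r. conjugate \<phi> b = ereal r" if "b \<in> B" for b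
    using B(1) that by (cases "conjugate \<phi> b") (auto simp: D_def subset_iff, metis MInfty_neq_ereal(2) ereal_infty_less_eq(2))
  then obtain s where s: "\<And>b. b \<in> B \<Longrightarrow> conjugate \<phi> b = ereal (s b)" by metis
  define n where "n = real (card B)"
  have n: "0 < n"
  proof -
    have "B \<noteq> {}"
    proof
      assume "B = {}"
      then have "(UNIV :: 'a set) = {0}" using spanB by simp
      moreover obtain b :: 'a where "b \<in> Basis" using nonempty_Basis by blast
      ultimately show False by (metis UNIV_I nonzero_Basis singletonD)
    qed
    then show ?thesis using finB by (simp add: n_def card_gt_0_iff)
  qed
  have low: "c * norm x - sum s B \<le> n * p" if p: "\<phi> x = ereal p" for x p
  proof -
    have "\<bar>x \<bullet> b\<bar> - s b \<le> p" if b: "b \<in> B" for b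
    proof -
      have "ereal (z \<bullet> b) - conjugate \<phi> b \<le> \<phi> z" for z
        using conjugate_upper[of z b "conjugate \<phi>"] admissible_biconjugate[OF \<phi>] by simp
      from this[of x] this[of "- x"] show ?thesis using s[OF b] p admissible_even[OF \<phi>, of x] by simp
    qed
    then have "(\<Sum>b\<in>B. \<bar>x \<bullet> b\<bar> - s b) \<le> (\<Sum>b\<in>B. p)" by (rule sum_mono)
    then show ?thesis using c(2)[of x] by (simp add: sum_subtractf n_def)
  qed
  have "\<forall>\<^sub>F x in at_infinity. ereal (c / (2 * n)) \<le> \<phi> x / ereal (norm x)"
    unfolding eventually_at_infinity
  \<comment> \<open>Beyond \<open>2 * sum s B / c\<close> the constant term uses up at most half of
    the linear growth, which leaves the slope \<open>c / (2 * n)\<close>. The bound 1 keeps the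
    denominator positive.\<close>
  proof (intro exI[of _ "max 1 (2 * sum s B / c)"] allI impI)
    fix x :: 'a assume x: "max 1 (2 * sum s B / c) \<le> norm x"
    then have x1: "0 < norm x" and x2: "2 * sum s B \<le> c * norm x" using c by (auto simp: field_simps)
    show "ereal (c / (2 * n)) \<le> \<phi> x / ereal (norm x)"
    proof (cases "\<phi> x")
      case (real p)
      have "c * norm x \<le> 2 * n * p" using low[OF real] x2 by simp
      then show ?thesis using real x1 n by (simp add: field_simps)
    next
      case PInf
      then show ?thesis using x1 by simp
    next
      case MInf
      then show ?thesis using admissible_not_MInf[OF \<phi>] by simp
    qed
  qed
  then have "ereal (c / (2 * n)) \<le> Liminf at_infinity (\<lambda>x. \<phi> x / ereal (norm x))"
    by (rule Liminf_bounded)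
  with less_le_trans[of 0 "ereal (c / (2 * n))"] c n
  show ?thesis using admissible_Conv[OF \<phi>] by (simp add: Lclass_def)
qed

text \<open>The added term has mean 0, so the perturbed \<open>conjugate \<phi>\<close> still
  satisfies the integral constraint. Conjugating twice can only lower it, so the constraint passes
  to the conjugate of the new function. Evenness of \<open>g\<close> keeps the competitor
  even.\<close>

lemma admissible_perturb:
  assumes \<phi>: "admissible \<mu> \<phi>"
    and g: "g \<in> borel_measurable borel" "\<And>y. \<bar>g y\<bar> \<le> C" "\<And>y. g (- y) = g y"
    and t: "0 \<le> t"
  shows "admissible \<mu> (conjugate (\<lambda>y. conjugate \<phi> y + ereal (t * (g y - (\<integral>y. g y \<partial>\<mu>)))))"
proof -
  note [measurable] = g(1)
  define a where "a = (\<integral>y. g y \<partial>\<mu>)"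
  have intg: "integrable \<mu> g" by (rule integrable_const_bound[of _ C]) (use g(2) in auto)
  have C: "0 \<le> C" using g(2)[of 0] by simp
  have a: "\<bar>a\<bar> \<le> C"
    unfolding a_def using g(2) intg
    by (auto simp: abs_le_iff minus_le_iff intro!: integral_le_const integral_ge_const)
  define f where "f y = conjugate \<phi> y + ereal (t * (g y - a))" for y
  define \<psi> where "\<psi> = conjugate f"
  obtain c where c: "\<phi> 0 = ereal c" "0 \<le> c" "\<And>y. ereal (- c) \<le> conjugate \<phi> y"
    using admissible_at_0[OF \<phi>] by blast
  \<comment> \<open>Since \<open>g\<close> and its mean are bounded by \<open>C\<close>, the
    perturbation is at most \<open>t * (2 * C)\<close>; this shift keeps the integrand nonnegative
    before and after it.\<close>
  define m where "m = c + t * (2 * C)"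
  have m: "0 \<le> m" "c \<le> m" using c t C by (auto simp: m_def)
  have th: "\<bar>t * (g y - a)\<bar> \<le> t * (2 * C)" for y
    unfolding abs_mult using t g(2)[of y] a by (auto intro!: mult_mono)
  have "\<psi> 0 \<le> conjugate (conjugate \<phi>) 0 + ereal (t * (2 * C))"
    unfolding \<psi>_def f_def by (rule conjugate_perturb_le(1)[OF th])
  then have \<psi>0: "\<psi> 0 \<le> ereal m" using c(1) admissible_biconjugate[OF \<phi>] by (simp add: m_def)
  have "(\<integral>\<^sup>+ y. e2ennreal (conjugate \<psi> y + ereal m) \<partial>\<mu>) \<le> (\<integral>\<^sup>+ y. e2ennreal (f y + ereal m) \<partial>\<mu>)"
    unfolding \<psi>_def by (intro nn_integral_mono e2ennreal_mono add_right_mono conjugate_conjugate_le)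
  also have "\<dots> \<le> ennreal m"
  proof -
    \<comment> \<open>Adding \<open>t * (C + a)\<close> turns the signed identity into one between
      nonnegative terms, to which additivity of the nonnegative integral applies.\<close>
    have eq: "e2ennreal (f y + ereal m) + ennreal (t * (C + a))
        = e2ennreal (conjugate \<phi> y + ereal m) + ennreal (t * (g y + C))" for y
    proof (cases "conjugate \<phi> y")
      case (real r)
      have "- c \<le> r" using c(3)[of y] real by simp
      then have "0 \<le> r + t * (g y - a) + m" "0 \<le> r + m" using th[of y] t C m by (auto simp: m_def)
      moreover have "0 \<le> t * (C + a)" "0 \<le> t * (g y + C)" using t a g(2)[of y] by (auto intro!: mult_nonneg_nonneg)
      ultimately show ?thesis using real by (simp add: f_def algebra_simps flip: ennreal_plus)
    next
      case MInf then show ?thesis using c(3)[of y] by simp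
    qed (simp add: f_def)
    have "(\<integral>\<^sup>+ y. e2ennreal (f y + ereal m) \<partial>\<mu>) + ennreal (t * (C + a))
        = (\<integral>\<^sup>+ y. e2ennreal (f y + ereal m) + ennreal (t * (C + a)) \<partial>\<mu>)"
      unfolding f_def by (subst nn_integral_add) auto
    also have "\<dots> = (\<integral>\<^sup>+ y. e2ennreal (conjugate \<phi> y + ereal m) \<partial>\<mu>) + (\<integral>\<^sup>+ y. ennreal (t * (g y + C)) \<partial>\<mu>)"
      unfolding eq by (rule nn_integral_add) auto
    also have "(\<integral>\<^sup>+ y. ennreal (t * (g y + C)) \<partial>\<mu>) = ennreal (\<integral>y. t * (g y + C) \<partial>\<mu>)"
    proof (rule nn_integral_eq_integral)
      show "integrable \<mu> (\<lambda>y. t * (g y + C))" using intg by (intro integrable_mult_right Bochner_Integration.integrable_add) auto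
      show "AE y in \<mu>. 0 \<le> t * (g y + C)" using g(2) t by (intro AE_I2 mult_nonneg_nonneg) (auto simp: abs_le_iff minus_le_iff add.commute real_add_le_0_iff add_increasing2, smt (verit))
    qed
    also have "(\<integral>y. t * (g y + C) \<partial>\<mu>) = t * (C + a)"
      using intg using prob_space by (simp add: a_def add.commute)
    also have "(\<integral>\<^sup>+ y. e2ennreal (conjugate \<phi> y + ereal m) \<partial>\<mu>) \<le> ennreal m"
      using m c(1) by (intro admissible_integral_le[OF \<phi>]) simp
    finally show ?thesis by (simp add: add_right_mono)
  qed
  finally have "(\<integral>\<^sup>+ y. e2ennreal (conjugate \<psi> y + ereal m) \<partial>\<mu>) \<le> ennreal m" .
  moreover have "\<psi> (- x) = \<psi> x" for x
    unfolding \<psi>_def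
    by (rule conjugate_even) (simp add: f_def g(3) conjugate_even admissible_even[OF \<phi>])
  ultimately show ?thesis
    unfolding admissible_def using m(1) \<psi>0 conjugate_triple[of f]
    by (auto simp: \<psi>_def f_def[abs_def] a_def)
qed

end

section \<open>The Euler-Lagrange equation\<close>

text \<open>This is integration against the moment measure without its constant, written on the
  source space in the form in which the derivative of \<open>gauss_functional\<close>
  arises.\<close>

definition grad_pairing :: "('a::euclidean_space \<Rightarrow> ereal) \<Rightarrow> ('a \<Rightarrow> real) \<Rightarrow> real" where
  "grad_pairing \<phi> h =
    (\<integral>x. exp_half_sq (\<phi> x) * exp (- (norm x)\<^sup>2 / 2) * indicator (grad_dom \<phi>) x * h (grad \<phi> x) \<partial>lborel)"

lemma exp_half_sq_bounds: "0 \<le> exp_half_sq v" "exp_half_sq v \<le> 1"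
  by (auto simp: exp_half_sq_def)

lemma grad_pairing_integrable:
  fixes \<phi> :: "'a::euclidean_space \<Rightarrow> ereal"
  assumes \<phi>: "\<phi> \<in> Conv" and h: "h \<in> borel_measurable borel" "\<And>y. \<bar>h y\<bar> \<le> C"
  shows "integrable lborel (\<lambda>x. exp_half_sq (\<phi> x) * exp (- (norm x)\<^sup>2 / 2) * indicator (grad_dom \<phi>) x * h (grad \<phi> x))"
proof (rule Bochner_Integration.integrable_bound)
  note [measurable] = Conv_measurable[OF \<phi>] grad_borel_measurable[OF \<phi>] grad_dom_borel[OF \<phi>] h(1)
  show "integrable lborel (\<lambda>x::'a. C * exp (- (norm x)\<^sup>2 / 2))"
    by (intro integrable_mult_right integrable_gaussian)
  show "(\<lambda>x. exp_half_sq (\<phi> x) * exp (- (norm x)\<^sup>2 / 2) * indicator (grad_dom \<phi>) x * h (grad \<phi> x))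
      \<in> borel_measurable lborel" by measurable
  have C: "0 \<le> C" using h(2)[of 0] by simp
  show "AE x in lborel. norm (exp_half_sq (\<phi> x) * exp (- (norm x)\<^sup>2 / 2) * indicator (grad_dom \<phi>) x * h (grad \<phi> x))
      \<le> norm (C * exp (- (norm x)\<^sup>2 / 2))"
  proof (rule AE_I2)
    fix x
    have "\<bar>exp_half_sq (\<phi> x) * indicator (grad_dom \<phi>) x\<bar> * \<bar>h (grad \<phi> x)\<bar> \<le> 1 * C"
      using exp_half_sq_bounds[of "\<phi> x"] h(2) by (intro mult_mono) (auto simp: indicator_def)
    then have "\<bar>exp_half_sq (\<phi> x) * indicator (grad_dom \<phi>) x\<bar> * \<bar>h (grad \<phi> x)\<bar> * exp (- (norm x)\<^sup>2 / 2)
        \<le> 1 * C * exp (- (norm x)\<^sup>2 / 2)" by (rule mult_right_mono) simp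
    then show "norm (exp_half_sq (\<phi> x) * exp (- (norm x)\<^sup>2 / 2) * indicator (grad_dom \<phi>) x * h (grad \<phi> x))
      \<le> norm (C * exp (- (norm x)\<^sup>2 / 2))" using C by (simp add: abs_mult mult_ac)
  qed
qed

lemma grad_pairing_lin:
  assumes \<phi>: "\<phi> \<in> Conv" and h: "h \<in> borel_measurable borel" "\<And>y. \<bar>h y\<bar> \<le> C"
  shows "grad_pairing \<phi> (\<lambda>y. a * h y + b) = a * grad_pairing \<phi> h + b * grad_pairing \<phi> (\<lambda>_. 1)"
proof -
  have "grad_pairing \<phi> (\<lambda>y. a * h y + b) = (\<integral>x.
      a * (exp_half_sq (\<phi> x) * exp (- (norm x)\<^sup>2 / 2) * indicator (grad_dom \<phi>) x * h (grad \<phi> x)) +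
      b * (exp_half_sq (\<phi> x) * exp (- (norm x)\<^sup>2 / 2) * indicator (grad_dom \<phi>) x * 1) \<partial>lborel)"
    unfolding grad_pairing_def by (intro Bochner_Integration.integral_cong refl) (simp add: algebra_simps)
  also have "\<dots> = a * grad_pairing \<phi> h + b * grad_pairing \<phi> (\<lambda>_. 1)"
    unfolding grad_pairing_def
    by (subst Bochner_Integration.integral_add[OF integrable_mult_right integrable_mult_right])
       (use grad_pairing_integrable[OF \<phi> h] grad_pairing_integrable[OF \<phi>, of "\<lambda>_. 1" 1] in simp_all)
  finally show ?thesis .
qed

lemma grad_pairing_reflect:
  assumes \<phi>: "\<phi> \<in> Conv" "\<And>x. \<phi> (- x) = \<phi> x" and h: "h \<in> borel_measurable borel"
  shows "grad_pairing \<phi> (\<lambda>y. h (- y)) = grad_pairing \<phi> h"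
proof -
  note [measurable] = Conv_measurable[OF \<phi>(1)] grad_borel_measurable[OF \<phi>(1)] grad_dom_borel[OF \<phi>(1)] h
  have "grad_pairing \<phi> h = (\<integral>x. exp_half_sq (\<phi> x) * exp (- (norm x)\<^sup>2 / 2) * indicator (grad_dom \<phi>) x * h (grad \<phi> x)
      \<partial>distr lborel borel uminus)"
    unfolding lborel_distr_uminus_euclidean grad_pairing_def ..
  also have "\<dots> = (\<integral>x. exp_half_sq (\<phi> (- x)) * exp (- (norm (- x))\<^sup>2 / 2) * indicator (grad_dom \<phi>) (- x) * h (grad \<phi> (- x)) \<partial>lborel)"
    by (rule integral_distr) measurable
  also have "\<dots> = grad_pairing \<phi> (\<lambda>y. h (- y))"
    unfolding grad_pairing_def using grad_reflect[of \<phi>, OF \<phi>(2)]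
    by (intro Bochner_Integration.integral_cong refl) (simp add: \<phi>(2) indicator_def)
  finally show ?thesis ..
qed

lemma integral_gaussian_moment_measure:
  fixes \<phi> :: "'a::euclidean_space \<Rightarrow> ereal"
  assumes \<phi>: "\<phi> \<in> Conv" and h: "h \<in> borel_measurable borel"
  shows "integral\<^sup>L (gaussian_moment_measure \<phi>) h = gauss_const TYPE('a) * grad_pairing \<phi> h"
proof -
  note [measurable] = Conv_measurable[OF \<phi>] grad_borel_measurable[OF \<phi>] grad_dom_borel[OF \<phi>] h
  define w where "w x = gauss_const TYPE('a) * exp_half_sq (\<phi> x) * exp (- (norm x)\<^sup>2 / 2) * indicator (grad_dom \<phi>) x" for x
  have w: "0 \<le> w x" for x using exp_half_sq_bounds(1) by (simp add: w_def gauss_const_def)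
  have [measurable]: "w \<in> borel_measurable borel" unfolding w_def by measurable
  have "gaussian_moment_measure \<phi> = distr (density lborel (\<lambda>x. ennreal (w x))) borel (grad \<phi>)"
    unfolding gaussian_moment_measure_def w_def
    by (intro arg_cong2[where f = "\<lambda>M. distr M borel"] arg_cong[where f = "density lborel"] ext refl)
       (auto simp: indicator_def)
  then have "integral\<^sup>L (gaussian_moment_measure \<phi>) h = (\<integral>x. h (grad \<phi> x) \<partial>density lborel (\<lambda>x. ennreal (w x)))"
    by (simp add: integral_distr)
  also have "\<dots> = (\<integral>x. w x *\<^sub>R h (grad \<phi> x) \<partial>lborel)"
    by (rule integral_density) (auto simp: w)
  also have "\<dots> = gauss_const TYPE('a) * grad_pairing \<phi> h"
    unfolding grad_pairing_def by (subst integral_mult_right_zero[symmetric]) (simp add: w_def mult_ac)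
  finally show ?thesis .
qed

context spanning_even_measure
begin

lemma integral_reflect:
  fixes g :: "'a \<Rightarrow> real"
  assumes [measurable]: "g \<in> borel_measurable borel"
  shows "(\<integral>y. g (- y) \<partial>\<mu>) = (\<integral>y. g y \<partial>\<mu>)"
proof -
  have "distr \<mu> borel uminus = \<mu>"
  proof (rule measure_eqI)
    fix A assume "A \<in> sets (distr \<mu> borel uminus)"
    then have A: "A \<in> sets borel" by simp
    have "uminus -` A = uminus ` A" by (force simp: image_iff)
    then show "emeasure (distr \<mu> borel uminus) A = emeasure \<mu> A"
      using A even by (subst emeasure_distr) (auto simp: even_measure_def)
  qed simp
  then have "(\<integral>y. g y \<partial>\<mu>) = (\<integral>y. g y \<partial>distr \<mu> borel uminus)" by simp
  also have "\<dots> = (\<integral>y. g (- y) \<partial>\<mu>)" by (rule integral_distr) measurable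
  finally show ?thesis ..
qed

text \<open>Competitors must be even, so maximality first gives an inequality for even
  \<open>g\<close>; \<open>- g\<close> gives the reverse one. A general \<open>g\<close> has the
  same integrals as its even part, since both \<open>\<mu>\<close> and the pairing are invariant
  under reflection.\<close>

lemma euler_lagrange:
  assumes \<phi>: "admissible \<mu> \<phi>" and max: "\<And>\<psi>. admissible \<mu> \<psi> \<Longrightarrow> gauss_functional \<psi> \<le> gauss_functional \<phi>"
    and g: "continuous_on UNIV g" "\<And>y. \<bar>g y\<bar> \<le> C"
  shows "grad_pairing \<phi> g = (\<integral>y. g y \<partial>\<mu>) * grad_pairing \<phi> (\<lambda>_. 1)"
proof -
  note Conv = admissible_Conv[OF \<phi>]
  have one_sided: "grad_pairing \<phi> g \<le> (\<integral>y. g y \<partial>\<mu>) * grad_pairing \<phi> (\<lambda>_. 1)"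
    if g: "continuous_on UNIV g" "\<And>y. \<bar>g y\<bar> \<le> C" "\<And>y. g (- y) = g y" for g
  proof -
    have gm: "g \<in> borel_measurable borel" by (rule borel_measurable_continuous_onI[OF g(1)])
    define a where "a = (\<integral>y. g y \<partial>\<mu>)"
    define t where "t k = 1 / real (Suc k)" for k
    have t: "0 < t k" for k by (simp add: t_def)
    have "t \<longlonglongrightarrow> 0" unfolding t_def by (rule LIMSEQ_inverse_real_of_nat[unfolded inverse_eq_divide])
    moreover have "continuous_on UNIV (\<lambda>y. g y - a)" by (intro continuous_intros g(1))
    moreover have "\<bar>g y - a\<bar> \<le> C + \<bar>a\<bar>" for y using g(2)[of y] by simp
    ultimately have lim: "(\<lambda>k. (gauss_functional (conjugate (\<lambda>y. conjugate \<phi> y + ereal (t k * (g y - a)))) - gauss_functional \<phi>) / t k)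
        \<longlonglongrightarrow> grad_pairing \<phi> (\<lambda>y. g y - a)"
      unfolding grad_pairing_def
      by (intro gauss_functional_derivative[OF Conv admissible_biconjugate[OF \<phi>]] t)
    have "gauss_functional (conjugate (\<lambda>y. conjugate \<phi> y + ereal (t k * (g y - a)))) \<le> gauss_functional \<phi>" for k
      unfolding a_def by (intro max admissible_perturb[OF \<phi> gm g(2,3)] less_imp_le t)
    then have "(gauss_functional (conjugate (\<lambda>y. conjugate \<phi> y + ereal (t k * (g y - a)))) - gauss_functional \<phi>) / t k \<le> 0" for k
      using t[of k] by (simp add: divide_le_0_iff)
    then have "grad_pairing \<phi> (\<lambda>y. g y - a) \<le> 0" by (intro LIMSEQ_le_const2[OF lim]) auto
    then show ?thesis using grad_pairing_lin[OF Conv gm g(2), of 1 "- a"] by (simp add: a_def)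
  qed
  have even_case: "grad_pairing \<phi> g = (\<integral>y. g y \<partial>\<mu>) * grad_pairing \<phi> (\<lambda>_. 1)"
    if g: "continuous_on UNIV g" "\<And>y. \<bar>g y\<bar> \<le> C" "\<And>y. g (- y) = g y" for g
  proof (rule antisym)
    show "grad_pairing \<phi> g \<le> (\<integral>y. g y \<partial>\<mu>) * grad_pairing \<phi> (\<lambda>_. 1)" by (rule one_sided[OF g])
    have "grad_pairing \<phi> (\<lambda>y. - g y) \<le> (\<integral>y. - g y \<partial>\<mu>) * grad_pairing \<phi> (\<lambda>_. 1)"
      using g by (intro one_sided continuous_intros) auto
    then show "(\<integral>y. g y \<partial>\<mu>) * grad_pairing \<phi> (\<lambda>_. 1) \<le> grad_pairing \<phi> g"
      using grad_pairing_lin[OF Conv borel_measurable_continuous_onI[OF g(1)] g(2), of "- 1" 0] by simp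
  qed
  have gm [measurable]: "g \<in> borel_measurable borel" by (rule borel_measurable_continuous_onI[OF g(1)])
  have gm' [measurable]: "(\<lambda>y. g (- y)) \<in> borel_measurable borel" by measurable
  \<comment> \<open>Passing to the even part also preserves the bound \<open>C\<close>.\<close>
  define e where "e y = (g y + g (- y)) / 2" for y
  have ce: "continuous_on UNIV e"
    unfolding e_def by (intro continuous_intros g(1) continuous_on_compose2[OF g(1)]) auto
  have eC: "\<bar>e y\<bar> \<le> C" for y using g(2)[of y] g(2)[of "- y"] by (simp add: e_def)
  have "grad_pairing \<phi> e = (\<integral>y. e y \<partial>\<mu>) * grad_pairing \<phi> (\<lambda>_. 1)"
    by (rule even_case[OF ce eC]) (simp add: e_def add.commute)
  moreover have "(\<integral>y. e y \<partial>\<mu>) = (\<integral>y. g y \<partial>\<mu>)"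
  proof -
    have "integrable \<mu> g" "integrable \<mu> (\<lambda>y. g (- y))"
      by (auto intro!: integrable_const_bound[of _ C] simp: g(2))
    then show ?thesis unfolding e_def using integral_reflect[OF gm] by simp
  qed
  moreover have "grad_pairing \<phi> e = grad_pairing \<phi> g"
  proof -
    have "grad_pairing \<phi> e = (\<integral>x. (1/2) * (exp_half_sq (\<phi> x) * exp (- (norm x)\<^sup>2 / 2) * indicator (grad_dom \<phi>) x * g (grad \<phi> x)) +
      (1/2) * (exp_half_sq (\<phi> x) * exp (- (norm x)\<^sup>2 / 2) * indicator (grad_dom \<phi>) x * g (- grad \<phi> x)) \<partial>lborel)"
      unfolding grad_pairing_def e_def by (intro Bochner_Integration.integral_cong refl) (simp add: algebra_simps)
    also have "\<dots> = (1/2) * grad_pairing \<phi> g + (1/2) * grad_pairing \<phi> (\<lambda>y. g (- y))"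
      unfolding grad_pairing_def
      by (subst Bochner_Integration.integral_add[OF integrable_mult_right integrable_mult_right])
        (auto simp only: integral_mult_right_zero intro!: grad_pairing_integrable[OF Conv gm g(2)] grad_pairing_integrable[OF Conv gm' g(2)])
    finally show ?thesis using grad_pairing_reflect[OF Conv admissible_even[OF \<phi>] gm] by simp
  qed
  ultimately show ?thesis by simp
qed

theorem exists_gaussian_moment_potential:
  obtains \<phi> where "\<phi> \<in> Lclass"
    "\<mu> = scale_measure (1 / emeasure (gaussian_moment_measure \<phi>) UNIV) (gaussian_moment_measure \<phi>)"
proof -
  obtain \<phi> where \<phi>: "admissible \<mu> \<phi>" "0 < gauss_functional \<phi>"
    and max: "\<And>\<psi>. admissible \<mu> \<psi> \<Longrightarrow> gauss_functional \<psi> \<le> gauss_functional \<phi>"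
    using gauss_functional_maximizer by blast
  note Conv = admissible_Conv[OF \<phi>(1)]
  note [measurable] = Conv_measurable[OF Conv] grad_borel_measurable[OF Conv] grad_dom_borel[OF Conv]
  define \<nu> where "\<nu> = gaussian_moment_measure \<phi>"
  have sets_\<nu>: "sets \<nu> = sets borel" by (simp add: \<nu>_def gaussian_moment_measure_def)
  define w where "w x = exp_half_sq (\<phi> x) * exp (- (norm x)\<^sup>2 / 2) * indicator (grad_dom \<phi>) x" for x
  have w0: "0 \<le> w x" for x using exp_half_sq_bounds(1) by (simp add: w_def)
  have intw: "integrable lborel w"
    using grad_pairing_integrable[OF Conv, of "\<lambda>_. 1" 1] by (simp add: w_def[abs_def])
  define W where "W = grad_pairing \<phi> (\<lambda>_. 1)"
  have W_eq: "W = (\<integral>x. w x \<partial>lborel)" by (simp add: W_def grad_pairing_def w_def)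
  \<comment> \<open>If the moment measure vanished, its weight would be 0 almost everywhere. The
    weight is positive wherever the gradient exists, hence almost everywhere on the effective
    domain, so \<open>\<phi>\<close> would be \<open>\<infinity>\<close> almost everywhere, against
    \<open>0 < gauss_functional \<phi>\<close>.\<close>
  have "W \<noteq> 0"
  proof
    assume "W = 0"
    then have "AE x in lborel. w x = 0"
      using integral_nonneg_eq_0_iff_AE[OF intw] w0 by (simp add: W_eq)
    with Conv_AE_grad_dom[OF Conv] have "AE x in lborel. \<phi> x = \<infinity>"
    proof eventually_elim
      case (elim x)
      show ?case
      proof (rule ccontr)
        assume "\<phi> x \<noteq> \<infinity>"
        then have "x \<in> grad_dom \<phi>" using elim(1) by (simp add: effdom_def less_top[symmetric])
        then show False using elim(2) \<open>\<phi> x \<noteq> \<infinity>\<close> admissible_not_MInf[OF \<phi>(1), of x]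
          by (cases "\<phi> x") (auto simp: w_def exp_half_sq_def)
      qed
    qed
    then show False
      using \<phi>(2) gauss_functional_pos_iff[OF admissible_measurable[OF \<phi>(1)] admissible_not_MInf[OF \<phi>(1)]] by simp
  qed
  moreover have "0 \<le> W" unfolding W_eq by (intro integral_nonneg_AE) (simp add: w0)
  ultimately have W: "0 < W" by simp
  have gc: "0 < gauss_const TYPE('a)" by (simp add: gauss_const_def)
  have total: "emeasure \<nu> UNIV = ennreal (gauss_const TYPE('a) * W)"
  proof -
    have "emeasure \<nu> UNIV = (\<integral>\<^sup>+ x. ennreal (gauss_const TYPE('a) * w x) \<partial>lborel)"
      unfolding \<nu>_def gaussian_moment_measure_def w_def
      by (subst emeasure_distr; simp?)+ (subst emeasure_density; auto simp: indicator_def mult.assoc intro!: nn_integral_cong)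
    also have "\<dots> = ennreal (\<integral>x. gauss_const TYPE('a) * w x \<partial>lborel)"
      using intw gc w0 by (intro nn_integral_eq_integral) auto
    finally show ?thesis by (simp add: W_eq)
  qed
  \<comment> \<open>This is the total mass of \<open>\<nu>\<close>; by the Euler-Lagrange equation,
    integrals of bounded continuous functions against \<open>\<nu>\<close> are \<open>T\<close>
    times those against \<open>\<mu>\<close>.\<close>
  define T where "T = gauss_const TYPE('a) * W"
  have T: "0 < T" using gc W by (simp add: T_def)
  interpret \<nu>: finite_measure \<nu>
    using total sets_eq_imp_space_eq[OF sets_\<nu>] by (intro finite_measureI) simp
  have scale: "1 / emeasure \<nu> UNIV = ennreal (1 / T)"
    using T total by (simp add: T_def[symmetric] divide_ennreal flip: ennreal_1)
  have "\<mu> = scale_measure (1 / emeasure \<nu> UNIV) \<nu>"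
  proof (rule borel_measure_eqI_bounded_continuous)
    show "finite_measure \<mu>" by (rule finite_measure_axioms)
    show "sets \<mu> = sets borel" by simp
    show "sets (scale_measure (1 / emeasure \<nu> UNIV) \<nu>) = sets borel" by (simp add: sets_\<nu>)
    show "finite_measure (scale_measure (1 / emeasure \<nu> UNIV) \<nu>)"
      unfolding scale by (intro finite_measureI) (simp add: space_scale_measure ennreal_mult_eq_top_iff)
    fix g :: "'a \<Rightarrow> real" assume g: "continuous_on UNIV g" "\<And>x. 0 \<le> g x" "\<And>x. g x \<le> 1"
    have gm: "g \<in> borel_measurable borel" by (rule borel_measurable_continuous_onI[OF g(1)])
    have "integral\<^sup>L (scale_measure (1 / emeasure \<nu> UNIV) \<nu>) g = (1 / T) * integral\<^sup>L \<nu> g"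
    proof -
      have gm\<nu>: "g \<in> borel_measurable \<nu>" using gm sets_\<nu> by (simp cong: measurable_cong_sets)
      then have "(\<integral>\<^sup>+ x. ennreal (g x) \<partial>scale_measure (ennreal (1 / T)) \<nu>) = ennreal (1 / T) * (\<integral>\<^sup>+ x. ennreal (g x) \<partial>\<nu>)"
        by (intro nn_integral_scale_measure) simp
      then show ?thesis
        using gm\<nu> g(2) T unfolding scale by (simp add: integral_eq_nn_integral enn2real_mult)
    qed
    also have "integral\<^sup>L \<nu> g = T * (\<integral>y. g y \<partial>\<mu>)"
      unfolding \<nu>_def integral_gaussian_moment_measure[OF Conv gm]
      using euler_lagrange[OF \<phi>(1) max g(1), of 1] g by (simp add: T_def W_def abs_of_nonneg)
    finally show "integral\<^sup>L \<mu> g = integral\<^sup>L (scale_measure (1 / emeasure \<nu> UNIV) \<nu>) g" using T by simp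
  qed
  then show ?thesis using admissible_Lclass[OF \<phi>(1)] by (intro that[of \<phi>]) (simp_all add: \<nu>_def)
qed

end

section \<open>From probability measures to finite measures\<close>

theorem theorem4p6:
  fixes \<mu> :: "(real ^ 'n) measure"
  assumes "sets \<mu> = sets borel"
    and "finite_measure \<mu>"
    and "emeasure \<mu> UNIV \<noteq> 0"
    and "even_measure \<mu>"
    and "\<And>S. subspace S \<Longrightarrow> dim S < CARD('n) \<Longrightarrow> emeasure \<mu> (- S) \<noteq> 0"
    and "(\<integral>\<^sup>+ x. ennreal (norm x) \<partial>\<mu>) < \<infinity>"
  shows "\<exists>\<phi>\<in>Lclass.
    \<mu> = scale_measure (emeasure \<mu> UNIV / emeasure (gaussian_moment_measure \<phi>) UNIV)
          (gaussian_moment_measure \<phi>)"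
proof -
  define m where "m = emeasure \<mu> UNIV"
  have space: "space \<mu> = UNIV" using sets_eq_imp_space_eq[OF assms(1)] by simp
  have m: "m \<noteq> 0" "m \<noteq> top"
    using assms(3) finite_measure.emeasure_finite[OF assms(2), of UNIV] by (simp_all add: m_def)
  define \<mu>' where "\<mu>' = scale_measure (1 / m) \<mu>"
  \<comment> \<open>The factor must be nonzero for the spanning condition to survive scaling, and
    finite for the moment condition; the last equation undoes the normalization at the end.\<close>
  have inv: "1 / m \<noteq> 0" "1 / m \<noteq> top" "m * (1 / m) = 1"
    using m by (auto simp: ennreal_divide_eq_0_iff ennreal_divide_eq_top_iff ennreal_times_divide less_top intro: ennreal_divide_self)
  have "prob_space \<mu>'"
  proof
    show "emeasure \<mu>' (space \<mu>') = 1"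
      using inv(3) by (simp add: \<mu>'_def space_scale_measure space m_def[symmetric] mult.commute)
  qed
  then interpret prob_space \<mu>' .
  interpret spanning_even_measure \<mu>'
  proof unfold_locales
    show "sets \<mu>' = sets borel" using assms(1) by (simp add: \<mu>'_def)
    show "even_measure \<mu>'" using assms(4) by (simp add: \<mu>'_def even_measure_def)
    show "emeasure \<mu>' (- S) \<noteq> 0" if "subspace S" "dim S < DIM(real ^ 'n)" for S
      using assms(5)[of S] that inv by (simp add: \<mu>'_def)
    have "norm \<in> borel_measurable \<mu>" using assms(1) by (simp cong: measurable_cong_sets)
    then show "(\<integral>\<^sup>+ x. ennreal (norm x) \<partial>\<mu>') < \<infinity>"
      using assms(6) inv unfolding \<mu>'_def
      by (subst nn_integral_scale_measure) (auto simp: ennreal_mult_eq_top_iff less_top[symmetric])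
  qed
  obtain \<phi> where \<phi>: "\<phi> \<in> Lclass"
    "\<mu>' = scale_measure (1 / emeasure (gaussian_moment_measure \<phi>) UNIV) (gaussian_moment_measure \<phi>)"
    using exists_gaussian_moment_potential by blast
  have "\<mu> = scale_measure m \<mu>'" using inv(3) by (simp add: \<mu>'_def)
  also have "\<dots> = scale_measure (m / emeasure (gaussian_moment_measure \<phi>) UNIV) (gaussian_moment_measure \<phi>)"
    by (subst \<phi>(2)) (simp add: ennreal_times_divide)
  finally show ?thesis using \<phi>(1) unfolding m_def by blast
qed

end
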